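(* Let $(M,\nabla)$ be an affine manifold (a manifold with a flat torsion-free linear connection) and $(TM,M,\mathrm{Id}_{TM},\nabla)$ its associated left symmetric algebroid. Let $h$ be a symmetric bivector field on $M$ and let $\mathcal D$ be the right-anchored product on $(T^*M,M,h_\#)$ given, for $\alpha,\beta\in\Omega^1(M)$ and $X$ a vector field, by $$\prec\mathcal D_\alpha\beta,X\succ=(\nabla_Xh)(\alpha,\beta)+\prec\nabla^*_{h_\#(\alpha)}\beta,X\succ .$$ Then $(T^*M,M,h_\#,\mathcal D)$ is a left symmetric algebroid compatible with $(TM,M,\mathrm{Id}_{TM},\nabla)$ if and only if, for all $\alpha,\beta,\gamma\in\Omega^1(M)$, $$(\nabla_{h_\#(\alpha)}h)(\beta,\gamma)-(\nabla_{h_\#(\beta)}h)(\alpha,\gamma)=0 .$$ In this case, $TM\oplus T^*M$ with anchor $\mathrm{Id}_{TM}+0$ (i.e. $X+\alpha\mapsto X$), bracket $[X+\alpha,Y+\beta]^{\triangleright}=[X,Y]+\nabla_X^*\beta-\nabla_Y^*\alpha$, metric $$\langle X+\alpha,Y+\beta\rangle_h=\prec\alpha,Y\succ+\prec\beta,X\succ-2h(\alpha,\beta)$$ and endomorphism $K_h(X+\alpha)=X-2h_\#(\alpha)-\alpha$ is a para-Kähler Lie algebroid. Moreover, the associated symplectic form $\Omega_0(a,b)=\langle K_ha,b\rangle_h$ is given by $\Omega_0(X+\alpha,Y+\beta)=\prec\beta,X\succ-\prec\alpha,Y\succ$.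
   Context: All objects are smooth and real; $\prec\cdot,\cdot\succ$ is the pairing between a bundle and its dual. A symmetric bivector field is a symmetric section $h$ of $TM\otimes TM$ (possibly degenerate), viewed as a bilinear form on $T^*M$; $h_\#:T^*M\to TM$ is defined by $\beta(h_\#(\alpha))=h(\alpha,\beta)$. $\nabla^*$ is the dual connection on $T^*M$. An anchored vector bundle $(A,M,\rho)$ is a vector bundle $A\to M$ with a bundle map $\rho:A\to TM$ over the identity. A Lie algebroid is an anchored vector bundle with a Lie bracket $[\,,]_A$ on $\Gamma(A)$ with $[a,fb]_A=f[a,b]_A+\rho(a)(f)b$. A right-anchored product on $(A,M,\rho)$ is an $\mathbb R$-bilinear map $T:\Gamma(A)\times\Gamma(A)\to\Gamma(A)$ with $T_{fa}b=fT_ab$ and $T_a(fb)=fT_ab+\rho(a)(f)b$; its bracket is $[a,b]_T=T_ab-T_ba$ and its curvature $R^T(a,b)c=T_aT_bc-T_bT_ac-T_{[a,b]_T}c$. $(A,M,\rho,T)$ is a left symmetric algebroid if $R^T=0$ identically. Compatibility: let $(B,M,\rho_0,S)$ and $(B^*,M,\rho_1,T)$ be left symmetric algebroids on dual bundles. Put $\prec S_X^*\beta,Y\succ=\rho_0(X).\prec\beta,Y\succ-\prec\beta,S_XY\succ$ and $\prec\beta,T_\alpha^*X\succ=\rho_1(\alpha).\prec\beta,X\succ-\prec T_\alpha\beta,X\succ$, and on $(B\oplus B^*,M,\rho_0\oplus\rho_1)$ put $\overline\nabla_{X+\alpha}(Y+\beta)=S_XY+T_\alpha^*Y+S_X^*\beta+T_\alpha\beta$,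 with curvature $\overline R$. They are compatible if $\overline R(X,\alpha)Y=\overline R(Y,\alpha)X$ and $\overline R(\alpha,X)\beta=\overline R(\beta,X)\alpha$ for all $X,Y\in\Gamma(B)$, $\alpha,\beta\in\Gamma(B^* )$. A para-Kähler Lie algebroid is a Lie algebroid $(A,M,\rho,[\,,]_A)$ with a smooth nondegenerate symmetric bilinear form $\langle\,,\rangle$ on the fibers of $A$ and a bundle isomorphism $K:A\to A$ with $K^2=\mathrm{Id}_A$, $K$ skew-symmetric for $\langle\,,\rangle$, and $\nabla^{LC}K=0$ (i.e. $\nabla^{LC}_a(Kb)=K\nabla^{LC}_ab$). Here $\nabla^{LC}$ is the Levi-Civita $A$-connection, the unique right-anchored product on $(A,M,\rho)$ with $\rho(a).\langle b,c\rangle=\langle\nabla^{LC}_ab,c\rangle+\langle b,\nabla^{LC}_ac\rangle$ and $\nabla^{LC}_ab-\nabla^{LC}_ba=[a,b]_A$. *)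

theory Defs
  imports "HOL-Analysis.Analysis" "HOL-Library.Function_Algebras"
begin

text \<open>Function spaces as real vector spaces, with pointwise operations.  Tangent vectors,
  covectors and sections of bundles below all live in such spaces.\<close>

instantiation "fun" :: (type, scaleR) scaleR
begin
definition scaleR_fun :: "real \<Rightarrow> ('a \<Rightarrow> 'b) \<Rightarrow> 'a \<Rightarrow> 'b"
  where "scaleR_fun r f = (\<lambda>x. r *\<^sub>R f x)"
instance ..
end

instance "fun" :: (type, real_vector) real_vector
  by standard (auto simp: scaleR_fun_def plus_fun_def fun_eq_iff scaleR_add_right scaleR_add_left)

definition linear_map_on :: "'a::real_vector set \<Rightarrow> 'b::real_vector set \<Rightarrow> ('a \<Rightarrow> 'b) \<Rightarrow> bool"
  where "linear_map_on V W f \<longleftrightarrow>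
    (\<forall>x\<in>V. f x \<in> W) \<and> (\<forall>x\<in>V. \<forall>y\<in>V. f (x + y) = f x + f y) \<and>
    (\<forall>r. \<forall>x\<in>V. f (r *\<^sub>R x) = r *\<^sub>R f x)"

definition bilinear_map_on ::
    "'a::real_vector set \<Rightarrow> 'b::real_vector set \<Rightarrow> ('a \<Rightarrow> 'a \<Rightarrow> 'b) \<Rightarrow> bool"
  where "bilinear_map_on V W f \<longleftrightarrow>
    (\<forall>x\<in>V. linear_map_on V W (f x)) \<and> (\<forall>y\<in>V. linear_map_on V W (\<lambda>x. f x y))"


section \<open>Smooth manifolds\<close>

primrec Ck_on :: "nat \<Rightarrow> 'a::real_normed_vector set \<Rightarrow> ('a \<Rightarrow> 'b::real_normed_vector) \<Rightarrow> bool"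
  where
    "Ck_on 0 S f \<longleftrightarrow> continuous_on S f"
  | "Ck_on (Suc k) S f \<longleftrightarrow>
       (\<forall>x\<in>S. f differentiable (at x)) \<and> (\<forall>v. Ck_on k S (\<lambda>x. frechet_derivative f (at x) v))"

text \<open>Used on open sets only.\<close>

definition smooth_on :: "'a::real_normed_vector set \<Rightarrow> ('a \<Rightarrow> 'b::real_normed_vector) \<Rightarrow> bool"
  where "smooth_on S f \<longleftrightarrow> (\<forall>k. Ck_on k S f)"

text \<open>A manifold is a type \<open>'m\<close> that is Hausdorff and second countable, with an atlas of
  charts \<open>(U, \<phi>)\<close> into a Euclidean space \<open>'e\<close>.  The values of \<open>\<phi>\<close> outside \<open>U\<close> are irrelevant.\<close>

type_synonym ('m, 'e) atlas = "('m set \<times> ('m \<Rightarrow> 'e)) set"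

definition smooth_manifold ::
    "('m::{t2_space,second_countable_topology}, 'e::euclidean_space) atlas \<Rightarrow> bool"
  where "smooth_manifold A \<longleftrightarrow>
    (\<Union>(U, \<phi>)\<in>A. U) = UNIV \<and>
    (\<forall>(U, \<phi>)\<in>A. open U \<and> open (\<phi> ` U) \<and> inj_on \<phi> U \<and>
       homeomorphism U (\<phi> ` U) \<phi> (inv_into U \<phi>)) \<and>
    (\<forall>(U, \<phi>)\<in>A. \<forall>(V, \<psi>)\<in>A. smooth_on (\<phi> ` (U \<inter> V)) (\<lambda>x. \<psi> (inv_into U \<phi> x)))"

definition smooth_functions ::
    "('m::topological_space, 'e::euclidean_space) atlas \<Rightarrow> ('m \<Rightarrow> real) set"
  where "smooth_functions A =
    {f. \<forall>(U, \<phi>)\<in>A. smooth_on (\<phi> ` U) (\<lambda>x. f (inv_into U \<phi> x))}"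


section \<open>Vector bundles\<close>

text \<open>A vector bundle is given by its fibres, which are subspaces of one ambient vector space
  \<open>'v\<close>, and its smooth structure, which is given by the set of its smooth global sections.\<close>

record ('m, 'v) vbundle =
  fiber :: "'m \<Rightarrow> 'v set"
  sections :: "('m \<Rightarrow> 'v) set"

definition fun_mult :: "('m \<Rightarrow> real) \<Rightarrow> ('m \<Rightarrow> 'v::real_vector) \<Rightarrow> 'm \<Rightarrow> 'v"
  where "fun_mult f s = (\<lambda>p. f p *\<^sub>R s p)"

definition smooth_frame ::
    "('m::topological_space, 'v::real_vector) vbundle \<Rightarrow> 'm set \<Rightarrow> nat \<Rightarrow> (nat \<Rightarrow> 'm \<Rightarrow> 'v) \<Rightarrow> bool"
  where "smooth_frame E U k e \<longleftrightarrow>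
    open U \<and> (\<forall>i<k. e i \<in> sections E) \<and>
    (\<forall>q\<in>U. inj_on (\<lambda>i. e i q) {..<k} \<and> independent ((\<lambda>i. e i q) ` {..<k}) \<and>
           span ((\<lambda>i. e i q) ` {..<k}) = fiber E q)"

text \<open>The sections form a module over the smooth functions, being a section is a local
  property, and around each point there is a frame of \<open>k\<close> sections (\<open>k\<close> is the rank) in which
  every section has smooth coefficients.  By means of cut-off functions the members of a local
  frame and the coefficients can be taken to be globally defined, on a smaller neighbourhood.\<close>

definition vector_bundle ::
    "('m::topological_space, 'e::euclidean_space) atlas \<Rightarrow> ('m, 'v::real_vector) vbundle \<Rightarrow> bool"
  where "vector_bundle A E \<longleftrightarrow>
    (\<forall>p. subspace (fiber E p)) \<and>
    (\<forall>s\<in>sections E. \<forall>p. s p \<in> fiber E p) \<and>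
    0 \<in> sections E \<and>
    (\<forall>s\<in>sections E. \<forall>t\<in>sections E. s + t \<in> sections E) \<and>
    (\<forall>f\<in>smooth_functions A. \<forall>s\<in>sections E. fun_mult f s \<in> sections E) \<and>
    (\<forall>s. (\<forall>p. s p \<in> fiber E p) \<and>
         (\<forall>p. \<exists>U. open U \<and> p \<in> U \<and> (\<exists>t\<in>sections E. \<forall>q\<in>U. s q = t q)) \<longrightarrow> s \<in> sections E) \<and>
    (\<exists>k. \<forall>p. \<exists>U e. p \<in> U \<and> smooth_frame E U k e \<and>
       (\<forall>s\<in>sections E. \<exists>V c. open V \<and> p \<in> V \<and> V \<subseteq> U \<and> (\<forall>i<k. c i \<in> smooth_functions A) \<and>
          (\<forall>q\<in>V. s q = (\<Sum>i<k. c i q *\<^sub>R e i q))))"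

text \<open>Fibrewise application: of a bundle map to a section, and of a section of the dual
  bundle to a section (the pairing).\<close>

definition fib_app :: "('m \<Rightarrow> 'v \<Rightarrow> 'w) \<Rightarrow> ('m \<Rightarrow> 'v) \<Rightarrow> 'm \<Rightarrow> 'w"
  where "fib_app F s = (\<lambda>p. F p (s p))"

definition bundle_map ::
    "('m, 'v::real_vector) vbundle \<Rightarrow> ('m, 'w::real_vector) vbundle \<Rightarrow> ('m \<Rightarrow> 'v \<Rightarrow> 'w) \<Rightarrow> bool"
  where "bundle_map E F \<Phi> \<longleftrightarrow>
    (\<forall>p. linear_map_on (fiber E p) (fiber F p) (\<Phi> p)) \<and>
    (\<forall>s\<in>sections E. fib_app \<Phi> s \<in> sections F)"

definition bundle_iso ::
    "('m, 'v::real_vector) vbundle \<Rightarrow> ('m, 'w::real_vector) vbundle \<Rightarrow> ('m \<Rightarrow> 'v \<Rightarrow> 'w) \<Rightarrow> bool"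
  where "bundle_iso E F \<Phi> \<longleftrightarrow>
    bundle_map E F \<Phi> \<and> (\<forall>p. bij_betw (\<Phi> p) (fiber E p) (fiber F p))"

definition fiber_form ::
    "('m::topological_space, 'e::euclidean_space) atlas \<Rightarrow> ('m, 'v::real_vector) vbundle \<Rightarrow>
     ('m \<Rightarrow> 'v \<Rightarrow> 'v \<Rightarrow> real) \<Rightarrow> bool"
  where "fiber_form A E g \<longleftrightarrow>
    (\<forall>p. bilinear_map_on (fiber E p) UNIV (g p)) \<and>
    (\<forall>a\<in>sections E. \<forall>b\<in>sections E. (\<lambda>p. g p (a p) (b p)) \<in> smooth_functions A)"

definition symmetric_form :: "('m, 'v) vbundle \<Rightarrow> ('m \<Rightarrow> 'v \<Rightarrow> 'v \<Rightarrow> real) \<Rightarrow> bool"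
  where "symmetric_form E g \<longleftrightarrow> (\<forall>p. \<forall>u\<in>fiber E p. \<forall>v\<in>fiber E p. g p u v = g p v u)"

definition nondegenerate_form ::
    "('m, 'v::real_vector) vbundle \<Rightarrow> ('m \<Rightarrow> 'v \<Rightarrow> 'v \<Rightarrow> real) \<Rightarrow> bool"
  where "nondegenerate_form E g \<longleftrightarrow>
    (\<forall>p. \<forall>u\<in>fiber E p. (\<forall>v\<in>fiber E p. g p u v = 0) \<longrightarrow> u = 0)"

text \<open>Elements of a dual fibre are extended by \<open>0\<close> outside the fibre, so that equality in the
  type is equality of linear forms on the fibre.\<close>

definition dual_bundle ::
    "('m::topological_space, 'e::euclidean_space) atlas \<Rightarrow> ('m, 'v::real_vector) vbundle \<Rightarrow>
     ('m, 'v \<Rightarrow> real) vbundle"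
  where "dual_bundle A E =
    (let F = (\<lambda>p. {\<beta>. linear_map_on (fiber E p) UNIV \<beta> \<and> (\<forall>v. v \<notin> fiber E p \<longrightarrow> \<beta> v = 0)})
     in \<lparr>fiber = F,
         sections = {\<beta>. (\<forall>p. \<beta> p \<in> F p) \<and>
                        (\<forall>s\<in>sections E. fib_app \<beta> s \<in> smooth_functions A)}\<rparr>)"

definition sum_bundle :: "('m, 'v) vbundle \<Rightarrow> ('m, 'w) vbundle \<Rightarrow> ('m, 'v \<times> 'w) vbundle"
  where "sum_bundle E F =
    \<lparr>fiber = (\<lambda>p. fiber E p \<times> fiber F p),
     sections = {s. (\<lambda>p. fst (s p)) \<in> sections E \<and> (\<lambda>p. snd (s p)) \<in> sections F}\<rparr>"

definition inl_section :: "('m \<Rightarrow> 'v) \<Rightarrow> 'm \<Rightarrow> 'v \<times> 'w::zero"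
  where "inl_section X = (\<lambda>p. (X p, 0))"

definition inr_section :: "('m \<Rightarrow> 'w) \<Rightarrow> 'm \<Rightarrow> 'v::zero \<times> 'w"
  where "inr_section \<alpha> = (\<lambda>p. (0, \<alpha> p))"


section \<open>Tangent and cotangent bundle\<close>

text \<open>Tangent vectors at \<open>p\<close> are the derivations at \<open>p\<close> of the algebra of smooth functions,
  extended by \<open>0\<close> to nonsmooth functions.\<close>

type_synonym 'm tvec = "('m \<Rightarrow> real) \<Rightarrow> real"

definition tangent_space ::
    "('m::topological_space, 'e::euclidean_space) atlas \<Rightarrow> 'm \<Rightarrow> 'm tvec set"
  where "tangent_space A p =
    {v. linear_map_on (smooth_functions A) UNIV v \<and>
        (\<forall>f\<in>smooth_functions A. \<forall>g\<in>smooth_functions A.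
            v (\<lambda>q. f q * g q) = v f * g p + f p * v g) \<and>
        (\<forall>f. f \<notin> smooth_functions A \<longrightarrow> v f = 0)}"

definition tangent_bundle ::
    "('m::topological_space, 'e::euclidean_space) atlas \<Rightarrow> ('m, 'm tvec) vbundle"
  where "tangent_bundle A =
    \<lparr>fiber = tangent_space A,
     sections = {X. (\<forall>p. X p \<in> tangent_space A p) \<and>
                    (\<forall>f\<in>smooth_functions A. (\<lambda>p. X p f) \<in> smooth_functions A)}\<rparr>"

abbreviation cotangent_bundle ::
    "('m::topological_space, 'e::euclidean_space) atlas \<Rightarrow> ('m, 'm tvec \<Rightarrow> real) vbundle"
  where "cotangent_bundle A \<equiv> dual_bundle A (tangent_bundle A)"

definition vf_bracket :: "('m \<Rightarrow> 'm tvec) \<Rightarrow> ('m \<Rightarrow> 'm tvec) \<Rightarrow> 'm \<Rightarrow> 'm tvec"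
  where "vf_bracket X Y = (\<lambda>p f. X p (\<lambda>q. Y q f) - Y p (\<lambda>q. X q f))"


section \<open>Algebroids\<close>

definition anchored_bundle ::
    "('m::topological_space, 'e::euclidean_space) atlas \<Rightarrow> ('m, 'v::real_vector) vbundle \<Rightarrow>
     ('m \<Rightarrow> 'v \<Rightarrow> 'm tvec) \<Rightarrow> bool"
  where "anchored_bundle A E \<rho> \<longleftrightarrow> vector_bundle A E \<and> bundle_map E (tangent_bundle A) \<rho>"

definition id_anchor :: "'m \<Rightarrow> 'm tvec \<Rightarrow> 'm tvec"
  where "id_anchor = (\<lambda>p v. v)"

definition zero_anchor :: "'m \<Rightarrow> 'v \<Rightarrow> 'm tvec"
  where "zero_anchor = (\<lambda>p v. 0)"

definition sum_anchor ::
    "('m \<Rightarrow> 'v \<Rightarrow> 'm tvec) \<Rightarrow> ('m \<Rightarrow> 'w \<Rightarrow> 'm tvec) \<Rightarrow> 'm \<Rightarrow> 'v \<times> 'w \<Rightarrow> 'm tvec"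
  where "sum_anchor \<rho>\<^sub>0 \<rho>\<^sub>1 = (\<lambda>p (u, \<xi>). \<rho>\<^sub>0 p u + \<rho>\<^sub>1 p \<xi>)"

text \<open>The derivative \<open>\<rho>(a)(f)\<close>.\<close>

definition act :: "('m \<Rightarrow> 'v \<Rightarrow> 'm tvec) \<Rightarrow> ('m \<Rightarrow> 'v) \<Rightarrow> ('m \<Rightarrow> real) \<Rightarrow> 'm \<Rightarrow> real"
  where "act \<rho> a f = (\<lambda>p. \<rho> p (a p) f)"

definition lie_algebroid ::
    "('m::topological_space, 'e::euclidean_space) atlas \<Rightarrow> ('m, 'v::real_vector) vbundle \<Rightarrow>
     ('m \<Rightarrow> 'v \<Rightarrow> 'm tvec) \<Rightarrow> (('m \<Rightarrow> 'v) \<Rightarrow> ('m \<Rightarrow> 'v) \<Rightarrow> 'm \<Rightarrow> 'v) \<Rightarrow> bool"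
  where "lie_algebroid A E \<rho> br \<longleftrightarrow>
    anchored_bundle A E \<rho> \<and>
    bilinear_map_on (sections E) (sections E) br \<and>
    (\<forall>a\<in>sections E. br a a = 0) \<and>
    (\<forall>a\<in>sections E. \<forall>b\<in>sections E. \<forall>c\<in>sections E.
       br a (br b c) + br b (br c a) + br c (br a b) = 0) \<and>
    (\<forall>a\<in>sections E. \<forall>b\<in>sections E. \<forall>f\<in>smooth_functions A.
       br a (fun_mult f b) = fun_mult f (br a b) + fun_mult (act \<rho> a f) b)"

definition right_anchored_product ::
    "('m::topological_space, 'e::euclidean_space) atlas \<Rightarrow> ('m, 'v::real_vector) vbundle \<Rightarrow>
     ('m \<Rightarrow> 'v \<Rightarrow> 'm tvec) \<Rightarrow> (('m \<Rightarrow> 'v) \<Rightarrow> ('m \<Rightarrow> 'v) \<Rightarrow> 'm \<Rightarrow> 'v) \<Rightarrow> bool"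
  where "right_anchored_product A E \<rho> T \<longleftrightarrow>
    anchored_bundle A E \<rho> \<and>
    bilinear_map_on (sections E) (sections E) T \<and>
    (\<forall>a\<in>sections E. \<forall>b\<in>sections E. \<forall>f\<in>smooth_functions A.
       T (fun_mult f a) b = fun_mult f (T a b) \<and>
       T a (fun_mult f b) = fun_mult f (T a b) + fun_mult (act \<rho> a f) b)"

definition commutator :: "('s \<Rightarrow> 's \<Rightarrow> 's::minus) \<Rightarrow> 's \<Rightarrow> 's \<Rightarrow> 's"
  where "commutator T a b = T a b - T b a"

definition curvature :: "('s \<Rightarrow> 's \<Rightarrow> 's::minus) \<Rightarrow> 's \<Rightarrow> 's \<Rightarrow> 's \<Rightarrow> 's"
  where "curvature T a b c = T a (T b c) - T b (T a c) - T (commutator T a b) c"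

definition left_symmetric_algebroid ::
    "('m::topological_space, 'e::euclidean_space) atlas \<Rightarrow> ('m, 'v::real_vector) vbundle \<Rightarrow>
     ('m \<Rightarrow> 'v \<Rightarrow> 'm tvec) \<Rightarrow> (('m \<Rightarrow> 'v) \<Rightarrow> ('m \<Rightarrow> 'v) \<Rightarrow> 'm \<Rightarrow> 'v) \<Rightarrow> bool"
  where "left_symmetric_algebroid A E \<rho> T \<longleftrightarrow>
    right_anchored_product A E \<rho> T \<and>
    (\<forall>a\<in>sections E. \<forall>b\<in>sections E. \<forall>c\<in>sections E. curvature T a b c = 0)"


section \<open>Compatible left symmetric algebroids on dual bundles\<close>

text \<open>For \<open>S\<close> on \<open>B\<close>: the section \<open>S*\<^sub>X \<beta>\<close> of the dual of \<open>B\<close>.\<close>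

definition dual_product ::
    "('m::topological_space, 'e::euclidean_space) atlas \<Rightarrow> ('m, 'v::real_vector) vbundle \<Rightarrow>
     ('m \<Rightarrow> 'v \<Rightarrow> 'm tvec) \<Rightarrow> (('m \<Rightarrow> 'v) \<Rightarrow> ('m \<Rightarrow> 'v) \<Rightarrow> 'm \<Rightarrow> 'v) \<Rightarrow>
     ('m \<Rightarrow> 'v) \<Rightarrow> ('m \<Rightarrow> 'v \<Rightarrow> real) \<Rightarrow> 'm \<Rightarrow> 'v \<Rightarrow> real"
  where "dual_product A B \<rho>\<^sub>0 S X \<beta> =
    (THE \<gamma>. \<gamma> \<in> sections (dual_bundle A B) \<and>
       (\<forall>Y\<in>sections B. fib_app \<gamma> Y = act \<rho>\<^sub>0 X (fib_app \<beta> Y) - fib_app \<beta> (S X Y)))"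

text \<open>For \<open>T\<close> on the dual of \<open>B\<close>: the section \<open>T*\<^sub>\<alpha> X\<close> of \<open>B\<close>.\<close>

definition predual_product ::
    "('m::topological_space, 'e::euclidean_space) atlas \<Rightarrow> ('m, 'v::real_vector) vbundle \<Rightarrow>
     ('m \<Rightarrow> ('v \<Rightarrow> real) \<Rightarrow> 'm tvec) \<Rightarrow>
     (('m \<Rightarrow> 'v \<Rightarrow> real) \<Rightarrow> ('m \<Rightarrow> 'v \<Rightarrow> real) \<Rightarrow> 'm \<Rightarrow> 'v \<Rightarrow> real) \<Rightarrow>
     ('m \<Rightarrow> 'v \<Rightarrow> real) \<Rightarrow> ('m \<Rightarrow> 'v) \<Rightarrow> 'm \<Rightarrow> 'v"
  where "predual_product A B \<rho>\<^sub>1 T \<alpha> X =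
    (THE Z. Z \<in> sections B \<and>
       (\<forall>\<beta>\<in>sections (dual_bundle A B).
          fib_app \<beta> Z = act \<rho>\<^sub>1 \<alpha> (fib_app \<beta> X) - fib_app (T \<alpha> \<beta>) X))"

definition double_product ::
    "('m::topological_space, 'e::euclidean_space) atlas \<Rightarrow> ('m, 'v::real_vector) vbundle \<Rightarrow>
     ('m \<Rightarrow> 'v \<Rightarrow> 'm tvec) \<Rightarrow> (('m \<Rightarrow> 'v) \<Rightarrow> ('m \<Rightarrow> 'v) \<Rightarrow> 'm \<Rightarrow> 'v) \<Rightarrow>
     ('m \<Rightarrow> ('v \<Rightarrow> real) \<Rightarrow> 'm tvec) \<Rightarrow>
     (('m \<Rightarrow> 'v \<Rightarrow> real) \<Rightarrow> ('m \<Rightarrow> 'v \<Rightarrow> real) \<Rightarrow> 'm \<Rightarrow> 'v \<Rightarrow> real) \<Rightarrow>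
     ('m \<Rightarrow> 'v \<times> ('v \<Rightarrow> real)) \<Rightarrow> ('m \<Rightarrow> 'v \<times> ('v \<Rightarrow> real)) \<Rightarrow> 'm \<Rightarrow> 'v \<times> ('v \<Rightarrow> real)"
  where "double_product A B \<rho>\<^sub>0 S \<rho>\<^sub>1 T a b =
    (let X = (\<lambda>p. fst (a p)); \<alpha> = (\<lambda>p. snd (a p)); Y = (\<lambda>p. fst (b p)); \<beta> = (\<lambda>p. snd (b p))
     in inl_section (S X Y + predual_product A B \<rho>\<^sub>1 T \<alpha> Y) +
        inr_section (dual_product A B \<rho>\<^sub>0 S X \<beta> + T \<alpha> \<beta>))"

definition compatible ::
    "('m::topological_space, 'e::euclidean_space) atlas \<Rightarrow> ('m, 'v::real_vector) vbundle \<Rightarrow>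
     ('m \<Rightarrow> 'v \<Rightarrow> 'm tvec) \<Rightarrow> (('m \<Rightarrow> 'v) \<Rightarrow> ('m \<Rightarrow> 'v) \<Rightarrow> 'm \<Rightarrow> 'v) \<Rightarrow>
     ('m \<Rightarrow> ('v \<Rightarrow> real) \<Rightarrow> 'm tvec) \<Rightarrow>
     (('m \<Rightarrow> 'v \<Rightarrow> real) \<Rightarrow> ('m \<Rightarrow> 'v \<Rightarrow> real) \<Rightarrow> 'm \<Rightarrow> 'v \<Rightarrow> real) \<Rightarrow> bool"
  where "compatible A B \<rho>\<^sub>0 S \<rho>\<^sub>1 T \<longleftrightarrow>
    left_symmetric_algebroid A B \<rho>\<^sub>0 S \<and>
    left_symmetric_algebroid A (dual_bundle A B) \<rho>\<^sub>1 T \<and>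
    (let R = curvature (double_product A B \<rho>\<^sub>0 S \<rho>\<^sub>1 T) in
      (\<forall>X\<in>sections B. \<forall>Y\<in>sections B. \<forall>\<alpha>\<in>sections (dual_bundle A B).
         R (inl_section X) (inr_section \<alpha>) (inl_section Y) =
         R (inl_section Y) (inr_section \<alpha>) (inl_section X)) \<and>
      (\<forall>X\<in>sections B. \<forall>\<alpha>\<in>sections (dual_bundle A B). \<forall>\<beta>\<in>sections (dual_bundle A B).
         R (inr_section \<alpha>) (inl_section X) (inr_section \<beta>) =
         R (inr_section \<beta>) (inl_section X) (inr_section \<alpha>)))"


section \<open>Para-Kaehler Lie algebroids\<close>

definition levi_civita ::
    "('m::topological_space, 'e::euclidean_space) atlas \<Rightarrow> ('m, 'v::real_vector) vbundle \<Rightarrow>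
     ('m \<Rightarrow> 'v \<Rightarrow> 'm tvec) \<Rightarrow> (('m \<Rightarrow> 'v) \<Rightarrow> ('m \<Rightarrow> 'v) \<Rightarrow> 'm \<Rightarrow> 'v) \<Rightarrow>
     ('m \<Rightarrow> 'v \<Rightarrow> 'v \<Rightarrow> real) \<Rightarrow> (('m \<Rightarrow> 'v) \<Rightarrow> ('m \<Rightarrow> 'v) \<Rightarrow> 'm \<Rightarrow> 'v) \<Rightarrow> bool"
  where "levi_civita A E \<rho> br g D \<longleftrightarrow>
    right_anchored_product A E \<rho> D \<and>
    (\<forall>a\<in>sections E. \<forall>b\<in>sections E. \<forall>c\<in>sections E.
       act \<rho> a (\<lambda>p. g p (b p) (c p)) =
       (\<lambda>p. g p (D a b p) (c p) + g p (b p) (D a c p))) \<and>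
    (\<forall>a\<in>sections E. \<forall>b\<in>sections E. D a b - D b a = br a b)"

text \<open>The Levi-Civita connection exists and is unique as an operation on sections, so quantifying
  it existentially is the same as speaking of the Levi-Civita connection.\<close>

definition para_kaehler_lie_algebroid ::
    "('m::topological_space, 'e::euclidean_space) atlas \<Rightarrow> ('m, 'v::real_vector) vbundle \<Rightarrow>
     ('m \<Rightarrow> 'v \<Rightarrow> 'm tvec) \<Rightarrow> (('m \<Rightarrow> 'v) \<Rightarrow> ('m \<Rightarrow> 'v) \<Rightarrow> 'm \<Rightarrow> 'v) \<Rightarrow>
     ('m \<Rightarrow> 'v \<Rightarrow> 'v \<Rightarrow> real) \<Rightarrow> ('m \<Rightarrow> 'v \<Rightarrow> 'v) \<Rightarrow> bool"
  where "para_kaehler_lie_algebroid A E \<rho> br g K \<longleftrightarrow>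
    lie_algebroid A E \<rho> br \<and>
    fiber_form A E g \<and> symmetric_form E g \<and> nondegenerate_form E g \<and>
    bundle_iso E E K \<and>
    (\<forall>p. \<forall>u\<in>fiber E p. K p (K p u) = u) \<and>
    (\<forall>p. \<forall>u\<in>fiber E p. \<forall>v\<in>fiber E p. g p (K p u) v = - g p u (K p v)) \<and>
    (\<exists>D. levi_civita A E \<rho> br g D \<and>
       (\<forall>a\<in>sections E. \<forall>b\<in>sections E. D a (fib_app K b) = fib_app K (D a b)))"

text \<open>Nondegenerate skew-symmetric forms that are closed for the differential of the Lie
  algebroid.\<close>

definition symplectic_form ::
    "('m::topological_space, 'e::euclidean_space) atlas \<Rightarrow> ('m, 'v::real_vector) vbundle \<Rightarrow>
     ('m \<Rightarrow> 'v \<Rightarrow> 'm tvec) \<Rightarrow> (('m \<Rightarrow> 'v) \<Rightarrow> ('m \<Rightarrow> 'v) \<Rightarrow> 'm \<Rightarrow> 'v) \<Rightarrow>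
     ('m \<Rightarrow> 'v \<Rightarrow> 'v \<Rightarrow> real) \<Rightarrow> bool"
  where "symplectic_form A E \<rho> br \<omega> \<longleftrightarrow>
    fiber_form A E \<omega> \<and> nondegenerate_form E \<omega> \<and>
    (\<forall>p. \<forall>u\<in>fiber E p. \<omega> p u u = 0) \<and>
    (\<forall>a\<in>sections E. \<forall>b\<in>sections E. \<forall>c\<in>sections E. \<forall>p.
       act \<rho> a (\<lambda>q. \<omega> q (b q) (c q)) p + act \<rho> b (\<lambda>q. \<omega> q (c q) (a q)) p
       + act \<rho> c (\<lambda>q. \<omega> q (a q) (b q)) p
       - \<omega> p (br a b p) (c p) - \<omega> p (br b c p) (a p) - \<omega> p (br c a p) (b p) = 0)"

definition associated_form ::
    "('m \<Rightarrow> 'v \<Rightarrow> 'v \<Rightarrow> real) \<Rightarrow> ('m \<Rightarrow> 'v \<Rightarrow> 'v) \<Rightarrow> 'm \<Rightarrow> 'v \<Rightarrow> 'v \<Rightarrow> real"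
  where "associated_form g K = (\<lambda>p u v. g p (K p u) v)"


section \<open>Affine manifolds and symmetric bivector fields\<close>

definition affine_manifold ::
    "('m::{t2_space,second_countable_topology}, 'e::euclidean_space) atlas \<Rightarrow>
     (('m \<Rightarrow> 'm tvec) \<Rightarrow> ('m \<Rightarrow> 'm tvec) \<Rightarrow> 'm \<Rightarrow> 'm tvec) \<Rightarrow> bool"
  where "affine_manifold A conn \<longleftrightarrow>
    smooth_manifold A \<and>
    right_anchored_product A (tangent_bundle A) id_anchor conn \<and>
    (\<forall>X\<in>sections (tangent_bundle A). \<forall>Y\<in>sections (tangent_bundle A).
       conn X Y - conn Y X = vf_bracket X Y) \<and>
    (\<forall>X\<in>sections (tangent_bundle A). \<forall>Y\<in>sections (tangent_bundle A).
     \<forall>Z\<in>sections (tangent_bundle A).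
       conn X (conn Y Z) - conn Y (conn X Z) - conn (vf_bracket X Y) Z = 0)"

text \<open>Since the tangent spaces are finite-dimensional, sections of \<open>TM \<otimes> TM\<close> are the smooth
  bilinear forms on the fibres of the cotangent bundle.\<close>

definition symmetric_bivector_field ::
    "('m::topological_space, 'e::euclidean_space) atlas \<Rightarrow>
     ('m \<Rightarrow> ('m tvec \<Rightarrow> real) \<Rightarrow> ('m tvec \<Rightarrow> real) \<Rightarrow> real) \<Rightarrow> bool"
  where "symmetric_bivector_field A h \<longleftrightarrow>
    fiber_form A (cotangent_bundle A) h \<and> symmetric_form (cotangent_bundle A) h"

text \<open>\<open>h\<^sub>#\<close>\<close>

definition sharp ::
    "('m::topological_space, 'e::euclidean_space) atlas \<Rightarrow>
     ('m \<Rightarrow> ('m tvec \<Rightarrow> real) \<Rightarrow> ('m tvec \<Rightarrow> real) \<Rightarrow> real) \<Rightarrow> 'm \<Rightarrow> ('m tvec \<Rightarrow> real) \<Rightarrow> 'm tvec"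
  where "sharp A h p \<alpha> =
    (THE v. v \<in> tangent_space A p \<and> (\<forall>\<beta>\<in>fiber (cotangent_bundle A) p. \<beta> v = h p \<alpha> \<beta>))"

abbreviation dual_connection ::
    "('m::topological_space, 'e::euclidean_space) atlas \<Rightarrow>
     (('m \<Rightarrow> 'm tvec) \<Rightarrow> ('m \<Rightarrow> 'm tvec) \<Rightarrow> 'm \<Rightarrow> 'm tvec) \<Rightarrow>
     ('m \<Rightarrow> 'm tvec) \<Rightarrow> ('m \<Rightarrow> 'm tvec \<Rightarrow> real) \<Rightarrow> 'm \<Rightarrow> 'm tvec \<Rightarrow> real"
  where "dual_connection A conn \<equiv> dual_product A (tangent_bundle A) id_anchor conn"

text \<open>\<open>(\<nabla>\<^sub>X h)(\<alpha>, \<beta>)\<close>\<close>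

definition bivector_derivative ::
    "('m::topological_space, 'e::euclidean_space) atlas \<Rightarrow>
     (('m \<Rightarrow> 'm tvec) \<Rightarrow> ('m \<Rightarrow> 'm tvec) \<Rightarrow> 'm \<Rightarrow> 'm tvec) \<Rightarrow>
     ('m \<Rightarrow> ('m tvec \<Rightarrow> real) \<Rightarrow> ('m tvec \<Rightarrow> real) \<Rightarrow> real) \<Rightarrow>
     ('m \<Rightarrow> 'm tvec) \<Rightarrow> ('m \<Rightarrow> 'm tvec \<Rightarrow> real) \<Rightarrow> ('m \<Rightarrow> 'm tvec \<Rightarrow> real) \<Rightarrow> 'm \<Rightarrow> real"
  where "bivector_derivative A conn h X \<alpha> \<beta> =
    (\<lambda>p. X p (\<lambda>q. h q (\<alpha> q) (\<beta> q)) - h p (dual_connection A conn X \<alpha> p) (\<beta> p)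
         - h p (\<alpha> p) (dual_connection A conn X \<beta> p))"

text \<open>\<open>\<D>\<^sub>\<alpha> \<beta>\<close>\<close>

definition bivector_product ::
    "('m::topological_space, 'e::euclidean_space) atlas \<Rightarrow>
     (('m \<Rightarrow> 'm tvec) \<Rightarrow> ('m \<Rightarrow> 'm tvec) \<Rightarrow> 'm \<Rightarrow> 'm tvec) \<Rightarrow>
     ('m \<Rightarrow> ('m tvec \<Rightarrow> real) \<Rightarrow> ('m tvec \<Rightarrow> real) \<Rightarrow> real) \<Rightarrow>
     ('m \<Rightarrow> 'm tvec \<Rightarrow> real) \<Rightarrow> ('m \<Rightarrow> 'm tvec \<Rightarrow> real) \<Rightarrow> 'm \<Rightarrow> 'm tvec \<Rightarrow> real"
  where "bivector_product A conn h \<alpha> \<beta> =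
    (THE \<gamma>. \<gamma> \<in> sections (cotangent_bundle A) \<and>
       (\<forall>X\<in>sections (tangent_bundle A). fib_app \<gamma> X =
          bivector_derivative A conn h X \<alpha> \<beta> +
          fib_app (dual_connection A conn (fib_app (sharp A h) \<alpha>) \<beta>) X))"

definition triangle_bracket ::
    "('m::topological_space, 'e::euclidean_space) atlas \<Rightarrow>
     (('m \<Rightarrow> 'm tvec) \<Rightarrow> ('m \<Rightarrow> 'm tvec) \<Rightarrow> 'm \<Rightarrow> 'm tvec) \<Rightarrow>
     ('m \<Rightarrow> 'm tvec \<times> ('m tvec \<Rightarrow> real)) \<Rightarrow> ('m \<Rightarrow> 'm tvec \<times> ('m tvec \<Rightarrow> real)) \<Rightarrow>
     'm \<Rightarrow> 'm tvec \<times> ('m tvec \<Rightarrow> real)"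
  where "triangle_bracket A conn a b =
    (let X = (\<lambda>p. fst (a p)); \<alpha> = (\<lambda>p. snd (a p)); Y = (\<lambda>p. fst (b p)); \<beta> = (\<lambda>p. snd (b p))
     in inl_section (vf_bracket X Y) +
        inr_section (dual_connection A conn X \<beta> - dual_connection A conn Y \<alpha>))"

definition bivector_metric ::
    "('m \<Rightarrow> ('m tvec \<Rightarrow> real) \<Rightarrow> ('m tvec \<Rightarrow> real) \<Rightarrow> real) \<Rightarrow>
     'm \<Rightarrow> 'm tvec \<times> ('m tvec \<Rightarrow> real) \<Rightarrow> 'm tvec \<times> ('m tvec \<Rightarrow> real) \<Rightarrow> real"
  where "bivector_metric h = (\<lambda>p (u, \<xi>) (v, \<eta>). \<xi> v + \<eta> u - 2 * h p \<xi> \<eta>)"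

definition bivector_endo ::
    "('m::topological_space, 'e::euclidean_space) atlas \<Rightarrow>
     ('m \<Rightarrow> ('m tvec \<Rightarrow> real) \<Rightarrow> ('m tvec \<Rightarrow> real) \<Rightarrow> real) \<Rightarrow>
     'm \<Rightarrow> 'm tvec \<times> ('m tvec \<Rightarrow> real) \<Rightarrow> 'm tvec \<times> ('m tvec \<Rightarrow> real)"
  where "bivector_endo A h = (\<lambda>p (u, \<xi>). (u - 2 *\<^sub>R sharp A h p \<xi>, - \<xi>))"

end

theory Submission
  imports Defs
begin

text \<open>Write \<open>W\<^sub>X = \<nabla>\<^sub>X h\<^sub>#\<close>.  The condition says \<open>W\<close> is symmetric along \<open>h\<^sub>#\<close>, which by
  torsion-freeness means that \<open>h\<^sub>#\<close> carries the bracket of \<open>\<D>\<close> to the bracket of vector fields.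
  Flatness of \<open>\<D>\<close> forces this by the Leibniz rule.  Conversely, \<open>\<D>\<^sub>\<alpha>\<close> is dual to the operator
  \<open>Q\<^sub>\<alpha> X = [h\<^sub>#(\<alpha>), X] + h\<^sub>#(\<nabla>*\<^sub>X \<alpha>)\<close>, whose flatness is then the Jacobi identity together with the
  flatness of \<open>\<nabla>*\<close>.  The compatibility conditions always hold: the mixed curvature is the second
  covariant derivative of \<open>h\<close> up to sign, which is symmetric in both pairs of arguments.  The
  connection of the compatible pair is conjugate to the Levi-Civita connection under
  \<open>Y + \<beta> \<mapsto> Y + h\<^sub>#(\<beta>) + \<beta>\<close>.  All objects defined by a description operator exist because maps
  linear over the smooth functions come from sections, which uses cut-off functions and dual frames.\<close>

section \<open>Smooth maps between normed spaces\<close>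

text \<open>Bundles are modules of global sections and tangent vectors are derivations, so charts
  enter only through the algebra of smooth functions. The local frames of TM come with the data,
  since a right-anchored product lives on a vector bundle. What remains is a calculus of operators
  on vector fields and one-forms, in which identities are proved by pairing with arbitrary sections.
  The obstacle to flatness of \<D> is that \<D> contains first derivatives of h, so its curvature
  contains second ones. In the dual operator h occurs only inside h_sharp, and the curvature is
  therefore computed there. That operator is found by writing <\<D>_\<alpha> \<beta>, X> as the
  derivative of <\<beta>, X> along h_sharp(\<alpha>) minus the pairing of \<beta> with a vector
  field: two of the three terms of that field form a bracket by torsion-freeness. The terms with
  factor 2 in the metric and in the endomorphism are those that cancel the contributions of h_sharp
  when both are expressed through the isomorphism onto the natural splitting.\<close>

lemma Ck_on_cong:
  assumes "open S" "\<And>x. x \<in> S \<Longrightarrow> f x = g x" "Ck_on k S f"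
  shows "Ck_on k S g"
  using assms(2,3)
proof (induction k arbitrary: f g)
  case 0
  then show ?case by (simp cong: continuous_on_cong)
next
  case (Suc k)
  have eq: "(f has_derivative D) (at x) \<longleftrightarrow> (g has_derivative D) (at x)" if "x \<in> S" for x D
    using has_derivative_transform_within_open[OF _ assms(1) that, of f D UNIV g]
      has_derivative_transform_within_open[OF _ assms(1) that, of g D UNIV f] Suc.prems(1) by auto
  have fr: "frechet_derivative f (at x) = frechet_derivative g (at x)" if "x \<in> S" for x
    unfolding frechet_derivative_def using eq[OF that] by simp
  show ?case
    using Suc.prems(2) eq fr Suc.IH[of "\<lambda>x. frechet_derivative f (at x) v" "\<lambda>x. frechet_derivative g (at x) v" for v]
    by (auto simp: differentiable_def)
qed

lemma Ck_on_Suc_imp: "Ck_on (Suc k) S f \<Longrightarrow> Ck_on k S f"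
proof (induction k arbitrary: f)
  case 0
  then show ?case
    by (auto simp: continuous_on_eq_continuous_within
        intro!: continuous_at_imp_continuous_at_within differentiable_imp_continuous_within
        intro: differentiable_at_withinI)
next
  case (Suc k)
  then show ?case by (metis Ck_on.simps(2))
qed

lemma Ck_on_subset: "Ck_on k S f \<Longrightarrow> T \<subseteq> S \<Longrightarrow> Ck_on k T f"
  by (induction k arbitrary: f) (auto intro: continuous_on_subset)

lemma Ck_on_local:
  assumes "\<And>x. x \<in> S \<Longrightarrow> \<exists>T. open T \<and> x \<in> T \<and> Ck_on k T f"
  shows "Ck_on k S f"
  using assms
proof (induction k arbitrary: f)
  case 0
  then show ?case
    by (metis Ck_on.simps(1) at_within_open continuous_at_imp_continuous_on continuous_on_eq_continuous_within)
next
  case (Suc k)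
  have "f differentiable (at x)" if "x \<in> S" for x using Suc.prems[OF that] by auto
  moreover have "Ck_on k S (\<lambda>x. frechet_derivative f (at x) v)" for v
    using Suc.prems by (intro Suc.IH) fastforce
  ultimately show ?case by simp
qed

text \<open>A derivative \<open>D\<close> found by the usual rules agrees pointwise with
  \<open>frechet_derivative\<close>. On an open set pointwise agreement is enough to transfer
  regularity.\<close>

lemma Ck_on_SucI:
  assumes "open S" "\<And>x. x \<in> S \<Longrightarrow> (f has_derivative D x) (at x)"
    and "\<And>v. Ck_on k S (\<lambda>x. D x v)"
  shows "Ck_on (Suc k) S f"
proof -
  have "frechet_derivative f (at x) = D x" if "x \<in> S" for x
    using frechet_derivative_at[OF assms(2)[OF that]] by simp
  then show ?thesis
    using assms Ck_on_cong[OF assms(1), of "\<lambda>x. D x v" "\<lambda>x. frechet_derivative f (at x) v" k for v]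
    by (auto simp: differentiable_def)
qed

lemma Ck_on_SucD:
  assumes "Ck_on (Suc k) S f"
  shows "x \<in> S \<Longrightarrow> (f has_derivative frechet_derivative f (at x)) (at x)"
    and "Ck_on k S (\<lambda>x. frechet_derivative f (at x) v)"
  using assms by (auto simp: frechet_derivative_works)

lemma Ck_on_const: "open S \<Longrightarrow> Ck_on k S (\<lambda>x. c)"
proof (induction k arbitrary: c)
  case (Suc k)
  then show ?case by (intro Ck_on_SucI[where D = "\<lambda>_ _. 0"]) (auto intro!: derivative_eq_intros)
qed auto

lemma Ck_on_bounded_linear:
  assumes "open S" "bounded_linear f"
  shows "Ck_on k S f"
proof (cases k)
  case 0
  then show ?thesis using assms by (simp add: linear_continuous_on)
next
  case (Suc n)
  then show ?thesis
    using assms by (auto intro!: Ck_on_SucI[where D = "\<lambda>_. f"] bounded_linear_imp_has_derivative Ck_on_const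
        simp del: Ck_on.simps)
qed

lemma Ck_on_add:
  assumes "open S"
  shows "Ck_on k S f \<Longrightarrow> Ck_on k S g \<Longrightarrow> Ck_on k S (\<lambda>x. f x + g x)"
proof (induction k arbitrary: f g)
  case (Suc k)
  show ?case
    by (rule Ck_on_SucI[OF assms])
      (auto intro!: has_derivative_add Ck_on_SucD(1)[OF Suc.prems(1)] Ck_on_SucD(1)[OF Suc.prems(2)]
        Suc.IH Ck_on_SucD(2)[OF Suc.prems(1)] Ck_on_SucD(2)[OF Suc.prems(2)])
qed (auto intro: continuous_intros)

lemma Ck_on_sum:
  assumes "open S"
  shows "(\<And>i. i \<in> I \<Longrightarrow> Ck_on k S (f i)) \<Longrightarrow> Ck_on k S (\<lambda>x. \<Sum>i\<in>I. f i x)"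
  by (induction I rule: infinite_finite_induct) (auto intro!: Ck_on_const Ck_on_add assms)

lemma Ck_on_scaleR:
  fixes c :: "_ \<Rightarrow> real"
  assumes "open S"
  shows "Ck_on k S c \<Longrightarrow> Ck_on k S g \<Longrightarrow> Ck_on k S (\<lambda>x. c x *\<^sub>R g x)"
proof (induction k arbitrary: c g)
  case (Suc k)
  note c = Ck_on_SucD[OF Suc.prems(1)] and g = Ck_on_SucD[OF Suc.prems(2)]
  show ?case
    by (rule Ck_on_SucI[OF assms, where D = "\<lambda>x v. c x *\<^sub>R frechet_derivative g (at x) v
          + frechet_derivative c (at x) v *\<^sub>R g x"])
      (auto intro!: has_derivative_scaleR c(1) g(1) Ck_on_add assms Suc.IH c(2) g(2)
        Ck_on_Suc_imp[OF Suc.prems(1)] Ck_on_Suc_imp[OF Suc.prems(2)])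
qed (auto intro: continuous_intros)

lemma Ck_on_mult:
  fixes f g :: "_ \<Rightarrow> real"
  assumes "open S" "Ck_on k S f" "Ck_on k S g"
  shows "Ck_on k S (\<lambda>x. f x * g x)"
  using Ck_on_scaleR[OF assms] by simp

lemma Ck_on_linear_compose:
  assumes "open S" "bounded_linear L"
  shows "Ck_on k S f \<Longrightarrow> Ck_on k S (\<lambda>x. L (f x))"
proof (induction k arbitrary: f)
  case 0
  then show ?case using bounded_linear.continuous_on[OF assms(2)] by auto
next
  case (Suc k)
  note f = Ck_on_SucD[OF Suc.prems]
  show ?case
    by (rule Ck_on_SucI[OF assms(1)])
      (auto intro!: bounded_linear.has_derivative[OF assms(2)] f(1) Suc.IH f(2))
qed

text \<open>The chain rule differentiates g in the moving direction f'(x) v, whereas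
  \<open>Ck_on\<close> controls derivatives in fixed directions. Expanding the moving direction in
  \<open>Basis\<close> leaves coefficients that depend on f alone, times derivatives of g in fixed
  directions.\<close>

lemma Ck_on_compose:
  fixes f :: "'a::real_normed_vector \<Rightarrow> 'b::euclidean_space"
  assumes "open S" "open T" "f ` S \<subseteq> T"
  shows "Ck_on k S f \<Longrightarrow> Ck_on k T g \<Longrightarrow> Ck_on k S (\<lambda>x. g (f x))"
  using assms(3)
proof (induction k arbitrary: f g)
  case 0
  then show ?case by (auto intro: continuous_on_compose2)
next
  case (Suc k)
  note f = Ck_on_SucD[OF Suc.prems(1)] and g = Ck_on_SucD[OF Suc.prems(2)]
  let ?D = "\<lambda>x v. \<Sum>b\<in>Basis. (frechet_derivative f (at x) v \<bullet> b) *\<^sub>R frechet_derivative g (at (f x)) b"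
  have D: "((\<lambda>x. g (f x)) has_derivative ?D x) (at x)" if x: "x \<in> S" for x
  proof -
    have gf: "(g has_derivative frechet_derivative g (at (f x))) (at (f x))"
      using g(1) x Suc.prems(3) by auto
    then have lin: "linear (frechet_derivative g (at (f x)))" by (rule has_derivative_linear)
    have "frechet_derivative g (at (f x)) (frechet_derivative f (at x) v) = ?D x v" for v
      by (subst euclidean_representation[of "frechet_derivative f (at x) v", symmetric])
        (simp add: linear_sum[OF lin] linear_scale[OF lin])
    moreover have "((\<lambda>x. g (f x)) has_derivative (\<lambda>v. frechet_derivative g (at (f x)) (frechet_derivative f (at x) v))) (at x)"
      using has_derivative_compose[OF f(1)[OF x] gf] .
    ultimately show ?thesis by simp
  qed
  have inner: "Ck_on k S (\<lambda>x. frechet_derivative f (at x) v \<bullet> b)" for v b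
    using Ck_on_linear_compose[OF assms(1) bounded_linear_inner_left f(2)] .
  show ?case
    by (rule Ck_on_SucI[OF assms(1) D])
      (auto intro!: Ck_on_sum Ck_on_scaleR assms inner Suc.IH Ck_on_Suc_imp[OF Suc.prems(1)] g(2) Suc.prems(3))
qed


section \<open>Smooth maps, and the flat function exp(-1/t)\<close>

lemma smooth_on_cong:
  "open S \<Longrightarrow> (\<And>x. x \<in> S \<Longrightarrow> f x = g x) \<Longrightarrow> smooth_on S f \<Longrightarrow> smooth_on S g"
  unfolding smooth_on_def by (metis Ck_on_cong)

lemma smooth_on_local:
  "(\<And>x. x \<in> S \<Longrightarrow> \<exists>T. open T \<and> x \<in> T \<and> smooth_on T f) \<Longrightarrow> smooth_on S f"
  unfolding smooth_on_def by (metis Ck_on_local)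

lemma smooth_on_subset: "smooth_on S f \<Longrightarrow> T \<subseteq> S \<Longrightarrow> smooth_on T f"
  unfolding smooth_on_def by (metis Ck_on_subset)

lemma smooth_on_const: "open S \<Longrightarrow> smooth_on S (\<lambda>x. c)"
  unfolding smooth_on_def by (metis Ck_on_const)

lemma smooth_on_bounded_linear: "open S \<Longrightarrow> bounded_linear f \<Longrightarrow> smooth_on S f"
  unfolding smooth_on_def by (metis Ck_on_bounded_linear)

lemma smooth_on_add:
  "open S \<Longrightarrow> smooth_on S f \<Longrightarrow> smooth_on S g \<Longrightarrow> smooth_on S (\<lambda>x. f x + g x)"
  unfolding smooth_on_def by (metis Ck_on_add)

lemma smooth_on_sum:
  "open S \<Longrightarrow> (\<And>i. i \<in> I \<Longrightarrow> smooth_on S (f i)) \<Longrightarrow> smooth_on S (\<lambda>x. \<Sum>i\<in>I. f i x)"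
  unfolding smooth_on_def by (intro allI Ck_on_sum) auto

lemma smooth_on_mult:
  fixes f g :: "_ \<Rightarrow> real"
  shows "open S \<Longrightarrow> smooth_on S f \<Longrightarrow> smooth_on S g \<Longrightarrow> smooth_on S (\<lambda>x. f x * g x)"
  unfolding smooth_on_def by (metis Ck_on_mult)

lemma smooth_on_compose:
  fixes f :: "_ \<Rightarrow> _::euclidean_space"
  assumes "open S" "open T" "f ` S \<subseteq> T" "smooth_on S f" "smooth_on T g"
  shows "smooth_on S (\<lambda>x. g (f x))"
  using assms unfolding smooth_on_def by (metis Ck_on_compose)

text \<open>A single induction on the order serves the whole family: each derivative is an
  expression in the members, so order k of all members gives order k of every \<open>f' n\<close>,
  hence order k + 1 of every \<open>f n\<close>.\<close>

lemma smooth_on_real: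
  fixes f :: "nat \<Rightarrow> real \<Rightarrow> real"
  assumes "open S" "\<And>n x. x \<in> S \<Longrightarrow> (f n has_real_derivative f' n x) (at x)"
    and "\<And>n k. (\<And>m. Ck_on k S (f m)) \<Longrightarrow> Ck_on k S (f' n)"
  shows "smooth_on S (f n)"
proof -
  have "Ck_on k S (f n)" for k
  proof (induction k arbitrary: n)
    case 0
    then show ?case
      using assms(2) by (auto intro!: DERIV_isCont continuous_at_imp_continuous_on)
  next
    case (Suc k)
    show ?case
      by (rule Ck_on_SucI[where D = "\<lambda>x v. f' n x * v"])
        (use assms Suc.IH in \<open>auto simp: has_field_derivative_def
           intro!: Ck_on_mult Ck_on_const\<close>)
  qed
  then show ?thesis by (simp add: smooth_on_def)
qed

lemma smooth_on_inverse: "smooth_on {0<..} (inverse :: real \<Rightarrow> real)"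
proof -
  \<comment> \<open>With exponent \<open>Suc n\<close> the family consists, up to constants, of the
    inverse and its successive derivatives.\<close>
  have deriv: "((\<lambda>x. inverse x ^ Suc n) has_real_derivative - real (Suc n) * inverse x ^ Suc (Suc n)) (at x)"
    if "x \<in> {0<..}" for n and x :: real
    using that power_minus_mult[of n x]
    by (cases "n = 0") (auto intro!: derivative_eq_intros simp: field_simps)
  have "smooth_on {0<..} (\<lambda>x::real. inverse x ^ Suc 0)"
    by (rule smooth_on_real[where f = "\<lambda>n x. inverse x ^ Suc n" and n = 0, OF open_greaterThan deriv])
      (auto intro!: Ck_on_mult Ck_on_const simp del: power_Suc)
  then show ?thesis by simp
qed

text \<open>For n = 0 this is exp(-1/t), extended by 0. The powers of 1/t are what differentiation
  produces, so the family is closed under it.\<close>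

definition flat_exp :: "nat \<Rightarrow> real \<Rightarrow> real"
  where "flat_exp n t = (if t > 0 then inverse t ^ n * exp (- inverse t) else 0)"

lemma flat_exp_nonneg: "flat_exp n t \<ge> 0" and flat_exp_pos_iff: "flat_exp n t > 0 \<longleftrightarrow> t > 0"
  by (auto simp: flat_exp_def)

text \<open>From the right, s = 1/t turns the claim into s^n / exp s tending to 0 at infinity; from
  the left the function vanishes.\<close>

lemma tendsto_flat_exp_0: "(flat_exp n \<longlongrightarrow> 0) (at 0)"
proof -
  have "((\<lambda>t::real. inverse t ^ n * exp (- inverse t)) \<longlongrightarrow> 0) (at_right 0)"
    using filterlim_compose[OF tendsto_power_div_exp_0[of n] filterlim_inverse_at_top_right]
    by (simp add: exp_minus divide_inverse)
  then have "(flat_exp n \<longlongrightarrow> 0) (at_right 0)"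
    by (rule tendsto_cong[THEN iffD1, rotated])
      (auto simp: flat_exp_def eventually_at_filter)
  moreover have "(flat_exp n \<longlongrightarrow> 0) (at_left 0)"
    by (rule tendsto_eventually) (auto simp: flat_exp_def eventually_at_filter)
  ultimately show ?thesis by (simp add: filterlim_at_split)
qed

lemma DERIV_flat_exp:
  "(flat_exp n has_real_derivative flat_exp (n + 2) t + - real n * flat_exp (n + 1) t) (at t)"
proof -
  consider "t > 0" | "t < 0" | "t = 0" by linarith
  then show ?thesis
  proof cases
    case 1
    have "((\<lambda>t. inverse t ^ n * exp (- inverse t)) has_real_derivative
        flat_exp (n + 2) t + - real n * flat_exp (n + 1) t) (at t)"
      using 1 power_minus_mult[of n t]
      by (cases "n = 0") (auto intro!: derivative_eq_intros simp: flat_exp_def field_simps)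
    then show ?thesis
      by (rule has_field_derivative_transform_within_open[of _ _ _ "{0<..}"])
        (use 1 in \<open>auto simp: flat_exp_def\<close>)
  next
    case 2
    have "((\<lambda>t. 0) has_real_derivative flat_exp (n + 2) t + - real n * flat_exp (n + 1) t) (at t)"
      using 2 by (simp add: flat_exp_def)
    then show ?thesis
      by (rule has_field_derivative_transform_within_open[of _ _ _ "{..<0}"])
        (use 2 in \<open>auto simp: flat_exp_def\<close>)
  next
    case 3
    \<comment> \<open>Away from 0 the difference quotient at 0 is \<open>flat_exp (Suc n)\<close>,
      whose limit is known.\<close>
    have "((\<lambda>s. (flat_exp n s - flat_exp n 0) / (s - 0)) \<longlongrightarrow> 0) (at 0)"
      by (rule tendsto_cong[THEN iffD1, OF _ tendsto_flat_exp_0[of "Suc n"]])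
        (auto simp: flat_exp_def eventually_at_filter field_simps)
    then show ?thesis
      using 3 by (simp add: has_field_derivative_iff flat_exp_def)
  qed
qed

lemma smooth_on_flat_exp: "smooth_on UNIV (flat_exp n)"
  by (rule smooth_on_real[OF open_UNIV DERIV_flat_exp]) (intro Ck_on_add Ck_on_mult Ck_on_const open_UNIV)


section \<open>Smooth functions on a manifold\<close>

text \<open>The added term removes the pole at \<open>0\<close> and vanishes from \<open>1 / 2\<close> on.\<close>

definition reciprocal :: "real \<Rightarrow> real"
  where "reciprocal t = t * inverse (t * t + flat_exp 0 (1 / 2 - t))"

lemma reciprocal_eq: "t > 1 / 2 \<Longrightarrow> reciprocal t = inverse t"
  by (simp add: reciprocal_def flat_exp_def)

lemma smooth_on_reciprocal: "smooth_on UNIV reciprocal"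
proof -
  have pos: "t * t + flat_exp 0 (1 / 2 - t) > 0" for t
    using flat_exp_nonneg[of 0 "1/2 - t"] flat_exp_pos_iff[of 0 "1/2 - t"] zero_le_square[of t]
    by (cases "t = 0") (auto intro!: add_pos_nonneg simp: zero_less_mult_iff)
  have id: "smooth_on UNIV (\<lambda>t::real. t)"
    by (simp add: smooth_on_bounded_linear bounded_linear_ident)
  have "smooth_on UNIV (\<lambda>t::real. 1 / 2 + (- 1) * t)"
    by (intro smooth_on_add smooth_on_mult smooth_on_const open_UNIV id)
  then have "smooth_on UNIV (\<lambda>t. flat_exp 0 (1 / 2 - t))"
    using smooth_on_compose[OF open_UNIV open_UNIV _ _ smooth_on_flat_exp, of "\<lambda>t. 1 / 2 - t" 0] by simp
  then have "smooth_on UNIV (\<lambda>t. t * t + flat_exp 0 (1 / 2 - t))"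
    by (intro smooth_on_add smooth_on_mult open_UNIV id)
  then have "smooth_on UNIV (\<lambda>t. inverse (t * t + flat_exp 0 (1 / 2 - t)))"
    using pos by (intro smooth_on_compose[OF open_UNIV open_greaterThan _ _ smooth_on_inverse]) auto
  then show ?thesis
    unfolding reciprocal_def[abs_def] by (intro smooth_on_mult id open_UNIV)
qed

section \<open>The algebra of smooth functions, cut-off functions and local reciprocals\<close>

locale smooth_manifold_atlas =
  fixes A :: "('m::{t2_space,second_countable_topology}, 'e::euclidean_space) atlas"
  assumes manifold: "smooth_manifold A"
begin

abbreviation "C \<equiv> smooth_functions A"

lemma chart:
  assumes "(U, \<phi>) \<in> A"
  shows "open U" "open (\<phi> ` U)" "inj_on \<phi> U" "continuous_on U \<phi>"
    "continuous_on (\<phi> ` U) (inv_into U \<phi>)"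
  using bspec[OF conjunct1[OF conjunct2[OF manifold[unfolded smooth_manifold_def]]] assms]
  by (auto simp: homeomorphism_def)

lemma transition:
  assumes "(U, \<phi>) \<in> A" "(V, \<psi>) \<in> A"
  shows "smooth_on (\<phi> ` (U \<inter> V)) (\<lambda>x. \<psi> (inv_into U \<phi> x))"
  using bspec[OF conjunct2[OF conjunct2[OF manifold[unfolded smooth_manifold_def]]] assms(1)] assms(2)
  by auto

lemma chart_cover: obtains U \<phi> where "(U, \<phi>) \<in> A" "p \<in> U"
proof -
  have "p \<in> (\<Union>(U, \<phi>)\<in>A. U)"
    using conjunct1[OF manifold[unfolded smooth_manifold_def]] by simp
  then show thesis using that by auto
qed

lemma open_chart_image:
  assumes "(U, \<phi>) \<in> A" "open W"
  shows "open (\<phi> ` (U \<inter> W))"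
proof -
  have "\<phi> ` (U \<inter> W) = \<phi> ` U \<inter> inv_into U \<phi> -` W"
    using chart(3)[OF assms(1)] by auto
  then show ?thesis
    using continuous_open_preimage[OF chart(5,2)[OF assms(1)] assms(2)] by simp
qed

lemma smooth_functionsD:
  "f \<in> C \<Longrightarrow> (U, \<phi>) \<in> A \<Longrightarrow> smooth_on (\<phi> ` U) (\<lambda>x. f (inv_into U \<phi> x))"
  by (auto simp: smooth_functions_def)

lemma smooth_functionsI:
  "(\<And>U \<phi>. (U, \<phi>) \<in> A \<Longrightarrow> smooth_on (\<phi> ` U) (\<lambda>x. f (inv_into U \<phi> x))) \<Longrightarrow> f \<in> C"
  by (auto simp: smooth_functions_def)

lemma smooth_functions_const: "(\<lambda>p. c) \<in> C"
  by (auto intro!: smooth_functionsI smooth_on_const chart)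

lemma smooth_functions_add:
  "f \<in> C \<Longrightarrow> g \<in> C \<Longrightarrow> (\<lambda>p. f p + g p) \<in> C"
  by (rule smooth_functionsI, rule smooth_on_add) (blast intro: chart smooth_functionsD)+

lemma smooth_functions_mult:
  "f \<in> C \<Longrightarrow> g \<in> C \<Longrightarrow> (\<lambda>p. f p * g p) \<in> C"
  by (rule smooth_functionsI, rule smooth_on_mult) (blast intro: chart smooth_functionsD)+

lemma smooth_functions_diff:
  assumes "f \<in> C" "g \<in> C"
  shows "(\<lambda>p. f p - g p) \<in> C"
  using smooth_functions_add[OF assms(1) smooth_functions_mult[OF smooth_functions_const[of "-1"] assms(2)]]
  by simp

lemma smooth_functions_compose:
  assumes "f \<in> C" "smooth_on UNIV r"
  shows "(\<lambda>p. r (f p)) \<in> C"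
  by (rule smooth_functionsI, rule smooth_on_compose[OF _ open_UNIV _ _ assms(2)])
    (auto intro: chart smooth_functionsD assms)

lemma smooth_functions_local:
  assumes "\<And>p. \<exists>W g. open W \<and> p \<in> W \<and> g \<in> C \<and> (\<forall>q\<in>W. f q = g q)"
  shows "f \<in> C"
proof (intro smooth_functionsI smooth_on_local)
  fix U \<phi> x assume U: "(U, \<phi>) \<in> A" and "x \<in> \<phi> ` U"
  then obtain p where p: "p \<in> U" "x = \<phi> p" by auto
  obtain W g where W: "open W" "p \<in> W" "g \<in> C" "\<And>q. q \<in> W \<Longrightarrow> f q = g q"
    using assms by metis
  have "smooth_on (\<phi> ` (U \<inter> W)) (\<lambda>x. f (inv_into U \<phi> x))"
    by (rule smooth_on_cong[OF open_chart_image[OF U W(1)]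
          _ smooth_on_subset[OF smooth_functionsD[OF W(3) U]]])
      (use W(4) chart(3)[OF U] in auto)
  then show "\<exists>T. open T \<and> x \<in> T \<and> smooth_on T (\<lambda>x. f (inv_into U \<phi> x))"
    using open_chart_image[OF U W(1)] p W(2) by blast
qed

text \<open>A radial flat function in one chart is extended by 0. Its support lies in K, the
  preimage of a closed ball; K is compact, hence closed because the manifold is Hausdorff. So near a
  point of K the function is seen in another chart through a transition map, and near any other
  point it is 0.\<close>

lemma bump_function:
  assumes "open W" "p \<in> W"
  obtains \<eta> where "\<eta> \<in> C" "\<eta> p = 1" "\<And>q. q \<notin> W \<Longrightarrow> \<eta> q = 0"
proof -
  obtain U \<phi> where U: "(U, \<phi>) \<in> A" and p: "p \<in> U" by (rule chart_cover)
  obtain r where r: "r > 0" "cball (\<phi> p) r \<subseteq> \<phi> ` (U \<inter> W)"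
    using open_chart_image[OF U assms(1)] p assms(2) unfolding open_contains_cball by blast
  define K where "K = inv_into U \<phi> ` cball (\<phi> p) r"
  \<comment> \<open>This is exp(-1/(r^2 - |x - \<phi>(p)|^2)), with the squared norm written in
    coordinates to suit the closure rules of \<open>smooth_on\<close>.\<close>
  define G where "G x = flat_exp 0 (r * r + (- 1) * (\<Sum>b\<in>Basis. ((x + - \<phi> p) \<bullet> b) * ((x + - \<phi> p) \<bullet> b)))" for x
  have G_eq: "G x = flat_exp 0 (r * r - dist (\<phi> p) x * dist (\<phi> p) x)" for x
  proof -
    have "(\<Sum>b\<in>Basis. ((x + - \<phi> p) \<bullet> b) * ((x + - \<phi> p) \<bullet> b)) = (x + - \<phi> p) \<bullet> (x + - \<phi> p)"
      by (rule euclidean_inner[symmetric])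
    also have "\<dots> = dist (\<phi> p) x * dist (\<phi> p) x"
      by (simp add: dist_norm norm_minus_commute[of "\<phi> p"] dot_square_norm power2_eq_square)
    finally show ?thesis by (simp add: G_def)
  qed
  have K: "K \<subseteq> U \<inter> W" "compact K"
  proof -
    show "K \<subseteq> U \<inter> W" using r(2) chart(3)[OF U] by (auto simp: K_def)
    have "continuous_on (cball (\<phi> p) r) (inv_into U \<phi>)"
      using r(2) by (intro continuous_on_subset[OF chart(5)[OF U]]) auto
    then show "compact K" unfolding K_def by (rule compact_continuous_image) simp
  qed
  have smooth_G: "smooth_on UNIV G"
  proof -
    have "smooth_on UNIV (\<lambda>x. (x + - \<phi> p) \<bullet> b)" for b
      by (subst inner_add_left)
        (intro smooth_on_add smooth_on_const open_UNIV smooth_on_bounded_linear bounded_linear_inner_left)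
    then have "smooth_on UNIV (\<lambda>x. r * r + (- 1) * (\<Sum>b\<in>Basis. ((x + - \<phi> p) \<bullet> b) * ((x + - \<phi> p) \<bullet> b)))"
      by (intro smooth_on_add smooth_on_const smooth_on_mult smooth_on_sum open_UNIV)
    then show ?thesis
      unfolding G_def[abs_def]
      by (intro smooth_on_compose[OF open_UNIV open_UNIV _ _ smooth_on_flat_exp] subset_UNIV)
  qed
  define \<eta> where "\<eta> q = (if q \<in> U then G (\<phi> q) else 0)" for q
  have \<eta>_K: "\<eta> q = 0" if "q \<notin> K" for q
  proof (cases "q \<in> U")
    case True
    then have "\<not> dist (\<phi> p) (\<phi> q) \<le> r"
      using that chart(3)[OF U] unfolding K_def
      by (metis imageI inv_into_f_f mem_cball)
    then have "r * r \<le> dist (\<phi> p) (\<phi> q) * dist (\<phi> p) (\<phi> q)"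
      using r(1) by (intro mult_mono) auto
    then show ?thesis using True by (simp add: \<eta>_def G_eq flat_exp_def)
  qed (simp add: \<eta>_def)
  have "\<eta> \<in> C"
  proof (intro smooth_functionsI smooth_on_local)
    fix V \<psi> x assume V: "(V, \<psi>) \<in> A" and "x \<in> \<psi> ` V"
    then obtain q where q: "q \<in> V" "x = \<psi> q" by auto
    show "\<exists>T. open T \<and> x \<in> T \<and> smooth_on T (\<lambda>x. \<eta> (inv_into V \<psi> x))"
    proof (cases "q \<in> K")
      case True
      let ?T = "\<psi> ` (V \<inter> U)"
      have T: "open ?T" by (rule open_chart_image[OF V chart(1)[OF U]])
      have "smooth_on ?T (\<lambda>x. G (\<phi> (inv_into V \<psi> x)))"
        by (rule smooth_on_compose[OF T open_UNIV _ transition[OF V U] smooth_G]) simp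
      then have "smooth_on ?T (\<lambda>x. \<eta> (inv_into V \<psi> x))"
        by (rule smooth_on_cong[OF T, rotated]) (use chart(3)[OF V] in \<open>auto simp: \<eta>_def\<close>)
      then show ?thesis using T True K(1) q by blast
    next
      case False
      let ?T = "\<psi> ` (V \<inter> - K)"
      have T: "open ?T"
        by (rule open_chart_image[OF V]) (use compact_imp_closed[OF K(2)] in \<open>simp add: open_Compl\<close>)
      have "smooth_on ?T (\<lambda>x. \<eta> (inv_into V \<psi> x))"
        by (rule smooth_on_cong[OF T _ smooth_on_const[OF T, of 0]])
          (use chart(3)[OF V] \<eta>_K in auto)
      then show ?thesis using T False q by blast
    qed
  qed
  moreover have "\<eta> p > 0" using r(1) p by (simp add: \<eta>_def G_eq flat_exp_pos_iff)
  ultimately have "(\<lambda>q. inverse (\<eta> p) * \<eta> q) \<in> C" "inverse (\<eta> p) * \<eta> p = 1"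
    by (auto intro: smooth_functions_mult smooth_functions_const)
  then show ?thesis by (rule that) (use \<eta>_K K(1) in auto)
qed

text \<open>Scaling d to the value 1 at p puts it above 1/2 near p, where \<open>reciprocal\<close>
  is the true inverse. Since \<open>reciprocal\<close> is smooth on the whole line, g is a global
  smooth function and can multiply global sections.\<close>

lemma local_reciprocal:
  assumes "d \<in> C" "d p \<noteq> 0"
  obtains g W where "g \<in> C" "open W" "p \<in> W" "\<And>q. q \<in> W \<Longrightarrow> g q * d q = 1"
proof -
  let ?d = "\<lambda>q. inverse (d p) * d q"
  have d: "?d \<in> C"
    by (intro smooth_functions_mult smooth_functions_const assms)
  obtain U \<phi> where U: "(U, \<phi>) \<in> A" and p: "p \<in> U" by (rule chart_cover)
  have "continuous_on (\<phi> ` U) (\<lambda>x. ?d (inv_into U \<phi> x))"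
    using smooth_functionsD[OF d U] unfolding smooth_on_def by (metis Ck_on.simps(1))
  then have "continuous_on U (\<lambda>q. ?d (inv_into U \<phi> (\<phi> q)))"
    by (rule continuous_on_compose2[OF _ chart(4)[OF U] order.refl])
  moreover have "?d (inv_into U \<phi> (\<phi> q)) = ?d q" if "q \<in> U" for q
    using chart(3)[OF U] that by simp
  ultimately have cont: "continuous_on U ?d"
    using continuous_on_cong[OF refl, of U "\<lambda>q. ?d (inv_into U \<phi> (\<phi> q))" ?d] by simp
  let ?W = "U \<inter> ?d -` {1 / 2<..}"
  show ?thesis
  proof (rule that)
    show "open ?W" by (rule continuous_open_preimage[OF cont chart(1)[OF U]]) simp
    show "p \<in> ?W" using p assms(2) by simp
    show "(\<lambda>q. inverse (d p) * reciprocal (?d q)) \<in> C"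
      by (rule smooth_functions_mult[OF smooth_functions_const smooth_functions_compose[OF d smooth_on_reciprocal]])
    show "inverse (d p) * reciprocal (?d q) * d q = 1" if "q \<in> ?W" for q
    proof -
      have *: "?d q > 1 / 2" using that by auto
      then have "d q \<noteq> 0" by auto
      then show ?thesis using assms(2) unfolding reciprocal_eq[OF *] by (simp add: field_simps)
    qed
  qed
qed

end

section \<open>Frames and tensorial maps\<close>

lemma sum_fun_apply: "(\<Sum>i\<in>I. f i) x = (\<Sum>i\<in>I. f i x)"
  by (induction I rule: infinite_finite_induct) auto

lemma linear_map_onI:
  assumes "\<And>x. x \<in> V \<Longrightarrow> f x \<in> W" "\<And>x y. x \<in> V \<Longrightarrow> y \<in> V \<Longrightarrow> f (x + y) = f x + f y"
    "\<And>r x. x \<in> V \<Longrightarrow> f (r *\<^sub>R x) = r *\<^sub>R f x"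
  shows "linear_map_on V W f"
  using assms by (simp add: linear_map_on_def)

lemma linear_map_onD:
  assumes "linear_map_on V W f"
  shows "x \<in> V \<Longrightarrow> f x \<in> W" "x \<in> V \<Longrightarrow> y \<in> V \<Longrightarrow> f (x + y) = f x + f y"
    "x \<in> V \<Longrightarrow> f (r *\<^sub>R x) = r *\<^sub>R f x"
  using assms by (simp_all add: linear_map_on_def)

lemma linear_map_on_0:
  assumes "linear_map_on V W f" "subspace V"
  shows "f 0 = 0"
  using linear_map_onD(3)[OF assms(1) subspace_0[OF assms(2)], of 0] by simp

lemma linear_map_on_diff:
  assumes "linear_map_on V W f" "subspace V" "x \<in> V" "y \<in> V"
  shows "f (x - y) = f x - f y"
  using linear_map_onD(2)[OF assms(1) subspace_diff[OF assms(2-4)] assms(4)] by (simp add: algebra_simps)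

lemma linear_map_on_sum:
  assumes "linear_map_on V W f" "subspace V"
  shows "(\<And>i. i \<in> I \<Longrightarrow> x i \<in> V) \<Longrightarrow> f (\<Sum>i\<in>I. x i) = (\<Sum>i\<in>I. f (x i))"
proof (induction I rule: infinite_finite_induct)
  case (insert i I)
  have "f (x i + (\<Sum>j\<in>I. x j)) = f (x i) + f (\<Sum>j\<in>I. x j)"
    using insert by (intro linear_map_onD(2)[OF assms(1)] subspace_sum[OF assms(2)]) auto
  then show ?case using insert by simp
qed (simp_all add: linear_map_on_0[OF assms])

lemma linear_map_on_lincomb:
  assumes "linear_map_on V W f" "subspace V" "\<And>i. i \<in> I \<Longrightarrow> x i \<in> V"
  shows "f (\<Sum>i\<in>I. c i *\<^sub>R x i) = (\<Sum>i\<in>I. c i *\<^sub>R f (x i))"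
proof -
  have "f (\<Sum>i\<in>I. c i *\<^sub>R x i) = (\<Sum>i\<in>I. f (c i *\<^sub>R x i))"
    by (rule linear_map_on_sum[OF assms(1,2)]) (use assms in \<open>auto intro: subspace_scale\<close>)
  also have "\<dots> = (\<Sum>i\<in>I. c i *\<^sub>R f (x i))"
    by (rule sum.cong) (use linear_map_onD(3)[OF assms(1)] assms(3) in auto)
  finally show ?thesis .
qed

text \<open>Applying \<open>l j\<close> to a vanishing combination isolates its j-th coefficient.
  This supplies the independence and span clauses of \<open>smooth_frame\<close>.\<close>

lemma biorthogonal_basis:
  fixes b :: "nat \<Rightarrow> 'v::real_vector"
  assumes W: "subspace W" and b: "\<And>i. i < k \<Longrightarrow> b i \<in> W"
    and l: "\<And>i. i < k \<Longrightarrow> linear_map_on W (UNIV :: real set) (l i)"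
    and lb: "\<And>i j. i < k \<Longrightarrow> j < k \<Longrightarrow> l i (b j) = (if i = j then 1 else 0)"
    and expand: "\<And>w. w \<in> W \<Longrightarrow> w = (\<Sum>i<k. l i w *\<^sub>R b i)"
  shows "inj_on b {..<k}" "independent (b ` {..<k})" "span (b ` {..<k}) = W"
proof -
  show inj: "inj_on b {..<k}"
  proof (rule inj_onI)
    fix i j assume "i \<in> {..<k}" "j \<in> {..<k}" "b i = b j"
    then show "i = j" using lb[of i i] lb[of i j] by (auto split: if_splits)
  qed
  show "independent (b ` {..<k})"
  proof (rule independent_if_scalars_zero)
    fix f x assume 0: "(\<Sum>x\<in>b ` {..<k}. f x *\<^sub>R x) = 0" and "x \<in> b ` {..<k}"
    then obtain j where j: "j < k" "x = b j" by auto
    have "0 = l j (\<Sum>i<k. f (b i) *\<^sub>R b i)"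
      using 0 linear_map_on_0[OF l[OF j(1)] W] by (simp add: sum.reindex[OF inj])
    also have "\<dots> = (\<Sum>i<k. f (b i) *\<^sub>R l j (b i))"
      by (rule linear_map_on_lincomb[OF l[OF j(1)] W]) (use b in auto)
    also have "\<dots> = (\<Sum>i<k. if i = j then f (b i) else 0)"
      by (rule sum.cong) (use lb j in auto)
    finally show "f x = 0" using j by simp
  qed simp
  show "span (b ` {..<k}) = W"
  proof
    show "span (b ` {..<k}) \<subseteq> W" by (rule span_minimal) (use W b in auto)
    show "W \<subseteq> span (b ` {..<k})"
    proof
      fix w assume "w \<in> W"
      moreover have "(\<Sum>i<k. l i w *\<^sub>R b i) \<in> span (b ` {..<k})"
        by (intro span_sum span_scale span_base) auto
      ultimately show "w \<in> span (b ` {..<k})" using expand[of w] by metis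
    qed
  qed
qed

lemma vector_bundle_fiber:
  "vector_bundle A E \<Longrightarrow> subspace (fiber E p)"
  "vector_bundle A E \<Longrightarrow> s \<in> sections E \<Longrightarrow> s p \<in> fiber E p"
  unfolding vector_bundle_def by meson+

text \<open>A frame together with its coefficient functionals. The coefficients of a section are
  then explicit functions, so their smoothness can be stated and checked directly.\<close>

definition biorthogonal_frame ::
    "('m::topological_space, 'v::real_vector) vbundle \<Rightarrow> 'm set \<Rightarrow> nat \<Rightarrow> (nat \<Rightarrow> 'm \<Rightarrow> 'v) \<Rightarrow>
     (nat \<Rightarrow> 'm \<Rightarrow> 'v \<Rightarrow> real) \<Rightarrow> bool"
  where "biorthogonal_frame E V k b l \<longleftrightarrow>
    open V \<and> (\<forall>i<k. b i \<in> sections E) \<and>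
    (\<forall>i<k. \<forall>q\<in>V. linear_map_on (fiber E q) UNIV (l i q)) \<and>
    (\<forall>i<k. \<forall>j<k. \<forall>q\<in>V. l i q (b j q) = (if i = j then 1 else 0)) \<and>
    (\<forall>q\<in>V. \<forall>w\<in>fiber E q. w = (\<Sum>i<k. l i q w *\<^sub>R b i q))"

lemma biorthogonal_frameI:
  assumes "open V" "\<And>i. i < k \<Longrightarrow> b i \<in> sections E"
    "\<And>i q. i < k \<Longrightarrow> q \<in> V \<Longrightarrow> linear_map_on (fiber E q) UNIV (l i q)"
    "\<And>i j q. i < k \<Longrightarrow> j < k \<Longrightarrow> q \<in> V \<Longrightarrow> l i q (b j q) = (if i = j then 1 else 0)"
    "\<And>q w. q \<in> V \<Longrightarrow> w \<in> fiber E q \<Longrightarrow> w = (\<Sum>i<k. l i q w *\<^sub>R b i q)"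
  shows "biorthogonal_frame E V k b l"
  unfolding biorthogonal_frame_def using assms by blast

lemma biorthogonal_frameD:
  assumes "biorthogonal_frame E V k b l"
  shows "open V" "i < k \<Longrightarrow> b i \<in> sections E"
    "i < k \<Longrightarrow> q \<in> V \<Longrightarrow> linear_map_on (fiber E q) UNIV (l i q)"
    "i < k \<Longrightarrow> j < k \<Longrightarrow> q \<in> V \<Longrightarrow> l i q (b j q) = (if i = j then 1 else 0)"
    "q \<in> V \<Longrightarrow> w \<in> fiber E q \<Longrightarrow> w = (\<Sum>i<k. l i q w *\<^sub>R b i q)"
  using assms unfolding biorthogonal_frame_def by blast+

text \<open>The coefficient functions demanded by \<open>vector_bundle\<close> are
  \<open>l i q (s q)\<close>, and they serve on all of V without shrinking it.\<close>

lemma vector_bundleI: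
  fixes k :: nat
  assumes fib: "\<And>p. subspace (fiber E p)"
    and sec: "\<And>s p. s \<in> sections E \<Longrightarrow> s p \<in> fiber E p"
    and zero: "0 \<in> sections E"
    and add: "\<And>s t. s \<in> sections E \<Longrightarrow> t \<in> sections E \<Longrightarrow> s + t \<in> sections E"
    and mult: "\<And>f s. f \<in> smooth_functions A \<Longrightarrow> s \<in> sections E \<Longrightarrow> fun_mult f s \<in> sections E"
    and loc: "\<And>s. (\<And>p. s p \<in> fiber E p) \<Longrightarrow>
      (\<And>p. \<exists>U. open U \<and> p \<in> U \<and> (\<exists>t\<in>sections E. \<forall>q\<in>U. s q = t q)) \<Longrightarrow> s \<in> sections E"
    and frame: "\<And>p. \<exists>V b l. p \<in> V \<and> biorthogonal_frame E V k b l \<and>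
      (\<forall>i<k. \<forall>s\<in>sections E. (\<lambda>q. l i q (s q)) \<in> smooth_functions A)"
  shows "vector_bundle A E"
proof -
  have "\<exists>U e. p \<in> U \<and> smooth_frame E U k e \<and>
       (\<forall>s\<in>sections E. \<exists>V c. open V \<and> p \<in> V \<and> V \<subseteq> U \<and> (\<forall>i<k. c i \<in> smooth_functions A) \<and>
          (\<forall>q\<in>V. s q = (\<Sum>i<k. c i q *\<^sub>R e i q)))" for p
  proof -
    obtain V b l where V: "p \<in> V" and frm: "biorthogonal_frame E V k b l"
      and sm: "\<forall>i<k. \<forall>s\<in>sections E. (\<lambda>q. l i q (s q)) \<in> smooth_functions A"
      using frame[of p] by (elim exE conjE) (rule that)
    note bf = biorthogonal_frameD[OF frm]
    have "smooth_frame E V k b"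
      unfolding smooth_frame_def
    proof (intro conjI ballI allI impI bf(1,2))
      fix q assume q: "q \<in> V"
      note basis = biorthogonal_basis[where b = "\<lambda>i. b i q" and l = "\<lambda>i. l i q",
          OF fib sec[OF bf(2)] bf(3)[OF _ q] bf(4)[OF _ _ q] bf(5)[OF q]]
      show "inj_on (\<lambda>i. b i q) {..<k}" "independent ((\<lambda>i. b i q) ` {..<k})"
        "span ((\<lambda>i. b i q) ` {..<k}) = fiber E q"
        using basis by blast+
    qed
    moreover have "\<forall>s\<in>sections E. \<exists>V' c. open V' \<and> p \<in> V' \<and> V' \<subseteq> V \<and>
        (\<forall>i<k. c i \<in> smooth_functions A) \<and> (\<forall>q\<in>V'. s q = (\<Sum>i<k. c i q *\<^sub>R b i q))"
    proof
      fix s assume s: "s \<in> sections E"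
      show "\<exists>V' c. open V' \<and> p \<in> V' \<and> V' \<subseteq> V \<and>
        (\<forall>i<k. c i \<in> smooth_functions A) \<and> (\<forall>q\<in>V'. s q = (\<Sum>i<k. c i q *\<^sub>R b i q))"
      proof (intro exI conjI ballI allI impI)
        show "s q = (\<Sum>i<k. l i q (s q) *\<^sub>R b i q)" if "q \<in> V" for q
          by (rule bf(5)[OF that sec[OF s]])
      qed (use V bf(1) sm s in auto)
    qed
    ultimately show ?thesis using V by (intro exI[of _ V] exI[of _ b] conjI)
  qed
  then have frames: "\<exists>k. \<forall>p. \<exists>U e. p \<in> U \<and> smooth_frame E U k e \<and>
       (\<forall>s\<in>sections E. \<exists>V c. open V \<and> p \<in> V \<and> V \<subseteq> U \<and> (\<forall>i<k. c i \<in> smooth_functions A) \<and>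
          (\<forall>q\<in>V. s q = (\<Sum>i<k. c i q *\<^sub>R e i q)))"
    by (intro exI[of _ k] allI)
  have local: "\<forall>s. (\<forall>p. s p \<in> fiber E p) \<and>
         (\<forall>p. \<exists>U. open U \<and> p \<in> U \<and> (\<exists>t\<in>sections E. \<forall>q\<in>U. s q = t q)) \<longrightarrow> s \<in> sections E"
    using loc by simp
  have "\<forall>p. subspace (fiber E p)" "\<forall>s\<in>sections E. \<forall>p. s p \<in> fiber E p"
    "\<forall>s\<in>sections E. \<forall>t\<in>sections E. s + t \<in> sections E"
    "\<forall>f\<in>smooth_functions A. \<forall>s\<in>sections E. fun_mult f s \<in> sections E"
    using fib sec add mult by auto
  then show ?thesis
    unfolding vector_bundle_def using zero local frames by (intro conjI)
qed

section \<open>Tangent and cotangent bundles as modules over the smooth functions\<close>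

locale tangent_vector_bundle = smooth_manifold_atlas A
  for A :: "('m::{t2_space,second_countable_topology}, 'e::euclidean_space) atlas" +
  assumes TM: "vector_bundle A (tangent_bundle A)"
begin

abbreviation "T \<equiv> tangent_space A"
abbreviation "T' \<equiv> fiber (cotangent_bundle A)"
abbreviation "VF \<equiv> sections (tangent_bundle A)"
abbreviation "OM \<equiv> sections (cotangent_bundle A)"

lemma fiber_TM [simp]: "fiber (tangent_bundle A) = T"
  by (simp add: tangent_bundle_def)

lemma subspace_T: "subspace (T p)"
  using vector_bundle_fiber(1)[OF TM] by simp

lemma T_add: "v \<in> T p \<Longrightarrow> f \<in> C \<Longrightarrow> g \<in> C \<Longrightarrow> v (\<lambda>q. f q + g q) = v f + v g"
  and T_scale: "v \<in> T p \<Longrightarrow> f \<in> C \<Longrightarrow> v (\<lambda>q. r * f q) = r * v f"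
  and T_mult: "v \<in> T p \<Longrightarrow> f \<in> C \<Longrightarrow> g \<in> C \<Longrightarrow> v (\<lambda>q. f q * g q) = v f * g p + f p * v g"
  and T_nonsmooth: "v \<in> T p \<Longrightarrow> f \<notin> C \<Longrightarrow> v f = 0"
  by (auto simp: tangent_space_def linear_map_on_def plus_fun_def scaleR_fun_def)

lemma T_diff: "v \<in> T p \<Longrightarrow> f \<in> C \<Longrightarrow> g \<in> C \<Longrightarrow> v (\<lambda>q. f q - g q) = v f - v g"
  using T_add[of v p "\<lambda>q. f q - g q" g] by (simp add: smooth_functions_diff)

lemma T_eqI: "v \<in> T p \<Longrightarrow> w \<in> T p \<Longrightarrow> (\<And>f. f \<in> C \<Longrightarrow> v f = w f) \<Longrightarrow> v = w"
  by (rule ext) (metis T_nonsmooth)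

lemma T'_iff: "\<xi> \<in> T' p \<longleftrightarrow> linear_map_on (T p) UNIV \<xi> \<and> (\<forall>v. v \<notin> T p \<longrightarrow> \<xi> v = 0)"
  by (simp add: dual_bundle_def Let_def)

lemma T'_linear: "\<xi> \<in> T' p \<Longrightarrow> linear_map_on (T p) UNIV \<xi>"
  by (simp add: T'_iff)

lemma T'_eqI: "\<xi> \<in> T' p \<Longrightarrow> \<eta> \<in> T' p \<Longrightarrow> (\<And>v. v \<in> T p \<Longrightarrow> \<xi> v = \<eta> v) \<Longrightarrow> \<xi> = \<eta>"
  by (auto simp: T'_iff fun_eq_iff) metis

lemma subspace_T': "subspace (T' p)"
  by (auto simp: T'_iff scaleR_fun_def subspace_def linear_map_on_def algebra_simps)

lemma T'_evaluation_linear: "linear_map_on (T' p) UNIV (\<lambda>\<xi>. \<xi> v)"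
  by (auto intro!: linear_map_onI simp: scaleR_fun_def)

lemma VF_iff: "X \<in> VF \<longleftrightarrow> (\<forall>p. X p \<in> T p) \<and> (\<forall>f\<in>C. (\<lambda>p. X p f) \<in> C)"
  by (simp add: tangent_bundle_def)

lemma OM_iff: "\<beta> \<in> OM \<longleftrightarrow> (\<forall>p. \<beta> p \<in> T' p) \<and> (\<forall>X\<in>VF. fib_app \<beta> X \<in> C)"
  by (simp add: dual_bundle_def Let_def)

lemma VF_T: "X \<in> VF \<Longrightarrow> X p \<in> T p" and VF_smooth: "X \<in> VF \<Longrightarrow> f \<in> C \<Longrightarrow> (\<lambda>p. X p f) \<in> C"
  by (auto simp: VF_iff)

lemma OM_T': "\<beta> \<in> OM \<Longrightarrow> \<beta> p \<in> T' p" and pair_smooth: "\<beta> \<in> OM \<Longrightarrow> X \<in> VF \<Longrightarrow> fib_app \<beta> X \<in> C"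
  by (auto simp: OM_iff)

lemma pair_smooth': "\<beta> \<in> OM \<Longrightarrow> X \<in> VF \<Longrightarrow> (\<lambda>p. \<beta> p (X p)) \<in> C"
  using pair_smooth by (simp add: fib_app_def)

lemma VF_add: "X \<in> VF \<Longrightarrow> Y \<in> VF \<Longrightarrow> X + Y \<in> VF"
  and VF_mult: "f \<in> C \<Longrightarrow> X \<in> VF \<Longrightarrow> fun_mult f X \<in> VF"
  and VF_0: "0 \<in> VF"
  using TM unfolding vector_bundle_def by meson+

lemma T'_add: "\<xi> \<in> T' p \<Longrightarrow> u \<in> T p \<Longrightarrow> v \<in> T p \<Longrightarrow> \<xi> (u + v) = \<xi> u + \<xi> v"
  and T'_scale: "\<xi> \<in> T' p \<Longrightarrow> u \<in> T p \<Longrightarrow> \<xi> (r *\<^sub>R u) = r * \<xi> u"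
  using linear_map_onD(2,3)[OF T'_linear] by auto

lemma T'_diff: "\<xi> \<in> T' p \<Longrightarrow> u \<in> T p \<Longrightarrow> v \<in> T p \<Longrightarrow> \<xi> (u - v) = \<xi> u - \<xi> v"
  using linear_map_on_diff[OF T'_linear subspace_T] .

lemma T'_lincomb:
  "\<xi> \<in> T' p \<Longrightarrow> (\<And>i. i \<in> I \<Longrightarrow> x i \<in> T p) \<Longrightarrow> \<xi> (\<Sum>i\<in>I. c i *\<^sub>R x i) = (\<Sum>i\<in>I. c i * \<xi> (x i))"
  using linear_map_on_lincomb[OF T'_linear subspace_T, of \<xi> p I x c] by simp

lemma OM_0: "0 \<in> OM"
  using subspace_0[OF subspace_T'] smooth_functions_const by (auto simp: OM_iff fib_app_def)

lemma OM_add: "\<alpha> \<in> OM \<Longrightarrow> \<beta> \<in> OM \<Longrightarrow> \<alpha> + \<beta> \<in> OM"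
  by (auto simp: OM_iff fib_app_def intro: subspace_add[OF subspace_T'] smooth_functions_add)

lemma OM_mult: "f \<in> C \<Longrightarrow> \<beta> \<in> OM \<Longrightarrow> fun_mult f \<beta> \<in> OM"
proof -
  assume f: "f \<in> C" and \<beta>: "\<beta> \<in> OM"
  have "fun_mult f \<beta> p \<in> T' p" for p
    using subspace_scale[OF subspace_T' OM_T'[OF \<beta>]] by (simp add: fun_mult_def)
  moreover have "fib_app (fun_mult f \<beta>) X = (\<lambda>p. f p * fib_app \<beta> X p)" for X
    by (simp add: fib_app_def fun_mult_def scaleR_fun_def)
  ultimately show ?thesis
    using smooth_functions_mult[OF f pair_smooth[OF \<beta>]] by (simp add: OM_iff)
qed

lemma VF_diff: "X \<in> VF \<Longrightarrow> Y \<in> VF \<Longrightarrow> X - Y \<in> VF"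
proof -
  assume "X \<in> VF" "Y \<in> VF"
  then have "X + fun_mult (\<lambda>_. -1) Y \<in> VF" by (intro VF_add VF_mult smooth_functions_const)
  also have "X + fun_mult (\<lambda>_. -1) Y = X - Y" by (auto simp: fun_mult_def fun_eq_iff)
  finally show ?thesis .
qed

lemma OM_diff: "\<alpha> \<in> OM \<Longrightarrow> \<beta> \<in> OM \<Longrightarrow> \<alpha> - \<beta> \<in> OM"
proof -
  assume "\<alpha> \<in> OM" "\<beta> \<in> OM"
  then have "\<alpha> + fun_mult (\<lambda>_. -1) \<beta> \<in> OM" by (intro OM_add OM_mult smooth_functions_const)
  also have "\<alpha> + fun_mult (\<lambda>_. -1) \<beta> = \<alpha> - \<beta>" by (auto simp: fun_mult_def fun_eq_iff)
  finally show ?thesis .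
qed

lemma VF_sum: "(\<And>i. i \<in> I \<Longrightarrow> X i \<in> VF) \<Longrightarrow> (\<Sum>i\<in>I. X i) \<in> VF"
  by (induction I rule: infinite_finite_induct) (auto intro: VF_0 VF_add)

lemma OM_sum: "(\<And>i. i \<in> I \<Longrightarrow> X i \<in> OM) \<Longrightarrow> (\<Sum>i\<in>I. X i) \<in> OM"
  by (induction I rule: infinite_finite_induct) (auto intro: OM_0 OM_add)

text \<open>The differential df, set to 0 off the tangent space by the convention of
  \<open>dual_bundle\<close>. Since tangent vectors are derivations, these forms suffice to separate
  them.\<close>

definition diff_form :: "('m \<Rightarrow> real) \<Rightarrow> 'm \<Rightarrow> 'm tvec \<Rightarrow> real"
  where "diff_form f p v = (if v \<in> T p then v f else 0)"

lemma diff_form_apply: "v \<in> T p \<Longrightarrow> diff_form f p v = v f"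
  by (simp add: diff_form_def)

lemma diff_form_OM: "f \<in> C \<Longrightarrow> diff_form f \<in> OM"
proof -
  assume f: "f \<in> C"
  have "diff_form f p \<in> T' p" for p
    using subspace_add[OF subspace_T] subspace_scale[OF subspace_T]
    by (auto simp: T'_iff diff_form_def scaleR_fun_def intro!: linear_map_onI)
  moreover have "fib_app (diff_form f) X = (\<lambda>p. X p f)" if "X \<in> VF" for X
    using VF_T[OF that] by (auto simp: fib_app_def diff_form_apply)
  ultimately show ?thesis using VF_smooth[OF _ f] by (simp add: OM_iff)
qed

text \<open>Gram-Schmidt orthogonalisation of a frame against differentials of functions.  It yields
  the dual frame without inverting a matrix of functions.\<close>

lemma biorthogonalise:
  fixes m :: nat
  assumes U: "open U" "p \<in> U" and e: "\<forall>i<m. e i \<in> VF"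
    and ind: "inj_on (\<lambda>i. e i p) {..<m}" "independent ((\<lambda>i. e i p) ` {..<m})"
  shows "\<exists>V b l. open V \<and> p \<in> V \<and> V \<subseteq> U \<and> (\<forall>i<m. b i \<in> VF) \<and> (\<forall>i<m. l i \<in> OM) \<and>
    (\<forall>q\<in>V. \<forall>i<m. \<forall>j<m. l i q (b j q) = (if i = j then 1 else 0)) \<and>
    (\<forall>q\<in>V. \<forall>i<m. e i q = (\<Sum>j<m. l j q (e i q) *\<^sub>R b j q)) \<and>
    (\<forall>i<m. b i p \<in> span ((\<lambda>i. e i p) ` {..<m}))"
  using e ind
proof (induction m)
  case 0
  show ?case using U by auto
next
  case (Suc m)
  have "\<exists>V b l. open V \<and> p \<in> V \<and> V \<subseteq> U \<and> (\<forall>i<m. b i \<in> VF) \<and> (\<forall>i<m. l i \<in> OM) \<and>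
    (\<forall>q\<in>V. \<forall>i<m. \<forall>j<m. l i q (b j q) = (if i = j then 1 else 0)) \<and>
    (\<forall>q\<in>V. \<forall>i<m. e i q = (\<Sum>j<m. l j q (e i q) *\<^sub>R b j q)) \<and>
    (\<forall>i<m. b i p \<in> span ((\<lambda>i. e i p) ` {..<m}))"
  proof (rule Suc.IH)
    show "inj_on (\<lambda>i. e i p) {..<m}" by (rule inj_on_subset[OF Suc.prems(2)]) auto
    show "independent ((\<lambda>i. e i p) ` {..<m})" by (rule independent_mono[OF Suc.prems(3)]) auto
  qed (use Suc.prems(1) in simp)
  then obtain V b l where V: "open V" "p \<in> V" "V \<subseteq> U"
    and *: "\<forall>i<m. b i \<in> VF" "\<forall>i<m. l i \<in> OM"
      "\<forall>q\<in>V. \<forall>i<m. \<forall>j<m. l i q (b j q) = (if i = j then 1 else 0)"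
      "\<forall>q\<in>V. \<forall>i<m. e i q = (\<Sum>j<m. l j q (e i q) *\<^sub>R b j q)"
      "\<forall>i<m. b i p \<in> span ((\<lambda>i. e i p) ` {..<m})"
    by (elim exE conjE) (rule that)
  note b = *(1)[rule_format] and l = *(2)[rule_format] and lb = *(3)[rule_format]
    and ex = *(4)[rule_format] and sp = *(5)[rule_format]
  have em: "e m \<in> VF" using Suc.prems(1) by simp
  define s where "s = e m - (\<Sum>i<m. fun_mult (fib_app (l i) (e m)) (b i))"
  have s_apply: "s q = e m q - (\<Sum>i<m. l i q (e m q) *\<^sub>R b i q)" for q
    by (simp add: s_def sum_fun_apply fun_mult_def fib_app_def)
  have s: "s \<in> VF"
    unfolding s_def using em b l by (intro VF_diff VF_sum VF_mult pair_smooth) auto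
  have ls: "l i q (s q) = 0" if "q \<in> V" "i < m" for i q
  proof -
    have "l i q (\<Sum>j<m. l j q (e m q) *\<^sub>R b j q) = (\<Sum>j<m. l j q (e m q) * l i q (b j q))"
      by (rule T'_lincomb[OF OM_T'[OF l[OF that(2)]]]) (use VF_T b in auto)
    also have "\<dots> = (\<Sum>j<m. if j = i then l j q (e m q) else 0)"
      by (rule sum.cong) (use lb that in auto)
    also have "\<dots> = l i q (e m q)" using that(2) by simp
    moreover have "l i q (s q) = l i q (e m q) - l i q (\<Sum>j<m. l j q (e m q) *\<^sub>R b j q)"
      unfolding s_apply using b em l that(2)
      by (intro T'_diff[of _ q] OM_T' VF_T subspace_sum[OF subspace_T] subspace_scale[OF subspace_T]) auto
    ultimately show ?thesis by simp
  qed
  \<comment> \<open>Otherwise \<open>e m p\<close> would depend linearly on the earlier members. The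
    span clause at p is carried through the induction for this purpose; independence is available at
    p only.\<close>
  have "s p \<noteq> 0"
  proof
    assume "s p = 0"
    then have "e m p = (\<Sum>i<m. l i p (e m p) *\<^sub>R b i p)" by (simp add: s_apply)
    then have "e m p \<in> span ((\<lambda>i. e i p) ` {..<m})"
      using sp by (metis (no_types, lifting) lessThan_iff span_scale span_sum)
    moreover have "(\<lambda>i. e i p) ` {..<m} = (\<lambda>i. e i p) ` {..<Suc m} - {e m p}"
      using Suc.prems(2) by (auto simp: inj_on_def lessThan_Suc)
    ultimately show False
      using Suc.prems(3) unfolding dependent_def by (metis imageI lessI lessThan_iff)
  qed
  \<comment> \<open>A nonzero derivation is nonzero on some smooth f. The form df, less its
    components along the earlier forms, becomes the new dual form \<tau>, and g normalises its value
    on s to 1.\<close>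
  then obtain f where f: "f \<in> C" "s p f \<noteq> 0"
    using T_eqI[OF VF_T[OF s] VF_T[OF VF_0], of p] by auto
  obtain g W where g: "g \<in> C" and W: "open W" "p \<in> W" and gs: "\<And>q. q \<in> W \<Longrightarrow> g q * s q f = 1"
    using local_reciprocal[OF VF_smooth[OF s f(1)] f(2)] by metis
  define \<tau> where "\<tau> = diff_form f - (\<Sum>j<m. fun_mult (fib_app (diff_form f) (b j)) (l j))"
  have \<tau>_apply: "\<tau> q v = diff_form f q v - (\<Sum>j<m. diff_form f q (b j q) * l j q v)" for q v
    by (simp add: \<tau>_def sum_fun_apply fun_mult_def fib_app_def scaleR_fun_def)
  have \<tau>: "\<tau> \<in> OM"
    unfolding \<tau>_def using b l f by (intro OM_diff OM_sum OM_mult pair_smooth diff_form_OM) auto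
  have \<tau>b: "\<tau> q (b i q) = 0" if "q \<in> V" "i < m" for i q
  proof -
    have "(\<Sum>j<m. diff_form f q (b j q) * l j q (b i q)) = (\<Sum>j<m. if j = i then diff_form f q (b j q) else 0)"
      by (rule sum.cong) (use lb that in auto)
    then show ?thesis using that by (simp add: \<tau>_apply)
  qed
  have \<tau>s: "\<tau> q (s q) = s q f" if "q \<in> V" for q
    using ls[OF that] VF_T[OF s] by (simp add: \<tau>_apply diff_form_apply)
  have \<tau>e: "\<tau> q (e i q) = 0" if "q \<in> V" "i < m" for q i
  proof -
    have "\<tau> q (e i q) = (\<Sum>j<m. l j q (e i q) * \<tau> q (b j q))"
      by (subst ex[OF that], rule T'_lincomb[OF OM_T'[OF \<tau>]]) (use VF_T b in auto)
    then show ?thesis using \<tau>b[OF that(1)] by simp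
  qed
  have \<tau>em: "\<tau> q (e m q) = s q f" if "q \<in> V" for q
  proof -
    have "\<tau> q (s q) = \<tau> q (e m q) - \<tau> q (\<Sum>j<m. l j q (e m q) *\<^sub>R b j q)"
      unfolding s_apply using b em l \<tau>
      by (intro T'_diff[of _ q] OM_T' VF_T subspace_sum[OF subspace_T] subspace_scale[OF subspace_T]) auto
    also have "\<tau> q (\<Sum>j<m. l j q (e m q) *\<^sub>R b j q) = (\<Sum>j<m. l j q (e m q) * \<tau> q (b j q))"
      by (rule T'_lincomb[OF OM_T'[OF \<tau>]]) (use VF_T b in auto)
    finally show ?thesis using \<tau>b[OF that] \<tau>s[OF that] by simp
  qed
  \<comment> \<open>The earlier pairs stay unchanged: each \<open>l i\<close> kills s, and \<tau>
    kills each \<open>b i\<close>.\<close>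
  define b' where "b' i = (if i = m then fun_mult g s else b i)" for i
  define l' where "l' i = (if i = m then \<tau> else l i)" for i
  have "open (V \<inter> W)" "p \<in> V \<inter> W" "V \<inter> W \<subseteq> U" using V W by auto
  moreover have "\<forall>i<Suc m. b' i \<in> VF" using b g s VF_mult by (auto simp: b'_def less_Suc_eq)
  moreover have "\<forall>i<Suc m. l' i \<in> OM" using l \<tau> by (auto simp: l'_def less_Suc_eq)
  moreover have "\<forall>q\<in>V \<inter> W. \<forall>i<Suc m. \<forall>j<Suc m. l' i q (b' j q) = (if i = j then 1 else 0)"
  proof (intro ballI allI impI)
    fix q i j assume q: "q \<in> V \<inter> W" and "i < Suc m" "j < Suc m"
    moreover have "l' i q (g q *\<^sub>R s q) = g q * l' i q (s q)" if "i < Suc m"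
      using that l \<tau> s by (intro T'_scale[of _ q] OM_T' VF_T) (auto simp: l'_def less_Suc_eq)
    ultimately show "l' i q (b' j q) = (if i = j then 1 else 0)"
      using lb[of q] ls[of q] \<tau>b[of q] \<tau>s[of q] gs[of q]
      by (auto simp: b'_def l'_def less_Suc_eq fun_mult_def)
  qed
  moreover have "\<forall>q\<in>V \<inter> W. \<forall>i<Suc m. e i q = (\<Sum>j<Suc m. l' j q (e i q) *\<^sub>R b' j q)"
  proof (intro ballI allI impI)
    fix q i assume q: "q \<in> V \<inter> W" and i: "i < Suc m"
    have "(\<Sum>j<Suc m. l' j q (e i q) *\<^sub>R b' j q) =
        (\<Sum>j<m. l j q (e i q) *\<^sub>R b j q) + \<tau> q (e i q) *\<^sub>R g q *\<^sub>R s q"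
      by (simp add: b'_def l'_def fun_mult_def)
    also have "\<dots> = e i q"
    proof (cases "i = m")
      case True
      have "\<tau> q (e i q) *\<^sub>R g q *\<^sub>R s q = s q"
        using \<tau>em[of q] gs[of q] q True by (simp add: mult.commute)
      then show ?thesis using True by (simp add: s_apply)
    next
      case False
      then show ?thesis using i q \<tau>e[of q i] ex[of q i] by simp
    qed
    finally show "e i q = (\<Sum>j<Suc m. l' j q (e i q) *\<^sub>R b' j q)" by simp
  qed
  moreover have "\<forall>i<Suc m. b' i p \<in> span ((\<lambda>i. e i p) ` {..<Suc m})"
  proof (intro allI impI)
    fix i assume i: "i < Suc m"
    have sp': "b j p \<in> span ((\<lambda>i. e i p) ` {..<Suc m})" if "j < m" for j
      using sp[OF that] by (rule subsetD[OF span_mono, rotated]) auto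
    have "s p \<in> span ((\<lambda>i. e i p) ` {..<Suc m})"
      unfolding s_apply by (intro span_diff span_sum span_scale sp') (auto intro: span_base)
    then show "b' i p \<in> span ((\<lambda>i. e i p) ` {..<Suc m})"
      using sp' i by (auto simp: b'_def fun_mult_def less_Suc_eq intro: span_scale)
  qed
  ultimately show ?case by blast
qed

lemma tangent_frames:
  obtains k where "\<And>p. \<exists>V b l. p \<in> V \<and> biorthogonal_frame (tangent_bundle A) V k b l \<and> (\<forall>i<k. l i \<in> OM)"
proof -
  obtain k where k: "\<And>p. \<exists>U e. p \<in> U \<and> smooth_frame (tangent_bundle A) U k e"
    using TM unfolding vector_bundle_def by meson
  have "\<exists>V b l. p \<in> V \<and> biorthogonal_frame (tangent_bundle A) V k b l \<and> (\<forall>i<k. l i \<in> OM)" for p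
  proof -
    obtain U e where "p \<in> U" "smooth_frame (tangent_bundle A) U k e" using k by metis
    then have U: "open U" "p \<in> U" and e: "\<forall>i<k. e i \<in> VF"
      and ind: "inj_on (\<lambda>i. e i p) {..<k}" "independent ((\<lambda>i. e i p) ` {..<k})"
      and sp: "\<And>q. q \<in> U \<Longrightarrow> span ((\<lambda>i. e i q) ` {..<k}) = T q"
      by (auto simp: smooth_frame_def)
    obtain V b l where V: "open V" "p \<in> V" "V \<subseteq> U"
      and *: "\<forall>i<k. b i \<in> VF" "\<forall>i<k. l i \<in> OM"
        "\<forall>q\<in>V. \<forall>i<k. \<forall>j<k. l i q (b j q) = (if i = j then 1 else 0)"
        "\<forall>q\<in>V. \<forall>i<k. e i q = (\<Sum>j<k. l j q (e i q) *\<^sub>R b j q)"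
      using biorthogonalise[OF U e ind] by (elim exE conjE) (rule that)
    note b = *(1)[rule_format] and l = *(2)[rule_format] and lb = *(3)[rule_format]
      and ex = *(4)[rule_format]
    have "v = (\<Sum>j<k. l j q v *\<^sub>R b j q)" if q: "q \<in> V" and "v \<in> T q" for q v
    proof -
      \<comment> \<open>The vectors satisfying the expansion form a subspace that contains every
        \<open>e i q\<close>, hence the fibre.\<close>
      let ?S = "{v \<in> T q. v = (\<Sum>j<k. l j q v *\<^sub>R b j q)}"
      have "subspace ?S"
      proof (rule subspaceI)
        show "0 \<in> ?S"
          using subspace_0[OF subspace_T] linear_map_on_0[OF T'_linear[OF OM_T'[OF l]] subspace_T]
          by (auto intro!: sum.neutral)
        show "x + y \<in> ?S" if "x \<in> ?S" "y \<in> ?S" for x y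
        proof -
          have "(\<Sum>j<k. l j q (x + y) *\<^sub>R b j q) = (\<Sum>j<k. (l j q x + l j q y) *\<^sub>R b j q)"
            by (rule sum.cong) (use that T'_add[OF OM_T'[OF l]] in auto)
          also have "\<dots> = x + y"
            using that by (simp add: scaleR_add_left sum.distrib)
          finally show ?thesis using that subspace_add[OF subspace_T] by simp
        qed
        show "c *\<^sub>R x \<in> ?S" if "x \<in> ?S" for c x
        proof -
          have "(\<Sum>j<k. l j q (c *\<^sub>R x) *\<^sub>R b j q) = (\<Sum>j<k. c *\<^sub>R l j q x *\<^sub>R b j q)"
            by (rule sum.cong) (use that T'_scale[OF OM_T'[OF l]] in auto)
          also have "\<dots> = c *\<^sub>R (\<Sum>j<k. l j q x *\<^sub>R b j q)" by (simp only: scaleR_sum_right)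
          also have "\<dots> = c *\<^sub>R x" using that by simp
          finally show ?thesis using that subspace_scale[OF subspace_T] by simp
        qed
      qed
      moreover have "(\<lambda>i. e i q) ` {..<k} \<subseteq> ?S"
        using ex[OF q] e VF_T by auto
      ultimately have "T q \<subseteq> ?S" using sp[of q] q V(3) span_minimal by blast
      then show ?thesis using that by blast
    qed
    then have "biorthogonal_frame (tangent_bundle A) V k b l"
      using V(1) b lb T'_linear[OF OM_T'[OF l]] by (intro biorthogonal_frameI) auto
    then show ?thesis using V(2) l by blast
  qed
  then show thesis by (rule that)
qed

lemma cotangent_expand:
  assumes "\<And>i. i < k \<Longrightarrow> b i \<in> T q" "\<And>i. i < k \<Longrightarrow> l i \<in> T' q"
    "\<And>v. v \<in> T q \<Longrightarrow> v = (\<Sum>j<k. l j v *\<^sub>R b j)" "\<xi> \<in> T' q"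
  shows "\<xi> = (\<Sum>j<k. \<xi> (b j) *\<^sub>R l j)"
proof (rule T'_eqI[OF assms(4)])
  show "(\<Sum>j<k. \<xi> (b j) *\<^sub>R l j) \<in> T' q"
    using assms by (intro subspace_sum[OF subspace_T'] subspace_scale[OF subspace_T']) auto
  fix v assume v: "v \<in> T q"
  have "\<xi> v = \<xi> (\<Sum>j<k. l j v *\<^sub>R b j)" using assms(3)[OF v] by simp
  also have "\<dots> = (\<Sum>j<k. l j v * \<xi> (b j))"
    by (rule T'_lincomb[OF assms(4)]) (use assms in auto)
  finally show "\<xi> v = (\<Sum>j<k. \<xi> (b j) *\<^sub>R l j) v"
    by (simp add: sum_fun_apply scaleR_fun_def mult.commute)
qed

lemma OM_local:
  assumes "\<And>p. \<beta> p \<in> T' p" "\<And>p. \<exists>U. open U \<and> p \<in> U \<and> (\<exists>\<gamma>\<in>OM. \<forall>q\<in>U. \<beta> q = \<gamma> q)"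
  shows "\<beta> \<in> OM"
proof -
  have "fib_app \<beta> X \<in> C" if "X \<in> VF" for X
  proof (rule smooth_functions_local)
    fix p
    obtain U \<gamma> where "open U" "p \<in> U" "\<gamma> \<in> OM" "\<forall>q\<in>U. \<beta> q = \<gamma> q" using assms(2) by metis
    then show "\<exists>W g. open W \<and> p \<in> W \<and> g \<in> C \<and> (\<forall>q\<in>W. fib_app \<beta> X q = g q)"
      using pair_smooth[OF _ that] by (intro exI[of _ U] exI[of _ "fib_app \<gamma> X"]) (auto simp: fib_app_def)
  qed
  then show ?thesis using assms(1) by (simp add: OM_iff)
qed

lemma VF_local:
  assumes "\<And>p. X p \<in> T p" "\<And>p. \<exists>U. open U \<and> p \<in> U \<and> (\<exists>Y\<in>VF. \<forall>q\<in>U. X q = Y q)"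
  shows "X \<in> VF"
proof -
  have "(\<lambda>q. X q f) \<in> C" if "f \<in> C" for f
  proof (rule smooth_functions_local)
    fix p
    obtain U Y where "open U" "p \<in> U" "Y \<in> VF" "\<forall>q\<in>U. X q = Y q" using assms(2) by metis
    then show "\<exists>W g. open W \<and> p \<in> W \<and> g \<in> C \<and> (\<forall>q\<in>W. X q f = g q)"
      using VF_smooth[OF _ that] by (intro exI[of _ U] exI[of _ "\<lambda>q. Y q f"]) auto
  qed
  then show ?thesis using assms(1) by (simp add: VF_iff)
qed

text \<open>A biorthogonal frame is self-dual: \<open>l\<close> becomes the frame and evaluation at
  \<open>b\<close> its coefficient functionals.\<close>

lemma vector_bundle_cotangent: "vector_bundle A (cotangent_bundle A)"
proof -
  obtain k where k: "\<And>p. \<exists>V b l. p \<in> V \<and> biorthogonal_frame (tangent_bundle A) V k b l \<and> (\<forall>i<k. l i \<in> OM)"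
    by (rule tangent_frames) blast
  show ?thesis
  proof (rule vector_bundleI[where k = k])
    fix p
    obtain V b l where V: "p \<in> V" and frm: "biorthogonal_frame (tangent_bundle A) V k b l"
      and l': "\<forall>i<k. l i \<in> OM"
      using k[of p] by (elim exE conjE) (rule that)
    note bf = biorthogonal_frameD[OF frm] and l = l'[rule_format]
    have "biorthogonal_frame (cotangent_bundle A) V k l (\<lambda>i q \<xi>. \<xi> (b i q))"
    proof (rule biorthogonal_frameI[OF bf(1) l])
      show "\<xi> = (\<Sum>i<k. \<xi> (b i q) *\<^sub>R l i q)" if "q \<in> V" "\<xi> \<in> T' q" for q \<xi>
        by (rule cotangent_expand[OF VF_T[OF bf(2)] OM_T'[OF l] _ that(2)])
          (use bf(5)[OF that(1)] in simp_all)
    qed (auto simp: T'_evaluation_linear bf(4))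
    then show "\<exists>V b l. p \<in> V \<and> biorthogonal_frame (cotangent_bundle A) V k b l \<and>
      (\<forall>i<k. \<forall>s\<in>OM. (\<lambda>q. l i q (s q)) \<in> C)"
      using V pair_smooth'[OF _ bf(2)] by blast
  qed (auto intro: subspace_T' OM_T' OM_0 OM_add OM_mult OM_local)
qed

section \<open>The sum of tangent and cotangent bundle\<close>

abbreviation "TT \<equiv> sum_bundle (tangent_bundle A) (cotangent_bundle A)"

lemma fiber_TT [simp]: "fiber TT p = T p \<times> T' p"
  by (simp add: sum_bundle_def)

lemma sections_TT_iff: "s \<in> sections TT \<longleftrightarrow> (\<lambda>p. fst (s p)) \<in> VF \<and> (\<lambda>p. snd (s p)) \<in> OM"
  by (simp add: sum_bundle_def)

lemma vector_bundle_TT: "vector_bundle A TT"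
proof -
  obtain k where k: "\<And>p. \<exists>V b l. p \<in> V \<and> biorthogonal_frame (tangent_bundle A) V k b l \<and> (\<forall>i<k. l i \<in> OM)"
    by (rule tangent_frames) blast
  show ?thesis
  proof (rule vector_bundleI[where k = "k + k"])
    show "subspace (fiber TT p)" for p
      using subspace_T subspace_T' by (simp add: subspace_Times)
    show "s p \<in> fiber TT p" if "s \<in> sections TT" for s p
      using VF_T[of "\<lambda>p. fst (s p)" p] OM_T'[of "\<lambda>p. snd (s p)" p] that
      by (simp add: sections_TT_iff mem_Times_iff)
    show "0 \<in> sections TT" using VF_0 OM_0 by (simp add: sections_TT_iff zero_fun_def)
    show "s + t \<in> sections TT" if "s \<in> sections TT" "t \<in> sections TT" for s t
      using that VF_add[of "\<lambda>p. fst (s p)" "\<lambda>p. fst (t p)"] OM_add[of "\<lambda>p. snd (s p)" "\<lambda>p. snd (t p)"]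
      by (simp add: sections_TT_iff plus_fun_def[of "\<lambda>p. fst (s p)"] plus_fun_def[of "\<lambda>p. snd (s p)"])
    show "fun_mult f s \<in> sections TT" if "f \<in> C" "s \<in> sections TT" for f s
      using that VF_mult[of f "\<lambda>p. fst (s p)"] OM_mult[of f "\<lambda>p. snd (s p)"]
      by (simp add: sections_TT_iff fun_mult_def)
    show "s \<in> sections TT" if fib: "\<And>p. s p \<in> fiber TT p"
      and loc: "\<And>p. \<exists>U. open U \<and> p \<in> U \<and> (\<exists>t\<in>sections TT. \<forall>q\<in>U. s q = t q)" for s
    proof -
      have "(\<exists>U. open U \<and> p \<in> U \<and> (\<exists>t\<in>VF. \<forall>q\<in>U. fst (s q) = t q)) \<and>
        (\<exists>U. open U \<and> p \<in> U \<and> (\<exists>t\<in>OM. \<forall>q\<in>U. snd (s q) = t q))" for p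
      proof -
        obtain U t where U: "open U" "p \<in> U" and t: "t \<in> sections TT" "\<forall>q\<in>U. s q = t q"
          using loc[of p] by (elim exE conjE bexE) (rule that)
        then show ?thesis
          by (intro conjI exI[of _ U] bexI[of _ "\<lambda>p. fst (t p)"] bexI[of _ "\<lambda>p. snd (t p)"])
            (simp_all add: sections_TT_iff)
      qed
      moreover have "fst (s p) \<in> T p" "snd (s p) \<in> T' p" for p
        using fib[of p] by (auto simp: mem_Times_iff)
      ultimately have "(\<lambda>p. fst (s p)) \<in> VF" "(\<lambda>p. snd (s p)) \<in> OM"
        by (auto intro: VF_local OM_local)
      then show ?thesis by (simp add: sections_TT_iff)
    qed
    fix p
    obtain V b l where V: "p \<in> V" and frm: "biorthogonal_frame (tangent_bundle A) V k b l"
      and l': "\<forall>i<k. l i \<in> OM"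
      using k[of p] by (elim exE conjE) (rule that)
    note bf = biorthogonal_frameD[OF frm] and l = l'[rule_format]
    have ex': "\<xi> = (\<Sum>i<k. \<xi> (b i q) *\<^sub>R l i q)" if "q \<in> V" "\<xi> \<in> T' q" for q \<xi>
      by (rule cotangent_expand[OF VF_T[OF bf(2)] OM_T'[OF l] _ that(2)])
        (use bf(5)[OF that(1)] in simp_all)
    \<comment> \<open>Indices below k carry the tangent frame, and the next k carry the cotangent
      frame, shifted by k.\<close>
    define B where "B i = (if i < k then inl_section (b i) else inr_section (l (i - k)))" for i
    define L where "L i q w = (if i < k then l i q (fst w) else snd w (b (i - k) q))" for i q and w :: "'m tvec \<times> ('m tvec \<Rightarrow> real)"
    have "biorthogonal_frame TT V (k + k) B L"
    proof (rule biorthogonal_frameI[OF bf(1)])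
      show "B i \<in> sections TT" if "i < k + k" for i
        using bf(2)[of i] l[of "i - k"] VF_0 OM_0 that
        by (auto simp: B_def sections_TT_iff inl_section_def inr_section_def zero_fun_def)
      show "linear_map_on (fiber TT q) UNIV (L i q)" if "i < k + k" for i q
        using T'_linear[OF OM_T'[OF l, of i q]] that unfolding L_def
        by (auto simp: linear_map_on_def scaleR_fun_def)
      show "L i q (B j q) = (if i = j then 1 else 0)" if "i < k + k" "j < k + k" "q \<in> V" for i j q
      proof -
        have "l i q 0 = 0" if "i < k"
          by (rule linear_map_on_0[OF T'_linear[OF OM_T'[OF l[OF that]]] subspace_T])
        moreover have "l (j - k) q (b (i - k) q) = (if i = j then 1 else 0)" if "\<not> i < k" "\<not> j < k"
          using bf(4)[OF _ _ \<open>q \<in> V\<close>, of "j - k" "i - k"] that \<open>i < k + k\<close> \<open>j < k + k\<close>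
          by (simp add: less_diff_conv2 eq_diff_iff eq_commute[of i])
        ultimately show ?thesis
          using bf(4)[OF _ _ that(3), of i j]
          by (cases "i < k"; cases "j < k") (simp_all add: L_def B_def inl_section_def inr_section_def)
      qed
      show "w = (\<Sum>i<k + k. L i q w *\<^sub>R B i q)" if "q \<in> V" "w \<in> fiber TT q" for q w
      proof -
        have split: "(\<Sum>i<k + n. F i) = (\<Sum>i<k. F i) + (\<Sum>i<n. F (k + i))"
          for F :: "nat \<Rightarrow> 'm tvec \<times> ('m tvec \<Rightarrow> real)" and n
          by (induction n) (simp_all add: add.assoc)
        have 1: "(\<Sum>i<k. L i q w *\<^sub>R B i q) = (\<Sum>i<k. (l i q (fst w) *\<^sub>R b i q, 0))"
          by (rule sum.cong) (simp_all add: L_def B_def inl_section_def)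
        have 2: "(\<Sum>i<k. L (k + i) q w *\<^sub>R B (k + i) q) = (\<Sum>i<k. (0, snd w (b i q) *\<^sub>R l i q))"
          by (rule sum.cong) (simp_all add: L_def B_def inr_section_def)
        have w: "fst w \<in> T q" "snd w \<in> T' q" using that(2) by (auto simp: mem_Times_iff)
        show ?thesis
          unfolding split 1 2 using bf(5)[OF that(1), of "fst w"] ex'[OF that(1) w(2)] w(1)
          by (intro prod_eqI) (simp_all add: fst_sum snd_sum)
      qed
    qed
    moreover have "(\<lambda>q. L i q (s q)) \<in> C" if "i < k + k" "s \<in> sections TT" for i s
      using pair_smooth'[of "l i" "\<lambda>q. fst (s q)"] pair_smooth'[of "\<lambda>q. snd (s q)" "b (i - k)"] that bf(2) l
      by (cases "i < k") (auto simp: L_def sections_TT_iff)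
    ultimately show "\<exists>V b l. p \<in> V \<and> biorthogonal_frame TT V (k + k) b l \<and>
      (\<forall>i<k + k. \<forall>s\<in>sections TT. (\<lambda>q. l i q (s q)) \<in> C)"
      using V by blast
  qed
qed

text \<open>The cut-off function makes the expansion in a local frame a global identity.\<close>

lemma local_decomposition:
  obtains k and b :: "nat \<Rightarrow> 'm \<Rightarrow> 'm tvec" and l \<eta> where "\<eta> \<in> C" "\<eta> p = 1"
    "\<forall>i<k. b i \<in> VF" "\<forall>i<k. l i \<in> OM"
    "\<forall>v\<in>T p. v = (\<Sum>i<k. l i p v *\<^sub>R b i p)"
    "\<forall>\<xi>\<in>T' p. \<xi> = (\<Sum>i<k. \<xi> (b i p) *\<^sub>R l i p)"
    "\<forall>X\<in>VF. fun_mult \<eta> X = (\<Sum>i<k. fun_mult (fib_app (l i) X) (b i))"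
    "\<forall>\<beta>\<in>OM. fun_mult \<eta> \<beta> = (\<Sum>i<k. fun_mult (fib_app \<beta> (b i)) (l i))"
proof -
  obtain k where k: "\<And>p. \<exists>V b l. p \<in> V \<and> biorthogonal_frame (tangent_bundle A) V k b l \<and> (\<forall>i<k. l i \<in> OM)"
    by (rule tangent_frames) blast
  obtain V b l where V: "p \<in> V" and frm: "biorthogonal_frame (tangent_bundle A) V k b l"
    and l': "\<forall>i<k. l i \<in> OM"
    using k[of p] by (elim exE conjE) (rule that)
  note bf = biorthogonal_frameD[OF frm] and l = l'[rule_format]
  obtain \<eta> where \<eta>: "\<eta> \<in> C" "\<eta> p = 1" "\<And>q. q \<notin> V \<Longrightarrow> \<eta> q = 0"
    using bump_function[OF bf(1) V] by metis
  \<comment> \<open>Only the vectors are cut off. Each of the two expansions then contains exactly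
    one factor \<eta>, and both sides vanish off V.\<close>
  define b' where "b' i = fun_mult \<eta> (b i)" for i
  have b'_apply: "b' i q = \<eta> q *\<^sub>R b i q" for i q by (simp add: b'_def fun_mult_def)
  have bp: "b' i p = b i p" for i using \<eta>(2) by (simp add: b'_apply)
  have ex': "\<xi> = (\<Sum>i<k. \<xi> (b i q) *\<^sub>R l i q)" if "q \<in> V" "\<xi> \<in> T' q" for q \<xi>
    by (rule cotangent_expand[OF VF_T[OF bf(2)] OM_T'[OF l] _ that(2)])
      (use bf(5)[OF that(1)] in simp_all)
  show thesis
  proof (rule that[OF \<eta>(1,2), where b = b'])
    show "\<forall>i<k. b' i \<in> VF" using VF_mult[OF \<eta>(1) bf(2)] by (simp add: b'_def)
    show "\<forall>i<k. l i \<in> OM" by (rule l')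
    show "\<forall>v\<in>T p. v = (\<Sum>i<k. l i p v *\<^sub>R b' i p)"
      unfolding bp using bf(5)[OF V] by simp
    show "\<forall>\<xi>\<in>T' p. \<xi> = (\<Sum>i<k. \<xi> (b' i p) *\<^sub>R l i p)"
      unfolding bp using ex'[OF V] by blast
    show "\<forall>X\<in>VF. fun_mult \<eta> X = (\<Sum>i<k. fun_mult (fib_app (l i) X) (b' i))"
    proof (intro ballI ext[of "fun_mult \<eta> _"])
      fix X q assume X: "X \<in> VF"
      show "fun_mult \<eta> X q = (\<Sum>i<k. fun_mult (fib_app (l i) X) (b' i)) q"
      proof (cases "q \<in> V")
        case True
        have "\<eta> q *\<^sub>R X q = \<eta> q *\<^sub>R (\<Sum>i<k. l i q (X q) *\<^sub>R b i q)"
          by (rule arg_cong[OF bf(5)[OF True]]) (simp add: VF_T[OF X])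
        also have "\<dots> = (\<Sum>i<k. l i q (X q) *\<^sub>R b' i q)"
          by (simp add: scaleR_sum_right b'_apply mult.commute)
        finally show ?thesis by (simp add: fun_mult_def fib_app_def sum_fun_apply)
      qed (simp add: fun_mult_def sum_fun_apply b'_apply \<eta>(3))
    qed
    show "\<forall>\<beta>\<in>OM. fun_mult \<eta> \<beta> = (\<Sum>i<k. fun_mult (fib_app \<beta> (b' i)) (l i))"
    proof (intro ballI ext[of "fun_mult \<eta> _"])
      fix \<beta> q assume \<beta>: "\<beta> \<in> OM"
      have "(\<Sum>i<k. \<beta> q (b' i q) *\<^sub>R l i q) = (\<Sum>i<k. (\<eta> q * \<beta> q (b i q)) *\<^sub>R l i q)"
        unfolding b'_apply by (rule sum.cong) (use T'_scale[OF OM_T'[OF \<beta>] VF_T[OF bf(2)]] in simp_all)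
      also have "\<dots> = \<eta> q *\<^sub>R (\<Sum>i<k. \<beta> q (b i q) *\<^sub>R l i q)"
        by (simp add: scaleR_sum_right)
      also have "\<dots> = \<eta> q *\<^sub>R \<beta> q"
        using ex'[OF _ OM_T'[OF \<beta>], of q] \<eta>(3)[of q] by (cases "q \<in> V") simp_all
      finally show "fun_mult \<eta> \<beta> q = (\<Sum>i<k. fun_mult (fib_app \<beta> (b' i)) (l i)) q"
        by (simp add: fun_mult_def fib_app_def sum_fun_apply)
    qed
  qed
qed

lemma VF_extend:
  assumes "v \<in> T p"
  obtains X where "X \<in> VF" "X p = v"
proof -
  obtain k :: nat and b l \<eta> where "\<eta> \<in> C" "\<eta> p = 1" and b: "\<forall>i<k. b i \<in> VF" and "\<forall>i<k. l i \<in> OM"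
    and ex: "\<forall>v\<in>T p. v = (\<Sum>i<k. l i p v *\<^sub>R b i p)"
    by (rule local_decomposition[of p]) (rule that)
  show thesis
  proof (rule that)
    show "(\<Sum>i<k. fun_mult (\<lambda>_. l i p v) (b i)) \<in> VF"
      using b by (intro VF_sum VF_mult smooth_functions_const) simp
    show "(\<Sum>i<k. fun_mult (\<lambda>_. l i p v) (b i)) p = v"
      using ex[rule_format, OF assms] by (simp add: sum_fun_apply fun_mult_def)
  qed
qed

lemma OM_extend:
  assumes "\<xi> \<in> T' p"
  obtains \<beta> where "\<beta> \<in> OM" "\<beta> p = \<xi>"
proof -
  obtain k :: nat and b l \<eta> where "\<eta> \<in> C" "\<eta> p = 1" and "\<forall>i<k. b i \<in> VF" and l: "\<forall>i<k. l i \<in> OM"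
    and "\<forall>v\<in>T p. v = (\<Sum>i<k. l i p v *\<^sub>R b i p)"
    and ex: "\<forall>\<xi>\<in>T' p. \<xi> = (\<Sum>i<k. \<xi> (b i p) *\<^sub>R l i p)"
    by (rule local_decomposition[of p]) (rule that)
  show thesis
  proof (rule that)
    show "(\<Sum>i<k. fun_mult (\<lambda>_. \<xi> (b i p)) (l i)) \<in> OM"
      using l by (intro OM_sum OM_mult smooth_functions_const) simp
    show "(\<Sum>i<k. fun_mult (\<lambda>_. \<xi> (b i p)) (l i)) p = \<xi>"
      using ex[rule_format, OF assms] by (simp add: sum_fun_apply fun_mult_def)
  qed
qed

lemma OM_eqI:
  assumes "\<alpha> \<in> OM" "\<beta> \<in> OM" "\<And>X. X \<in> VF \<Longrightarrow> fib_app \<alpha> X = fib_app \<beta> X"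
  shows "\<alpha> = \<beta>"
proof
  fix p show "\<alpha> p = \<beta> p"
  proof (rule T'_eqI)
    fix v assume "v \<in> T p"
    then obtain X where "X \<in> VF" "X p = v" by (rule VF_extend)
    then show "\<alpha> p v = \<beta> p v" using fun_cong[OF assms(3), of X p] by (simp add: fib_app_def)
  qed (use assms OM_T' in auto)
qed

text \<open>A derivation is determined by its values on smooth functions, and these are its pairings
  with differentials.\<close>

lemma T_separated:
  assumes "v \<in> T p" "w \<in> T p" "\<And>\<xi>. \<xi> \<in> T' p \<Longrightarrow> \<xi> v = \<xi> w"
  shows "v = w"
  using assms(1,2)
proof (rule T_eqI)
  fix f assume "f \<in> C"
  then show "v f = w f"
    using assms(3)[OF OM_T'[OF diff_form_OM]] diff_form_apply assms(1,2) by metis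
qed

lemma VF_eqI:
  assumes "X \<in> VF" "Y \<in> VF" "\<And>\<beta>. \<beta> \<in> OM \<Longrightarrow> fib_app \<beta> X = fib_app \<beta> Y"
  shows "X = Y"
proof
  fix p show "X p = Y p"
  proof (rule T_separated)
    fix \<xi> assume "\<xi> \<in> T' p"
    then obtain \<beta> where "\<beta> \<in> OM" "\<beta> p = \<xi>" by (rule OM_extend)
    then show "\<xi> (X p) = \<xi> (Y p)" using fun_cong[OF assms(3), of \<beta> p] by (simp add: fib_app_def)
  qed (use assms VF_T in auto)
qed

lemma module_map_sum:
  assumes add: "\<And>s t. s \<in> S \<Longrightarrow> t \<in> S \<Longrightarrow> F (s + t) = (F s + F t :: 'm \<Rightarrow> real)"
    and mult: "\<And>f s. f \<in> C \<Longrightarrow> s \<in> S \<Longrightarrow> F (fun_mult f s) = f * F s"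
    and S: "0 \<in> S" "\<And>s t. s \<in> S \<Longrightarrow> t \<in> S \<Longrightarrow> s + t \<in> S" "\<And>f s. f \<in> C \<Longrightarrow> s \<in> S \<Longrightarrow> fun_mult f s \<in> S"
    and "\<And>i. i \<in> I \<Longrightarrow> c i \<in> C" "\<And>i. i \<in> I \<Longrightarrow> s i \<in> S"
  shows "(\<Sum>i\<in>I. fun_mult (c i) (s i)) \<in> S \<and> F (\<Sum>i\<in>I. fun_mult (c i) (s i)) = (\<Sum>i\<in>I. c i * F (s i))"
proof -
  have "F 0 = 0" using add[OF S(1) S(1)] by simp
  then show ?thesis
    using assms(6,7)
    by (induction I rule: infinite_finite_induct) (simp_all add: S add mult)
qed

text \<open>The tensoriality principle. As \<eta> is 1 at p, \<open>F X p\<close> equals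
  \<open>F (fun_mult \<eta> X) p\<close>, and \<eta> X is a global combination of frame fields; so
  the value at p depends linearly on \<open>X p\<close> alone. Unique existence is stated because it
  resolves the description operators in the definitions.\<close>

lemma form_of_module_map:
  assumes smooth: "\<And>X. X \<in> VF \<Longrightarrow> F X \<in> C"
    and add: "\<And>X Y. X \<in> VF \<Longrightarrow> Y \<in> VF \<Longrightarrow> F (X + Y) = F X + F Y"
    and mult: "\<And>f X. f \<in> C \<Longrightarrow> X \<in> VF \<Longrightarrow> F (fun_mult f X) = f * F X"
  shows "\<exists>!\<gamma>. \<gamma> \<in> OM \<and> (\<forall>X\<in>VF. fib_app \<gamma> X = F X)"
proof -
  have "\<exists>\<xi>. \<xi> \<in> T' p \<and> (\<forall>X\<in>VF. F X p = \<xi> (X p))" for p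
  proof -
    obtain k :: nat and b l \<eta> where \<eta>: "\<eta> \<in> C" "\<eta> p = 1" and b: "\<forall>i<k. b i \<in> VF" and l: "\<forall>i<k. l i \<in> OM"
      and "\<forall>v\<in>T p. v = (\<Sum>i<k. l i p v *\<^sub>R b i p)"
      and "\<forall>\<xi>\<in>T' p. \<xi> = (\<Sum>i<k. \<xi> (b i p) *\<^sub>R l i p)"
      and ex: "\<forall>X\<in>VF. fun_mult \<eta> X = (\<Sum>i<k. fun_mult (fib_app (l i) X) (b i))"
      by (rule local_decomposition[of p]) (rule that)
    have "F X p = (\<Sum>i<k. F (b i) p *\<^sub>R l i p) (X p)" if X: "X \<in> VF" for X
    proof -
      have "F X p = (\<eta> * F X) p" using \<eta>(2) by simp
      also have "\<eta> * F X = F (\<Sum>i<k. fun_mult (fib_app (l i) X) (b i))"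
        using ex[rule_format, OF X] mult[OF \<eta>(1) X] by simp
      also have "\<dots> = (\<Sum>i<k. fib_app (l i) X * F (b i))"
        by (rule conjunct2[OF module_map_sum[where S = VF and F = F]])
          (use b l X in \<open>simp_all add: add mult VF_0 VF_add VF_mult pair_smooth\<close>)
      finally show ?thesis
        by (simp add: sum_fun_apply fib_app_def scaleR_fun_def mult.commute)
    qed
    moreover have "(\<Sum>i<k. F (b i) p *\<^sub>R l i p) \<in> T' p"
      using l OM_T' by (intro subspace_sum[OF subspace_T'] subspace_scale[OF subspace_T']) simp
    ultimately show ?thesis by blast
  qed
  then obtain \<gamma> where \<gamma>: "\<And>p. \<gamma> p \<in> T' p" "\<And>p X. X \<in> VF \<Longrightarrow> F X p = \<gamma> p (X p)" by metis
  then have "\<And>X. X \<in> VF \<Longrightarrow> fib_app \<gamma> X = F X" by (auto simp: fib_app_def)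
  then have "\<gamma> \<in> OM \<and> (\<forall>X\<in>VF. fib_app \<gamma> X = F X)"
    using \<gamma>(1) smooth by (simp add: OM_iff)
  then show ?thesis by (intro ex1I[of _ \<gamma>]) (auto intro: OM_eqI)
qed

section \<open>Calculus of derivations and pairings\<close>

definition der :: "('m \<Rightarrow> 'm tvec) \<Rightarrow> ('m \<Rightarrow> real) \<Rightarrow> 'm \<Rightarrow> real"
  where "der X f = (\<lambda>p. X p f)"

lemma C_closed:
  "0 \<in> C" "f \<in> C \<Longrightarrow> g \<in> C \<Longrightarrow> f + g \<in> C" "f \<in> C \<Longrightarrow> g \<in> C \<Longrightarrow> f - g \<in> C"
  "f \<in> C \<Longrightarrow> g \<in> C \<Longrightarrow> f * g \<in> C" "f \<in> C \<Longrightarrow> - f \<in> C"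
proof -
  show "0 \<in> C" using smooth_functions_const[of 0] by (simp add: zero_fun_def)
  show add: "f + g \<in> C" if "f \<in> C" "g \<in> C" for f g
    using smooth_functions_add[OF that] by (simp add: plus_fun_def)
  show mult: "f * g \<in> C" if "f \<in> C" "g \<in> C" for f g
    using smooth_functions_mult[OF that] by (simp add: times_fun_def)
  show diff: "f - g \<in> C" if "f \<in> C" "g \<in> C" for f g
    using smooth_functions_diff[OF that] by (simp add: fun_diff_def)
  show "- f \<in> C" if "f \<in> C" for f
    using diff[OF \<open>0 \<in> C\<close> that] by simp
qed

lemma der_smooth: "X \<in> VF \<Longrightarrow> f \<in> C \<Longrightarrow> der X f \<in> C"
  using VF_smooth by (simp add: der_def)

lemma VF_uminus: "X \<in> VF \<Longrightarrow> - X \<in> VF"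
  using VF_diff[OF VF_0, of X] by simp

lemma OM_uminus: "\<beta> \<in> OM \<Longrightarrow> - \<beta> \<in> OM"
  using OM_diff[OF OM_0, of \<beta>] by simp

lemma fun_mult_const: "fun_mult (\<lambda>_. r) s = r *\<^sub>R s"
  by (simp add: fun_mult_def scaleR_fun_def)

lemma VF_scaleR: "X \<in> VF \<Longrightarrow> r *\<^sub>R X \<in> VF"
  using VF_mult[OF smooth_functions_const[of r]] by (simp add: fun_mult_const)

lemma OM_scaleR: "\<beta> \<in> OM \<Longrightarrow> r *\<^sub>R \<beta> \<in> OM"
  using OM_mult[OF smooth_functions_const[of r]] by (simp add: fun_mult_const)

lemma C_scaleR: "f \<in> C \<Longrightarrow> r *\<^sub>R f \<in> C"
  using smooth_functions_mult[OF smooth_functions_const[of r]] by (simp add: scaleR_fun_def)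

lemmas closed = C_closed der_smooth C_scaleR pair_smooth VF_0 VF_add VF_diff VF_uminus VF_mult VF_scaleR
  OM_0 OM_add OM_diff OM_uminus OM_mult OM_scaleR

lemma der_add: "X \<in> VF \<Longrightarrow> f \<in> C \<Longrightarrow> g \<in> C \<Longrightarrow> der X (f + g) = der X f + der X g"
  and der_diff: "X \<in> VF \<Longrightarrow> f \<in> C \<Longrightarrow> g \<in> C \<Longrightarrow> der X (f - g) = der X f - der X g"
  and der_mult: "X \<in> VF \<Longrightarrow> f \<in> C \<Longrightarrow> g \<in> C \<Longrightarrow> der X (f * g) = der X f * g + f * der X g"
  and der_scaleR: "X \<in> VF \<Longrightarrow> f \<in> C \<Longrightarrow> der X (r *\<^sub>R f) = r *\<^sub>R der X f"
  using T_add[OF VF_T] T_diff[OF VF_T] T_mult[OF VF_T] T_scale[OF VF_T]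
  by (simp_all add: der_def fun_eq_iff plus_fun_def times_fun_def fun_diff_def scaleR_fun_def)

lemma der_vector:
  "der (X + Y) f = der X f + der Y f" "der (X - Y) f = der X f - der Y f" "der 0 f = 0"
  "der (- X) f = - der X f" "der (fun_mult g X) f = g * der X f" "der (r *\<^sub>R X) f = r *\<^sub>R der X f"
  by (simp_all add: der_def fun_eq_iff fun_mult_def scaleR_fun_def)

lemma der_bracket: "der (vf_bracket X Y) f = der X (der Y f) - der Y (der X f)"
  by (simp add: der_def vf_bracket_def fun_eq_iff)

lemma pair_form:
  "fib_app (\<alpha> + \<beta>) X = fib_app \<alpha> X + fib_app \<beta> X" "fib_app (\<alpha> - \<beta>) X = fib_app \<alpha> X - fib_app \<beta> X"
  "fib_app 0 X = 0" "fib_app (- \<beta>) X = - fib_app \<beta> X"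
  "fib_app (fun_mult f \<beta>) X = f * fib_app \<beta> X" "fib_app (r *\<^sub>R \<beta>) X = r *\<^sub>R fib_app \<beta> X"
  for \<alpha> \<beta> :: "'m \<Rightarrow> 'm tvec \<Rightarrow> real"
  by (simp_all add: fib_app_def fun_eq_iff fun_mult_def scaleR_fun_def)

lemma pair_vector:
  assumes "\<beta> \<in> OM" "X \<in> VF"
  shows "Y \<in> VF \<Longrightarrow> fib_app \<beta> (X + Y) = fib_app \<beta> X + fib_app \<beta> Y"
    "Y \<in> VF \<Longrightarrow> fib_app \<beta> (X - Y) = fib_app \<beta> X - fib_app \<beta> Y"
    "fib_app \<beta> (- X) = - fib_app \<beta> X"
    "fib_app \<beta> (fun_mult f X) = f * fib_app \<beta> X" "fib_app \<beta> (r *\<^sub>R X) = r *\<^sub>R fib_app \<beta> X"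
proof -
  note \<beta> = OM_T'[OF assms(1)] and X = VF_T[OF assms(2)]
  show "Y \<in> VF \<Longrightarrow> fib_app \<beta> (X + Y) = fib_app \<beta> X + fib_app \<beta> Y"
    "Y \<in> VF \<Longrightarrow> fib_app \<beta> (X - Y) = fib_app \<beta> X - fib_app \<beta> Y"
    "fib_app \<beta> (fun_mult f X) = f * fib_app \<beta> X" "fib_app \<beta> (r *\<^sub>R X) = r *\<^sub>R fib_app \<beta> X"
    using T'_add[OF \<beta> X] T'_diff[OF \<beta> X] T'_scale[OF \<beta> X] VF_T[of Y]
    by (simp_all add: fib_app_def fun_eq_iff fun_mult_def scaleR_fun_def)
  show "fib_app \<beta> (- X) = - fib_app \<beta> X"
    using T'_scale[OF \<beta> X, of _ "-1"] by (simp add: fib_app_def fun_eq_iff)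
qed

lemma pair_vector_0: "\<beta> \<in> OM \<Longrightarrow> fib_app \<beta> 0 = 0"
  using pair_vector(1)[of \<beta> 0 0] VF_0 by simp

lemma der_eqI: "X \<in> VF \<Longrightarrow> Y \<in> VF \<Longrightarrow> (\<And>f. f \<in> C \<Longrightarrow> der X f = der Y f) \<Longrightarrow> X = Y"
  by (rule ext, rule T_eqI[OF VF_T VF_T]) (simp_all add: der_def fun_eq_iff)

end

section \<open>Affine manifolds\<close>

locale affine_structure =
  fixes A :: "('m::{t2_space,second_countable_topology}, 'e::euclidean_space) atlas"
    and conn :: "('m \<Rightarrow> 'm tvec) \<Rightarrow> ('m \<Rightarrow> 'm tvec) \<Rightarrow> 'm \<Rightarrow> 'm tvec"
  assumes affine: "affine_manifold A conn"

sublocale affine_structure \<subseteq> tangent_vector_bundle A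
proof
  show "smooth_manifold A" "vector_bundle A (tangent_bundle A)"
    using affine
    by (simp_all add: affine_manifold_def right_anchored_product_def anchored_bundle_def)
qed

context affine_structure
begin

lemma act_id_anchor: "act id_anchor = der"
  by (simp add: act_def id_anchor_def der_def fun_eq_iff)

lemma conn_bilinear: "bilinear_map_on VF VF conn"
  using affine by (simp add: affine_manifold_def right_anchored_product_def)

lemma conn_closed: "X \<in> VF \<Longrightarrow> Y \<in> VF \<Longrightarrow> conn X Y \<in> VF"
  using conn_bilinear by (simp add: bilinear_map_on_def linear_map_on_def)

lemma conn_additive:
  assumes "X \<in> VF" "Y \<in> VF"
  shows "Z \<in> VF \<Longrightarrow> conn (X + Y) Z = conn X Z + conn Y Z" "Z \<in> VF \<Longrightarrow> conn Z (X + Y) = conn Z X + conn Z Y"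
    "conn (r *\<^sub>R X) Y = r *\<^sub>R conn X Y" "conn X (r *\<^sub>R Y) = r *\<^sub>R conn X Y"
  using conn_bilinear assms unfolding bilinear_map_on_def linear_map_on_def by simp_all

lemma conn_0: "Z \<in> VF \<Longrightarrow> conn 0 Z = 0" "Z \<in> VF \<Longrightarrow> conn Z 0 = 0"
  using conn_additive(3)[of Z Z 0] conn_additive(4)[of Z Z 0] conn_additive(3)[of 0 Z 0]
    conn_additive(4)[of Z 0 0] VF_0 by simp_all

lemma conn_subtractive:
  assumes "X \<in> VF" "Y \<in> VF"
  shows "Z \<in> VF \<Longrightarrow> conn (X - Y) Z = conn X Z - conn Y Z" "Z \<in> VF \<Longrightarrow> conn Z (X - Y) = conn Z X - conn Z Y"
    "conn (- X) Y = - conn X Y" "conn X (- Y) = - conn X Y"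
proof -
  have 1: "conn (- X) Y = - conn X Y" "conn X (- Y) = - conn X Y" if "X \<in> VF" "Y \<in> VF" for X Y
    using conn_additive(3)[OF that, of "-1"] conn_additive(4)[OF that, of "-1"] by simp_all
  show "conn (- X) Y = - conn X Y" "conn X (- Y) = - conn X Y"
    by (rule 1[OF assms])+
  show "Z \<in> VF \<Longrightarrow> conn (X - Y) Z = conn X Z - conn Y Z" "Z \<in> VF \<Longrightarrow> conn Z (X - Y) = conn Z X - conn Z Y"
    using conn_additive(1)[OF assms(1) VF_uminus[OF assms(2)], of Z]
      conn_additive(2)[OF assms(1) VF_uminus[OF assms(2)], of Z] 1[of Y Z] 1[of Z Y] assms by simp_all
qed

lemma conn_mult:
  "f \<in> C \<Longrightarrow> X \<in> VF \<Longrightarrow> Y \<in> VF \<Longrightarrow> conn (fun_mult f X) Y = fun_mult f (conn X Y)"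
  "f \<in> C \<Longrightarrow> X \<in> VF \<Longrightarrow> Y \<in> VF \<Longrightarrow> conn X (fun_mult f Y) = fun_mult f (conn X Y) + fun_mult (der X f) Y"
  using affine by (simp_all add: affine_manifold_def right_anchored_product_def act_id_anchor)

lemma torsion_free: "X \<in> VF \<Longrightarrow> Y \<in> VF \<Longrightarrow> vf_bracket X Y = conn X Y - conn Y X"
  using affine by (simp add: affine_manifold_def)

text \<open>Torsion-freeness writes the bracket as a difference of sections, so no check that the
  commutator is a derivation is made.\<close>

lemma bracket_closed: "X \<in> VF \<Longrightarrow> Y \<in> VF \<Longrightarrow> vf_bracket X Y \<in> VF"
  by (simp add: torsion_free VF_diff conn_closed)

lemma flat:
  "X \<in> VF \<Longrightarrow> Y \<in> VF \<Longrightarrow> Z \<in> VF \<Longrightarrow> conn (vf_bracket X Y) Z = conn X (conn Y Z) - conn Y (conn X Z)"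
  using affine by (simp add: affine_manifold_def)

lemma flat':
  "X \<in> VF \<Longrightarrow> Y \<in> VF \<Longrightarrow> Z \<in> VF \<Longrightarrow>
    conn (conn X Y) Z - conn (conn Y X) Z = conn X (conn Y Z) - conn Y (conn X Z)"
  using flat[of X Y Z] by (simp add: torsion_free conn_subtractive conn_closed)

lemma der_torsion:
  "X \<in> VF \<Longrightarrow> Y \<in> VF \<Longrightarrow> der (conn X Y) f - der (conn Y X) f = der X (der Y f) - der Y (der X f)"
  using der_bracket[of X Y f] by (simp add: torsion_free der_vector)

lemmas conn_simps = conn_additive conn_0 conn_subtractive conn_mult

text \<open>The first Bianchi identity read backwards: torsion-freeness expands the outer brackets,
  flatness replaces the derivatives along the inner ones, and all terms cancel.\<close>

lemma jacobi:
  assumes "X \<in> VF" "Y \<in> VF" "Z \<in> VF"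
  shows "vf_bracket X (vf_bracket Y Z) + vf_bracket Y (vf_bracket Z X) + vf_bracket Z (vf_bracket X Y) = 0"
  using flat[OF assms] flat[OF assms(2,3,1)] flat[OF assms(3,1,2)] assms
  by (simp add: torsion_free[of _ "vf_bracket _ _"] bracket_closed)
     (simp add: torsion_free conn_subtractive conn_closed algebra_simps)

section \<open>The dual connection\<close>

abbreviation "N \<equiv> dual_connection A conn"

text \<open>Replacing Y by fY produces the term X(f) <\<beta>, Y> in both summands. It cancels, so
  the expression is linear over functions in Y.\<close>

lemma dual_connection_characterization:
  assumes "X \<in> VF" "\<beta> \<in> OM"
  shows "N X \<beta> \<in> OM \<and> (\<forall>Y\<in>VF. fib_app (N X \<beta>) Y = der X (fib_app \<beta> Y) - fib_app \<beta> (conn X Y))"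
proof -
  have "\<exists>!\<gamma>. \<gamma> \<in> OM \<and> (\<forall>Y\<in>VF. fib_app \<gamma> Y = der X (fib_app \<beta> Y) - fib_app \<beta> (conn X Y))"
    by (rule form_of_module_map)
      (use assms in \<open>simp_all add: closed conn_closed conn_simps der_add der_mult pair_vector algebra_simps\<close>)
  from theI'[OF this] show ?thesis unfolding dual_product_def act_id_anchor .
qed

lemma N_closed: "X \<in> VF \<Longrightarrow> \<beta> \<in> OM \<Longrightarrow> N X \<beta> \<in> OM"
  using dual_connection_characterization by blast

lemma pair_N:
  "X \<in> VF \<Longrightarrow> \<beta> \<in> OM \<Longrightarrow> Y \<in> VF \<Longrightarrow> fib_app (N X \<beta>) Y = der X (fib_app \<beta> Y) - fib_app \<beta> (conn X Y)"
  using dual_connection_characterization by blast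

lemmas vf_closed = closed conn_closed N_closed
lemmas expand = der_add der_diff der_mult der_scaleR der_vector pair_form pair_vector pair_vector_0 pair_N

lemma der_0: "X \<in> VF \<Longrightarrow> der X 0 = 0"
  using der_add[of X 0 0] C_closed(1) by simp

lemma der_uminus: "X \<in> VF \<Longrightarrow> f \<in> C \<Longrightarrow> der X (- f) = - der X f"
  using der_diff[of X 0 f] C_closed(1) by (simp add: der_0)

lemma N_simps:
  assumes "X \<in> VF" "\<beta> \<in> OM"
  shows "Y \<in> VF \<Longrightarrow> N (X + Y) \<beta> = N X \<beta> + N Y \<beta>" "Y \<in> VF \<Longrightarrow> N (X - Y) \<beta> = N X \<beta> - N Y \<beta>"
    "\<alpha> \<in> OM \<Longrightarrow> N X (\<alpha> + \<beta>) = N X \<alpha> + N X \<beta>" "\<alpha> \<in> OM \<Longrightarrow> N X (\<alpha> - \<beta>) = N X \<alpha> - N X \<beta>"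
    "N (- X) \<beta> = - N X \<beta>" "N X (- \<beta>) = - N X \<beta>"
    "N (r *\<^sub>R X) \<beta> = r *\<^sub>R N X \<beta>" "N X (r *\<^sub>R \<beta>) = r *\<^sub>R N X \<beta>"
    "f \<in> C \<Longrightarrow> N (fun_mult f X) \<beta> = fun_mult f (N X \<beta>)"
    "f \<in> C \<Longrightarrow> N X (fun_mult f \<beta>) = fun_mult f (N X \<beta>) + fun_mult (der X f) \<beta>"
    "N 0 \<beta> = 0" "N X 0 = 0"
  using assms
  by (auto intro!: OM_eqI simp: vf_closed expand conn_simps der_0 der_uminus algebra_simps)

text \<open>Paired with Z, the claim becomes \<open>flat'\<close> under \<beta> together with
  \<open>der_torsion\<close> for the function <\<beta>, Z>.\<close>

lemma N_flat:
  assumes "X \<in> VF" "Y \<in> VF" "\<beta> \<in> OM"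
  shows "N (conn X Y) \<beta> - N (conn Y X) \<beta> = N X (N Y \<beta>) - N Y (N X \<beta>)"
proof (rule OM_eqI)
  fix Z assume Z: "Z \<in> VF"
  have "fib_app \<beta> (conn (conn X Y) Z - conn (conn Y X) Z) = fib_app \<beta> (conn X (conn Y Z) - conn Y (conn X Z))"
    using flat'[OF assms(1,2) Z] by simp
  then show "fib_app (N (conn X Y) \<beta> - N (conn Y X) \<beta>) Z = fib_app (N X (N Y \<beta>) - N Y (N X \<beta>)) Z"
    using der_torsion[OF assms(1,2), of "fib_app \<beta> Z"] assms Z
    by (simp add: vf_closed expand algebra_simps)
qed (use assms in \<open>simp_all add: vf_closed\<close>)

end

section \<open>Symmetric bivector fields\<close>

locale affine_bivector = affine_structure A conn
  for A :: "('m::{t2_space,second_countable_topology}, 'e::euclidean_space) atlas"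
    and conn :: "('m \<Rightarrow> 'm tvec) \<Rightarrow> ('m \<Rightarrow> 'm tvec) \<Rightarrow> 'm \<Rightarrow> 'm tvec" +
  fixes h :: "'m \<Rightarrow> ('m tvec \<Rightarrow> real) \<Rightarrow> ('m tvec \<Rightarrow> real) \<Rightarrow> real"
  assumes bivector: "symmetric_bivector_field A h"
begin

section \<open>The anchor given by h\<close>

lemma h_bilinear: "bilinear_map_on (T' p) UNIV (h p)"
  and h_smooth: "\<alpha> \<in> OM \<Longrightarrow> \<beta> \<in> OM \<Longrightarrow> (\<lambda>p. h p (\<alpha> p) (\<beta> p)) \<in> C"
  and h_sym: "\<xi> \<in> T' p \<Longrightarrow> \<eta> \<in> T' p \<Longrightarrow> h p \<xi> \<eta> = h p \<eta> \<xi>"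
  using bivector by (simp_all add: symmetric_bivector_field_def fiber_form_def symmetric_form_def)

lemma h_linear:
  "\<xi> \<in> T' p \<Longrightarrow> linear_map_on (T' p) UNIV (h p \<xi>)" "\<xi> \<in> T' p \<Longrightarrow> linear_map_on (T' p) UNIV (\<lambda>\<eta>. h p \<eta> \<xi>)"
  using h_bilinear by (simp_all add: bilinear_map_on_def)

text \<open>The fibres have finite dimension, so a linear form on \<open>T' p\<close> is evaluation
  at a tangent vector. The coordinates of that vector in the frame \<open>b\<close> are the values
  of the form on the dual frame \<open>l\<close>.\<close>

lemma sharp_characterization:
  assumes "\<xi> \<in> T' p"
  shows "sharp A h p \<xi> \<in> T p \<and> (\<forall>\<eta>\<in>T' p. \<eta> (sharp A h p \<xi>) = h p \<xi> \<eta>)"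
proof -
  obtain k :: nat and b l \<eta> where "\<eta> \<in> C" "\<eta> p = 1" and b: "\<forall>i<k. b i \<in> VF" and l: "\<forall>i<k. l i \<in> OM"
    and "\<forall>v\<in>T p. v = (\<Sum>i<k. l i p v *\<^sub>R b i p)"
    and ex: "\<forall>\<xi>\<in>T' p. \<xi> = (\<Sum>i<k. \<xi> (b i p) *\<^sub>R l i p)"
    by (rule local_decomposition[of p]) (rule that)
  define v where "v = (\<Sum>i<k. h p \<xi> (l i p) *\<^sub>R b i p)"
  have v: "v \<in> T p"
    unfolding v_def using b VF_T by (intro subspace_sum[OF subspace_T] subspace_scale[OF subspace_T]) simp
  have eval: "\<eta> v = h p \<xi> \<eta>" if \<eta>: "\<eta> \<in> T' p" for \<eta>
  proof -
    have "\<eta> v = (\<Sum>i<k. h p \<xi> (l i p) * \<eta> (b i p))"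
      unfolding v_def using b VF_T by (intro T'_lincomb[OF \<eta>]) simp
    also have "\<dots> = (\<Sum>i<k. \<eta> (b i p) *\<^sub>R h p \<xi> (l i p))" by (simp add: mult.commute)
    also have "\<dots> = h p \<xi> (\<Sum>i<k. \<eta> (b i p) *\<^sub>R l i p)"
      using l OM_T' by (intro linear_map_on_lincomb[OF h_linear(1)[OF assms] subspace_T', symmetric]) simp
    also have "\<dots> = h p \<xi> \<eta>" by (rule arg_cong[OF ex[rule_format, OF \<eta>], symmetric])
    finally show ?thesis .
  qed
  have "\<exists>!v. v \<in> T p \<and> (\<forall>\<eta>\<in>T' p. \<eta> v = h p \<xi> \<eta>)"
  proof (rule ex1I[of _ v])
    show "w = v" if "w \<in> T p \<and> (\<forall>\<eta>\<in>T' p. \<eta> w = h p \<xi> \<eta>)" for w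
      by (rule T_separated[of _ p]) (use that v eval in simp_all)
  qed (use v eval in simp)
  from theI'[OF this] show ?thesis unfolding sharp_def .
qed

lemma sharp_T: "\<xi> \<in> T' p \<Longrightarrow> sharp A h p \<xi> \<in> T p"
  and sharp_eval: "\<xi> \<in> T' p \<Longrightarrow> \<eta> \<in> T' p \<Longrightarrow> \<eta> (sharp A h p \<xi>) = h p \<xi> \<eta>"
  using sharp_characterization by blast+

lemma sharp_linear: "linear_map_on (T' p) (T p) (sharp A h p)"
proof (rule linear_map_onI)
  note [simp] = subspace_add[OF subspace_T] subspace_scale[OF subspace_T]
    subspace_add[OF subspace_T'] subspace_scale[OF subspace_T'] sharp_T sharp_eval T'_add T'_scale
    linear_map_onD(2)[OF h_linear(2)] linear_map_onD(3)[OF h_linear(2)]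
  show "sharp A h p (\<xi> + \<eta>) = sharp A h p \<xi> + sharp A h p \<eta>" if "\<xi> \<in> T' p" "\<eta> \<in> T' p" for \<xi> \<eta>
    by (rule T_separated[of _ p]) (use that in simp_all)
  show "sharp A h p (r *\<^sub>R \<xi>) = r *\<^sub>R sharp A h p \<xi>" if "\<xi> \<in> T' p" for r \<xi>
    by (rule T_separated[of _ p]) (use that in simp_all)
qed (rule sharp_T)

abbreviation "S \<equiv> fib_app (sharp A h)"

text \<open>Applied to f, the vector field \<open>S \<alpha>\<close> is h(\<alpha>, df), which is
  smooth because h and df are.\<close>

lemma S_closed: "\<alpha> \<in> OM \<Longrightarrow> S \<alpha> \<in> VF"
proof -
  assume \<alpha>: "\<alpha> \<in> OM"
  have "(\<lambda>p. S \<alpha> p f) = (\<lambda>p. h p (\<alpha> p) (diff_form f p))" if "f \<in> C" for f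
    using sharp_eval[OF OM_T'[OF \<alpha>] OM_T'[OF diff_form_OM[OF that]]] diff_form_apply[OF sharp_T[OF OM_T'[OF \<alpha>]]]
    by (simp add: fib_app_def fun_eq_iff)
  then show ?thesis
    using sharp_T[OF OM_T'[OF \<alpha>]] h_smooth[OF \<alpha> diff_form_OM] by (simp add: VF_iff fib_app_def)
qed

lemma pair_S: "\<alpha> \<in> OM \<Longrightarrow> \<beta> \<in> OM \<Longrightarrow> fib_app \<beta> (S \<alpha>) = (\<lambda>p. h p (\<alpha> p) (\<beta> p))"
  using sharp_eval[OF OM_T' OM_T'] by (simp add: fib_app_def fun_eq_iff)

lemma pair_S_sym: "\<alpha> \<in> OM \<Longrightarrow> \<beta> \<in> OM \<Longrightarrow> fib_app \<beta> (S \<alpha>) = fib_app \<alpha> (S \<beta>)"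
  using pair_S pair_S[of \<beta> \<alpha>] h_sym[OF OM_T' OM_T'] by (simp add: fun_eq_iff)

lemma S_simps:
  assumes "\<alpha> \<in> OM"
  shows "\<beta> \<in> OM \<Longrightarrow> S (\<alpha> + \<beta>) = S \<alpha> + S \<beta>" "\<beta> \<in> OM \<Longrightarrow> S (\<alpha> - \<beta>) = S \<alpha> - S \<beta>"
    "S (- \<alpha>) = - S \<alpha>" "S (r *\<^sub>R \<alpha>) = r *\<^sub>R S \<alpha>" "S (fun_mult f \<alpha>) = fun_mult f (S \<alpha>)"
proof -
  note \<alpha> = OM_T'[OF assms]
  note add = linear_map_onD(2)[OF sharp_linear \<alpha>] and diff = linear_map_on_diff[OF sharp_linear subspace_T' \<alpha>]
    and scale = linear_map_onD(3)[OF sharp_linear \<alpha>]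
  show "S (\<alpha> + \<beta>) = S \<alpha> + S \<beta>" "S (\<alpha> - \<beta>) = S \<alpha> - S \<beta>" if "\<beta> \<in> OM"
    using add[OF OM_T'[OF that]] diff[OF OM_T'[OF that]] by (simp_all add: fib_app_def fun_eq_iff)
  show "S (- \<alpha>) = - S \<alpha>"
    using scale[where r = "-1"] by (intro ext[of "S _"]) (simp add: fib_app_def)
  show "S (r *\<^sub>R \<alpha>) = r *\<^sub>R S \<alpha>"
    by (rule ext) (simp add: fib_app_def scaleR_fun_def[of _ \<alpha>] scaleR_fun_def[of _ "\<lambda>p. sharp A h p (\<alpha> p)"] scale)
  show "S (fun_mult f \<alpha>) = fun_mult f (S \<alpha>)"
    by (rule ext) (simp add: fib_app_def fun_mult_def scale)
qed

lemma S_0: "S 0 = 0"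
  using S_simps(4)[OF OM_0, of 0] by simp

lemma anchored_cotangent: "anchored_bundle A (cotangent_bundle A) (sharp A h)"
  unfolding anchored_bundle_def bundle_map_def
  using vector_bundle_cotangent sharp_linear S_closed by simp

lemma act_sharp: "act (sharp A h) \<alpha> f = der (S \<alpha>) f"
  by (simp add: act_def der_def fib_app_def)

text \<open>\<open>W X\<close> is \<open>\<nabla>\<^sub>X h\<^sub>#\<close>.\<close>

definition W :: "('m \<Rightarrow> 'm tvec) \<Rightarrow> ('m \<Rightarrow> 'm tvec \<Rightarrow> real) \<Rightarrow> 'm \<Rightarrow> 'm tvec"
  where "W X \<alpha> = conn X (S \<alpha>) - S (N X \<alpha>)"

lemma W_closed: "X \<in> VF \<Longrightarrow> \<alpha> \<in> OM \<Longrightarrow> W X \<alpha> \<in> VF"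
  by (simp add: W_def vf_closed S_closed)

lemmas bv_closed = vf_closed S_closed W_closed

lemma bivector_derivative_eq:
  assumes "X \<in> VF" "\<alpha> \<in> OM" "\<beta> \<in> OM"
  shows "bivector_derivative A conn h X \<alpha> \<beta> = fib_app \<beta> (W X \<alpha>)"
proof -
  have "bivector_derivative A conn h X \<alpha> \<beta> =
      der X (fib_app \<beta> (S \<alpha>)) - fib_app \<beta> (S (N X \<alpha>)) - fib_app (N X \<beta>) (S \<alpha>)"
    using assms by (simp add: bivector_derivative_def pair_S bv_closed der_def fun_eq_iff)
  then show ?thesis
    using assms by (simp add: W_def bv_closed expand)
qed

lemma W_sym:
  assumes "X \<in> VF" "\<alpha> \<in> OM" "\<beta> \<in> OM"
  shows "fib_app \<beta> (W X \<alpha>) = fib_app \<alpha> (W X \<beta>)"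
  using pair_S_sym[OF assms(2,3)] pair_S_sym[OF N_closed[OF assms(1,2)] assms(3)]
    pair_S_sym[OF assms(2) N_closed[OF assms(1,3)]] assms
  by (simp add: W_def bv_closed expand algebra_simps)

lemma W_simps:
  assumes "X \<in> VF" "\<alpha> \<in> OM"
  shows "Y \<in> VF \<Longrightarrow> W (X + Y) \<alpha> = W X \<alpha> + W Y \<alpha>" "\<beta> \<in> OM \<Longrightarrow> W X (\<alpha> + \<beta>) = W X \<alpha> + W X \<beta>"
    "f \<in> C \<Longrightarrow> W (fun_mult f X) \<alpha> = fun_mult f (W X \<alpha>)" "f \<in> C \<Longrightarrow> W X (fun_mult f \<alpha>) = fun_mult f (W X \<alpha>)"
    "W (r *\<^sub>R X) \<alpha> = r *\<^sub>R W X \<alpha>" "W X (r *\<^sub>R \<alpha>) = r *\<^sub>R W X \<alpha>"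
  using assms
  by (auto intro!: VF_eqI simp: W_def bv_closed expand conn_simps N_simps S_simps algebra_simps)

section \<open>The product \<D> and its dual operator\<close>

abbreviation "D \<equiv> bivector_product A conn h"

lemma bivector_product_characterization:
  assumes "\<alpha> \<in> OM" "\<beta> \<in> OM"
  shows "D \<alpha> \<beta> \<in> OM \<and> (\<forall>X\<in>VF. fib_app (D \<alpha> \<beta>) X =
    bivector_derivative A conn h X \<alpha> \<beta> + fib_app (N (S \<alpha>) \<beta>) X)"
proof -
  have "\<exists>!\<gamma>. \<gamma> \<in> OM \<and> (\<forall>X\<in>VF. fib_app \<gamma> X =
    bivector_derivative A conn h X \<alpha> \<beta> + fib_app (N (S \<alpha>) \<beta>) X)"
    by (rule form_of_module_map)
      (use assms in \<open>simp_all add: bivector_derivative_eq bv_closed W_simps pair_vector algebra_simps\<close>)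
  from theI'[OF this] show ?thesis unfolding bivector_product_def .
qed

lemma D_closed: "\<alpha> \<in> OM \<Longrightarrow> \<beta> \<in> OM \<Longrightarrow> D \<alpha> \<beta> \<in> OM"
  using bivector_product_characterization by blast

lemma pair_D:
  "\<alpha> \<in> OM \<Longrightarrow> \<beta> \<in> OM \<Longrightarrow> X \<in> VF \<Longrightarrow> fib_app (D \<alpha> \<beta>) X = fib_app \<beta> (W X \<alpha>) + fib_app (N (S \<alpha>) \<beta>) X"
  using bivector_product_characterization bivector_derivative_eq by simp

text \<open>\<open>Q \<alpha>\<close> is the operator on vector fields dual to \<open>\<D>\<^sub>\<alpha>\<close>.\<close>

definition Q :: "('m \<Rightarrow> 'm tvec \<Rightarrow> real) \<Rightarrow> ('m \<Rightarrow> 'm tvec) \<Rightarrow> 'm \<Rightarrow> 'm tvec"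
  where "Q \<alpha> X = vf_bracket (S \<alpha>) X + S (N X \<alpha>)"

lemma Q_eq: "\<alpha> \<in> OM \<Longrightarrow> X \<in> VF \<Longrightarrow> Q \<alpha> X = conn (S \<alpha>) X - conn X (S \<alpha>) + S (N X \<alpha>)"
  by (simp add: Q_def torsion_free S_closed)

lemma Q_closed: "\<alpha> \<in> OM \<Longrightarrow> X \<in> VF \<Longrightarrow> Q \<alpha> X \<in> VF"
  by (simp add: Q_eq bv_closed)

text \<open>The covariant derivatives of h inside \<open>W\<close> recombine with \<nabla> along
  \<open>S \<alpha>\<close> into \<open>Q\<close>. Identities for \<D> are henceforth reduced
  through this formula to identities for \<open>Q\<close>.\<close>

lemma pair_D_dual:
  assumes "\<alpha> \<in> OM" "\<beta> \<in> OM" "X \<in> VF"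
  shows "fib_app (D \<alpha> \<beta>) X = der (S \<alpha>) (fib_app \<beta> X) - fib_app \<beta> (Q \<alpha> X)"
  using assms by (simp add: pair_D Q_eq W_def bv_closed expand algebra_simps)

lemma predual_eq:
  assumes "\<alpha> \<in> OM" "X \<in> VF"
  shows "predual_product A (tangent_bundle A) (sharp A h) D \<alpha> X = Q \<alpha> X"
  unfolding predual_product_def
proof (rule the_equality)
  show "Q \<alpha> X \<in> VF \<and> (\<forall>\<beta>\<in>OM. fib_app \<beta> (Q \<alpha> X) = act (sharp A h) \<alpha> (fib_app \<beta> X) - fib_app (D \<alpha> \<beta>) X)"
    using assms by (simp add: Q_closed pair_D_dual act_sharp)
  then show "Z = Q \<alpha> X"
    if "Z \<in> VF \<and> (\<forall>\<beta>\<in>OM. fib_app \<beta> Z = act (sharp A h) \<alpha> (fib_app \<beta> X) - fib_app (D \<alpha> \<beta>) X)" for Z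
    using that by (auto intro: VF_eqI)
qed

lemmas all_closed = bv_closed D_closed Q_closed

lemma Q_simps:
  assumes "\<alpha> \<in> OM" "X \<in> VF"
  shows "\<beta> \<in> OM \<Longrightarrow> Q (\<alpha> + \<beta>) X = Q \<alpha> X + Q \<beta> X" "\<beta> \<in> OM \<Longrightarrow> Q (\<alpha> - \<beta>) X = Q \<alpha> X - Q \<beta> X"
    "Y \<in> VF \<Longrightarrow> Q \<alpha> (X + Y) = Q \<alpha> X + Q \<alpha> Y" "Y \<in> VF \<Longrightarrow> Q \<alpha> (X - Y) = Q \<alpha> X - Q \<alpha> Y"
    "Q (- \<alpha>) X = - Q \<alpha> X" "Q \<alpha> (- X) = - Q \<alpha> X"
    "Q (r *\<^sub>R \<alpha>) X = r *\<^sub>R Q \<alpha> X" "Q \<alpha> (r *\<^sub>R X) = r *\<^sub>R Q \<alpha> X"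
    "f \<in> C \<Longrightarrow> Q (fun_mult f \<alpha>) X = fun_mult f (Q \<alpha> X)"
    "f \<in> C \<Longrightarrow> Q \<alpha> (fun_mult f X) = fun_mult f (Q \<alpha> X) + fun_mult (der (S \<alpha>) f) X"
    "Q 0 X = 0" "Q \<alpha> 0 = 0"
  using assms
  by (auto intro!: VF_eqI simp: Q_eq bv_closed expand conn_simps N_simps S_simps S_0 algebra_simps)

lemma D_simps:
  assumes "\<alpha> \<in> OM" "\<gamma> \<in> OM"
  shows "\<beta> \<in> OM \<Longrightarrow> D (\<alpha> + \<beta>) \<gamma> = D \<alpha> \<gamma> + D \<beta> \<gamma>" "\<beta> \<in> OM \<Longrightarrow> D \<alpha> (\<gamma> + \<beta>) = D \<alpha> \<gamma> + D \<alpha> \<beta>"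
    "D (- \<alpha>) \<gamma> = - D \<alpha> \<gamma>" "D \<alpha> (- \<gamma>) = - D \<alpha> \<gamma>"
    "D (r *\<^sub>R \<alpha>) \<gamma> = r *\<^sub>R D \<alpha> \<gamma>" "D \<alpha> (r *\<^sub>R \<gamma>) = r *\<^sub>R D \<alpha> \<gamma>"
    "f \<in> C \<Longrightarrow> D (fun_mult f \<alpha>) \<gamma> = fun_mult f (D \<alpha> \<gamma>)"
    "f \<in> C \<Longrightarrow> D \<alpha> (fun_mult f \<gamma>) = fun_mult f (D \<alpha> \<gamma>) + fun_mult (der (S \<alpha>) f) \<gamma>"
    "D 0 \<gamma> = 0" "D \<alpha> 0 = 0"
  using assms
  by (auto intro!: OM_eqI simp: pair_D_dual Q_simps all_closed expand S_simps S_0 der_0 der_uminus algebra_simps)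

lemma right_anchored_D: "right_anchored_product A (cotangent_bundle A) (sharp A h) D"
  unfolding right_anchored_product_def bilinear_map_on_def
  using anchored_cotangent by (auto intro!: linear_map_onI simp: D_simps all_closed act_sharp)

text \<open>The derivative of h in \<D> is symmetric in its two forms, so it drops out of the
  commutator. This is why \<open>anchor_morphism\<close> below can be written with the dual
  connection in place of \<D>.\<close>

lemma commutator_D:
  assumes "\<alpha> \<in> OM" "\<beta> \<in> OM"
  shows "D \<alpha> \<beta> - D \<beta> \<alpha> = N (S \<alpha>) \<beta> - N (S \<beta>) \<alpha>"
  by (rule OM_eqI) (use assms W_sym[of _ \<alpha> \<beta>] in \<open>simp_all add: all_closed pair_D pair_form\<close>)

section \<open>Flatness of \<D> and the anchor\<close>

definition anchor_morphism :: bool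
  where "anchor_morphism \<longleftrightarrow>
    (\<forall>\<alpha>\<in>OM. \<forall>\<beta>\<in>OM. vf_bracket (S \<alpha>) (S \<beta>) = S (N (S \<alpha>) \<beta> - N (S \<beta>) \<alpha>))"

text \<open>Both sides say that \<open>W (S \<alpha>) \<beta> = W (S \<beta>) \<alpha>\<close>: by
  torsion-freeness the difference of these two fields is exactly the failure of \<open>S\<close> to
  preserve brackets. Quantifying over \<gamma> then tests equality of vector fields.\<close>

lemma anchor_morphism_iff:
  "anchor_morphism \<longleftrightarrow> (\<forall>\<alpha>\<in>OM. \<forall>\<beta>\<in>OM. \<forall>\<gamma>\<in>OM.
     bivector_derivative A conn h (S \<alpha>) \<beta> \<gamma> - bivector_derivative A conn h (S \<beta>) \<alpha> \<gamma> = 0)"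
proof -
  have "vf_bracket (S \<alpha>) (S \<beta>) = S (N (S \<alpha>) \<beta> - N (S \<beta>) \<alpha>) \<longleftrightarrow> W (S \<alpha>) \<beta> = W (S \<beta>) \<alpha>"
    if "\<alpha> \<in> OM" "\<beta> \<in> OM" for \<alpha> \<beta>
    using that by (auto simp: W_def torsion_free bv_closed S_simps algebra_simps)
  moreover have "W (S \<alpha>) \<beta> = W (S \<beta>) \<alpha> \<longleftrightarrow> (\<forall>\<gamma>\<in>OM.
      bivector_derivative A conn h (S \<alpha>) \<beta> \<gamma> - bivector_derivative A conn h (S \<beta>) \<alpha> \<gamma> = 0)"
    if "\<alpha> \<in> OM" "\<beta> \<in> OM" for \<alpha> \<beta>
    using that by (auto simp: bivector_derivative_eq bv_closed intro!: VF_eqI)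
  ultimately show ?thesis by (simp add: anchor_morphism_def)
qed

text \<open>The Leibniz rule is used twice in the iterated products and once in the commutator term.
  Mixed first-order terms cancel, and f is finally differentiated along the bracket defect of the
  anchor.\<close>

lemma curvature_D_mult:
  assumes "\<alpha> \<in> OM" "\<beta> \<in> OM" "\<gamma> \<in> OM" "f \<in> C"
  shows "curvature D \<alpha> \<beta> (fun_mult f \<gamma>) = fun_mult f (curvature D \<alpha> \<beta> \<gamma>) +
    fun_mult (der (vf_bracket (S \<alpha>) (S \<beta>) - S (D \<alpha> \<beta> - D \<beta> \<alpha>)) f) \<gamma>"
  by (rule OM_eqI)
    (use assms in \<open>simp_all add: curvature_def commutator_def bracket_closed all_closed D_simps expand der_bracket
      S_simps algebra_simps\<close>)

text \<open>For flat \<D> the defect field Z satisfies Z(f) \<gamma> = 0 for all f and \<gamma>. The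
  choice \<gamma> = df, evaluated on Z, gives the square of Z(f), so Z vanishes on every smooth
  function.\<close>

lemma anchor_morphism_if_flat:
  assumes "\<And>\<alpha> \<beta> \<gamma>. \<alpha> \<in> OM \<Longrightarrow> \<beta> \<in> OM \<Longrightarrow> \<gamma> \<in> OM \<Longrightarrow> curvature D \<alpha> \<beta> \<gamma> = 0"
  shows anchor_morphism
  unfolding anchor_morphism_def
proof (intro ballI)
  fix \<alpha> \<beta> assume ab: "\<alpha> \<in> OM" "\<beta> \<in> OM"
  define Z where "Z = vf_bracket (S \<alpha>) (S \<beta>) - S (D \<alpha> \<beta> - D \<beta> \<alpha>)"
  have Z: "Z \<in> VF" unfolding Z_def using ab by (simp add: bracket_closed all_closed)
  have "Z = 0"
  proof (rule der_eqI[OF Z VF_0])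
    fix f assume f: "f \<in> C"
    have "fun_mult f 0 = (0 :: 'm \<Rightarrow> 'm tvec \<Rightarrow> real)"
      by (simp add: fun_mult_def fun_eq_iff)
    \<comment> \<open>Both curvature terms in \<open>curvature_D_mult\<close> are 0, which leaves
      the derivation term alone.\<close>
    then have 0: "fun_mult (der Z f) (diff_form f) = 0"
      using curvature_D_mult[OF ab diff_form_OM[OF f] f] assms[OF ab diff_form_OM[OF f]]
        assms[OF ab OM_mult[OF f diff_form_OM[OF f]]]
      by (simp add: Z_def)
    have "der Z f p * diff_form f p (Z p) = 0" for p
      using fun_cong[OF fun_cong[OF 0, of p], of "Z p"] by (simp add: fun_mult_def scaleR_fun_def)
    then show "der Z f = der 0 f"
      using diff_form_apply[OF VF_T[OF Z]] by (simp add: der_def fun_eq_iff)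
  qed
  then show "vf_bracket (S \<alpha>) (S \<beta>) = S (N (S \<alpha>) \<beta> - N (S \<beta>) \<alpha>)"
    using ab by (simp add: Z_def commutator_D)
qed

text \<open>The hypothesis opens the bracket of \<open>S \<alpha>\<close> with
  \<open>S (N X \<beta>)\<close>. Its term containing \<open>N (S (N X \<beta>)) \<alpha>\<close>
  cancels against the one that \<open>Q \<alpha>\<close> contributes, so no nested \<open>S\<close>
  survives.\<close>

lemma Q_Q:
  assumes anchor_morphism "\<alpha> \<in> OM" "\<beta> \<in> OM" "X \<in> VF"
  shows "Q \<alpha> (Q \<beta> X) = vf_bracket (S \<alpha>) (vf_bracket (S \<beta>) X) +
    S (N (S \<alpha>) (N X \<beta>) + N (vf_bracket (S \<beta>) X) \<alpha>)"
proof -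
  have "vf_bracket (S \<alpha>) (S (N X \<beta>)) = S (N (S \<alpha>) (N X \<beta>) - N (S (N X \<beta>)) \<alpha>)"
    using assms N_closed by (simp add: anchor_morphism_def)
  moreover have "vf_bracket (S \<alpha>) (Y + Z) = vf_bracket (S \<alpha>) Y + vf_bracket (S \<alpha>) Z" if "Y \<in> VF" "Z \<in> VF" for Y Z
    using that assms by (simp add: torsion_free all_closed conn_simps)
  ultimately show ?thesis
    using assms(2-) by (simp add: Q_def all_closed bracket_closed N_simps S_simps)
qed

lemma N_flat_bracket:
  assumes "X \<in> VF" "Y \<in> VF" "\<beta> \<in> OM"
  shows "N (vf_bracket X Y) \<beta> = N X (N Y \<beta>) - N Y (N X \<beta>)"
  using N_flat[OF assms] assms by (simp add: torsion_free conn_closed N_simps)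

lemma Q_flat:
  assumes anchor_morphism "\<alpha> \<in> OM" "\<beta> \<in> OM" "X \<in> VF"
  shows "Q \<alpha> (Q \<beta> X) - Q \<beta> (Q \<alpha> X) = Q (D \<alpha> \<beta> - D \<beta> \<alpha>) X"
proof -
  have bracket: "vf_bracket (S \<alpha>) (S \<beta>) = S (D \<alpha> \<beta> - D \<beta> \<alpha>)"
    using assms by (simp add: anchor_morphism_def commutator_D)
  have 1: "vf_bracket (S \<alpha>) (vf_bracket (S \<beta>) X) - vf_bracket (S \<beta>) (vf_bracket (S \<alpha>) X) =
      vf_bracket (S (D \<alpha> \<beta> - D \<beta> \<alpha>)) X"
    unfolding bracket[symmetric] using jacobi[of "S \<alpha>" "S \<beta>" X] assms
    by (simp add: torsion_free all_closed conn_simps algebra_simps)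
  \<comment> \<open>Flatness of the dual connection for the pairs \<open>S \<beta>\<close>, X and
    \<open>S \<alpha>\<close>, X.\<close>
  have 2: "N X (D \<alpha> \<beta> - D \<beta> \<alpha>) = (N (S \<alpha>) (N X \<beta>) + N (vf_bracket (S \<beta>) X) \<alpha>) -
      (N (S \<beta>) (N X \<alpha>) + N (vf_bracket (S \<alpha>) X) \<beta>)"
    using assms by (simp add: commutator_D all_closed N_flat_bracket N_simps)
  show ?thesis
    unfolding Q_Q[OF assms] Q_Q[OF assms(1,3,2,4)] Q_def[of "D \<alpha> \<beta> - D \<beta> \<alpha>"] 1[symmetric] 2
    using assms by (simp add: all_closed bracket_closed S_simps algebra_simps)
qed

text \<open>Paired with X, the iterated derivatives of <\<gamma>, X> cancel because the anchor
  preserves brackets, and the remaining terms are \<open>Q_flat\<close> under \<gamma>.\<close>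

lemma D_flat:
  assumes anchor_morphism "\<alpha> \<in> OM" "\<beta> \<in> OM" "\<gamma> \<in> OM"
  shows "curvature D \<alpha> \<beta> \<gamma> = 0"
proof (rule OM_eqI)
  fix X assume X: "X \<in> VF"
  have "der (S (D \<alpha> \<beta> - D \<beta> \<alpha>)) (fib_app \<gamma> X) = der (vf_bracket (S \<alpha>) (S \<beta>)) (fib_app \<gamma> X)"
    using assms by (simp add: anchor_morphism_def commutator_D)
  moreover have "fib_app \<gamma> (Q \<alpha> (Q \<beta> X) - Q \<beta> (Q \<alpha> X)) = fib_app \<gamma> (Q (D \<alpha> \<beta> - D \<beta> \<alpha>) X)"
    using Q_flat[OF assms(1-3) X] by simp
  ultimately show "fib_app (curvature D \<alpha> \<beta> \<gamma>) X = fib_app 0 X"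
    using assms(2-) X
    by (simp add: curvature_def commutator_def all_closed pair_D_dual expand der_bracket S_simps algebra_simps)
qed (use assms in \<open>simp_all add: curvature_def commutator_def all_closed\<close>)

lemma left_symmetric_iff:
  "left_symmetric_algebroid A (cotangent_bundle A) (sharp A h) D \<longleftrightarrow> anchor_morphism"
  unfolding left_symmetric_algebroid_def
  using right_anchored_D D_flat anchor_morphism_if_flat by blast

end

section \<open>Compatibility and the para-Kaehler structure\<close>

lemma bilinear_map_on_comp_left:
  "bilinear_map_on V W f \<Longrightarrow> linear_map_on V V k \<Longrightarrow> bilinear_map_on V W (\<lambda>u. f (k u))"
  unfolding bilinear_map_on_def linear_map_on_def by simp

section \<open>The mixed curvature of the pair\<close>

context affine_bivector
begin

text \<open>The vector part of the mixed curvature at X, \<alpha>, Y. The last two terms come from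
  the commutator of X and \<alpha> in the double, which is \<open>N X \<alpha>\<close> minus
  \<open>Q \<alpha> X\<close>.\<close>

definition R_vec :: "('m \<Rightarrow> 'm tvec) \<Rightarrow> ('m \<Rightarrow> 'm tvec \<Rightarrow> real) \<Rightarrow> ('m \<Rightarrow> 'm tvec) \<Rightarrow> 'm \<Rightarrow> 'm tvec"
  where "R_vec X \<alpha> Y = conn X (Q \<alpha> Y) - Q \<alpha> (conn X Y) + conn (Q \<alpha> X) Y - Q (N X \<alpha>) Y"

definition R_form ::
    "('m \<Rightarrow> 'm tvec \<Rightarrow> real) \<Rightarrow> ('m \<Rightarrow> 'm tvec) \<Rightarrow> ('m \<Rightarrow> 'm tvec \<Rightarrow> real) \<Rightarrow> 'm \<Rightarrow> 'm tvec \<Rightarrow> real"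
  where "R_form \<alpha> X \<beta> = D \<alpha> (N X \<beta>) - N X (D \<alpha> \<beta>) - N (Q \<alpha> X) \<beta> + D (N X \<alpha>) \<beta>"

lemma R_closed:
  "X \<in> VF \<Longrightarrow> \<alpha> \<in> OM \<Longrightarrow> Y \<in> VF \<Longrightarrow> R_vec X \<alpha> Y \<in> VF"
  "X \<in> VF \<Longrightarrow> \<alpha> \<in> OM \<Longrightarrow> \<beta> \<in> OM \<Longrightarrow> R_form \<alpha> X \<beta> \<in> OM"
  by (simp_all add: R_vec_def R_form_def all_closed)

text \<open>By flatness \<open>R_vec X \<alpha> Y\<close> is, up to sign, the second covariant derivative of \<open>h\<^sub>#\<close> along
  \<open>X\<close> and \<open>Y\<close> at \<open>\<alpha>\<close>.\<close>

lemma R_vec_eq: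
  assumes "X \<in> VF" "\<alpha> \<in> OM" "Y \<in> VF"
  shows "R_vec X \<alpha> Y = W (conn X Y) \<alpha> + W Y (N X \<alpha>) - conn X (W Y \<alpha>)"
proof -
  have "conn (conn (S \<alpha>) X) Y =
      conn (conn X (S \<alpha>)) Y + conn (S \<alpha>) (conn X Y) - conn X (conn (S \<alpha>) Y)"
    using flat'[OF S_closed[OF assms(2)] assms(1,3)] by (simp add: algebra_simps)
  then show ?thesis
    using assms by (simp add: R_vec_def Q_eq W_def all_closed conn_simps algebra_simps)
qed

text \<open>Flatness of \<nabla> on \<open>S \<alpha>\<close> and of the dual connection on \<alpha>
  lets the derivatives along X and Y be exchanged; the bracket terms that appear are those
  separating \<open>W (conn X Y)\<close> from \<open>W (conn Y X)\<close>.\<close>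

lemma R_vec_sym:
  assumes "X \<in> VF" "\<alpha> \<in> OM" "Y \<in> VF"
  shows "R_vec X \<alpha> Y = R_vec Y \<alpha> X"
proof -
  have 1: "conn (conn X Y) (S \<alpha>) =
      conn (conn Y X) (S \<alpha>) + conn X (conn Y (S \<alpha>)) - conn Y (conn X (S \<alpha>))"
    using flat'[OF assms(1,3) S_closed[OF assms(2)]] by (simp add: algebra_simps)
  have "N (conn X Y) \<alpha> = N (conn Y X) \<alpha> + N X (N Y \<alpha>) - N Y (N X \<alpha>)"
    using N_flat[OF assms(1,3,2)] by (simp add: algebra_simps)
  then have 2: "S (N (conn X Y) \<alpha>) = S (N (conn Y X) \<alpha>) + S (N X (N Y \<alpha>)) - S (N Y (N X \<alpha>))"
    using assms by (simp add: all_closed S_simps)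
  show ?thesis
    unfolding R_vec_eq[OF assms] R_vec_eq[OF assms(3,2,1)] W_def 1 2
    using assms by (simp add: all_closed conn_simps algebra_simps)
qed

text \<open>This is \<open>W_sym\<close> differentiated along X: \<open>pair_conn\<close> moves
  \<nabla>_X off the vector field, and each resulting term is an instance of
  \<open>W_sym\<close>.\<close>

lemma pair_R_vec_sym:
  assumes "X \<in> VF" "\<alpha> \<in> OM" "\<beta> \<in> OM" "Y \<in> VF"
  shows "fib_app \<beta> (R_vec X \<alpha> Y) = fib_app \<alpha> (R_vec X \<beta> Y)"
proof -
  have pair_conn: "fib_app \<gamma> (conn X Z) = der X (fib_app \<gamma> Z) - fib_app (N X \<gamma>) Z"
    if "\<gamma> \<in> OM" "Z \<in> VF" for \<gamma> Z
    using that assms by (simp add: pair_N)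
  show ?thesis
    using assms W_sym[OF conn_closed[OF assms(1,4)] assms(2,3)]
      W_sym[OF assms(4) N_closed[OF assms(1,2)] assms(3)]
      W_sym[OF assms(4,2) N_closed[OF assms(1,3)]] W_sym[OF assms(4,2,3)]
    by (simp add: R_vec_eq all_closed pair_vector pair_conn)
qed

text \<open>The curvature of a dual connection is the negative transpose, and the sign is absorbed
  by exchanging X and \<alpha>. The second compatibility condition thereby becomes a symmetry of
  \<open>R_vec\<close> in the two forms.\<close>

lemma pair_R_form:
  assumes "X \<in> VF" "\<alpha> \<in> OM" "\<beta> \<in> OM" "Y \<in> VF"
  shows "fib_app (R_form \<alpha> X \<beta>) Y = fib_app \<beta> (R_vec X \<alpha> Y)"
proof -
  have "der (Q \<alpha> X) f = der (S \<alpha>) (der X f) - der X (der (S \<alpha>) f) + der (S (N X \<alpha>)) f" for f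
    by (simp add: Q_def der_vector der_bracket)
  then show ?thesis
    using assms by (simp add: R_form_def R_vec_def all_closed pair_D_dual expand algebra_simps)
qed

lemma R_form_sym:
  assumes "X \<in> VF" "\<alpha> \<in> OM" "\<beta> \<in> OM"
  shows "R_form \<alpha> X \<beta> = R_form \<beta> X \<alpha>"
  using assms by (auto intro!: OM_eqI simp: R_closed pair_R_form pair_R_vec_sym)

section \<open>Sections of the sum by components, and compatibility\<close>

definition mk :: "('m \<Rightarrow> 'm tvec) \<Rightarrow> ('m \<Rightarrow> 'm tvec \<Rightarrow> real) \<Rightarrow> 'm \<Rightarrow> 'm tvec \<times> ('m tvec \<Rightarrow> real)"
  where "mk X \<alpha> = (\<lambda>p. (X p, \<alpha> p))"

lemma mk_simps:
  "inl_section X + inr_section \<alpha> = mk X \<alpha>" "inl_section X = mk X 0" "inr_section \<alpha> = mk 0 \<alpha>"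
  "mk X \<alpha> + mk Y \<beta> = mk (X + Y) (\<alpha> + \<beta>)" "mk X \<alpha> - mk Y \<beta> = mk (X - Y) (\<alpha> - \<beta>)"
  "fun_mult f (mk X \<alpha>) = mk (fun_mult f X) (fun_mult f \<alpha>)" "r *\<^sub>R mk X \<alpha> = mk (r *\<^sub>R X) (r *\<^sub>R \<alpha>)"
  by (simp_all add: mk_def fun_eq_iff inl_section_def inr_section_def fun_mult_def scaleR_fun_def)

lemma mk_eq_0: "mk 0 0 = 0"
  by (simp add: mk_def fun_eq_iff zero_prod_def)

lemma mk_sections [simp]: "mk X \<alpha> \<in> sections TT \<longleftrightarrow> X \<in> VF \<and> \<alpha> \<in> OM"
  by (simp add: sections_TT_iff mk_def)

lemma mk_cases:
  assumes "a \<in> sections TT"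
  obtains X \<alpha> where "a = mk X \<alpha>" "X \<in> VF" "\<alpha> \<in> OM"
  using assms that[of "\<lambda>p. fst (a p)" "\<lambda>p. snd (a p)"] by (simp add: sections_TT_iff mk_def)

text \<open>Each component of the result involves only the same component of the second argument.
  Hence the mixed curvatures have a single component, and the connection preserves both
  summands.\<close>

lemma double_product_mk:
  assumes "\<alpha> \<in> OM" "Y \<in> VF"
  shows "double_product A (tangent_bundle A) id_anchor conn (sharp A h) D (mk X \<alpha>) (mk Y \<beta>) =
    mk (conn X Y + Q \<alpha> Y) (N X \<beta> + D \<alpha> \<beta>)"
  using predual_eq[OF assms] by (simp add: double_product_def mk_simps) (simp add: mk_def)

lemma compatible_if_anchor_morphism:
  assumes anchor_morphism
  shows "compatible A (tangent_bundle A) id_anchor conn (sharp A h) D"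
proof -
  have "left_symmetric_algebroid A (tangent_bundle A) id_anchor conn"
    using affine by (simp add: affine_manifold_def left_symmetric_algebroid_def curvature_def commutator_def)
  moreover have "curvature (double_product A (tangent_bundle A) id_anchor conn (sharp A h) D)
      (inl_section X) (inr_section \<alpha>) (inl_section Y) = mk (R_vec X \<alpha> Y) 0"
    if "X \<in> VF" "\<alpha> \<in> OM" "Y \<in> VF" for X \<alpha> Y
    using that
    by (simp add: curvature_def commutator_def mk_simps(2-) double_product_mk all_closed conn_simps N_simps
        Q_simps D_simps R_vec_def algebra_simps)
  moreover have "curvature (double_product A (tangent_bundle A) id_anchor conn (sharp A h) D)
      (inr_section \<alpha>) (inl_section X) (inr_section \<beta>) = mk 0 (R_form \<alpha> X \<beta>)"
    if "X \<in> VF" "\<alpha> \<in> OM" "\<beta> \<in> OM" for X \<alpha> \<beta>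
    using that
    by (simp add: curvature_def commutator_def mk_simps(2-) double_product_mk all_closed conn_simps N_simps
        Q_simps D_simps R_form_def algebra_simps)
  ultimately show ?thesis
    using assms R_vec_sym R_form_sym by (simp add: compatible_def Let_def left_symmetric_iff)
qed

lemma compatible_iff:
  "left_symmetric_algebroid A (cotangent_bundle A) (sharp A h) D \<and>
    compatible A (tangent_bundle A) id_anchor conn (sharp A h) D \<longleftrightarrow> anchor_morphism"
  using left_symmetric_iff compatible_if_anchor_morphism by blast

section \<open>Bracket, metric and endomorphism on the sum\<close>

abbreviation "\<rho> \<equiv> sum_anchor id_anchor (zero_anchor :: 'm \<Rightarrow> ('m tvec \<Rightarrow> real) \<Rightarrow> 'm tvec)"
abbreviation "br \<equiv> triangle_bracket A conn"
abbreviation "g \<equiv> bivector_metric h"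
abbreviation "K \<equiv> bivector_endo A h"

lemma br_mk: "br (mk X \<alpha>) (mk Y \<beta>) = mk (vf_bracket X Y) (N X \<beta> - N Y \<alpha>)"
  by (simp add: triangle_bracket_def mk_simps) (simp add: mk_def)

lemma act_mk: "act \<rho> (mk X \<alpha>) f = der X f"
  by (simp add: act_def mk_def sum_anchor_def id_anchor_def zero_anchor_def der_def)

lemma anchored_TT: "anchored_bundle A TT \<rho>"
proof -
  have "fib_app \<rho> (mk X \<alpha>) = X" for X \<alpha>
    by (simp add: fib_app_def mk_def sum_anchor_def id_anchor_def zero_anchor_def fun_eq_iff)
  then have "fib_app \<rho> s \<in> VF" if "s \<in> sections TT" for s
    using that by (elim mk_cases) simp
  then show ?thesis
    using vector_bundle_TT
    by (auto simp: anchored_bundle_def bundle_map_def linear_map_on_def sum_anchor_def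
        id_anchor_def zero_anchor_def)
qed

lemma fun_mult_distrib:
  "fun_mult f (s + t) = fun_mult f s + fun_mult f t" "fun_mult f (s - t) = fun_mult f s - fun_mult f t"
  "fun_mult (f + f') s = fun_mult f s + fun_mult f' s"
  by (simp_all add: fun_mult_def fun_eq_iff algebra_simps)

text \<open>The bracket is the semidirect product of vector fields with one-forms as an abelian
  ideal, acted on by the dual connection. Its Jacobi identity combines that of vector fields with
  flatness of this action.\<close>

lemma br_algebra:
  assumes "a \<in> sections TT" "b \<in> sections TT" "c \<in> sections TT"
  shows "br a b \<in> sections TT" "br a (b + c) = br a b + br a c" "br (a + b) c = br a c + br b c"
    "br a (r *\<^sub>R b) = r *\<^sub>R br a b" "br (r *\<^sub>R a) b = r *\<^sub>R br a b" "br a a = 0"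
    "f \<in> C \<Longrightarrow> br a (fun_mult f b) = fun_mult f (br a b) + fun_mult (act \<rho> a f) b"
    "br a (br b c) + br b (br c a) + br c (br a b) = 0"
proof -
  obtain X \<alpha> where a: "a = mk X \<alpha>" "X \<in> VF" "\<alpha> \<in> OM" using assms(1) by (rule mk_cases)
  obtain Y \<beta> where b: "b = mk Y \<beta>" "Y \<in> VF" "\<beta> \<in> OM" using assms(2) by (rule mk_cases)
  obtain Z \<gamma> where c: "c = mk Z \<gamma>" "Z \<in> VF" "\<gamma> \<in> OM" using assms(3) by (rule mk_cases)
  note [simp] = a b c br_mk mk_simps bracket_closed all_closed
  show "br a b \<in> sections TT" by simp
  show "br a (b + c) = br a b + br a c" "br (a + b) c = br a c + br b c"
    "br a (r *\<^sub>R b) = r *\<^sub>R br a b" "br (r *\<^sub>R a) b = r *\<^sub>R br a b" "br a a = 0"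
    "f \<in> C \<Longrightarrow> br a (fun_mult f b) = fun_mult f (br a b) + fun_mult (act \<rho> a f) b"
    by (simp_all add: torsion_free conn_simps N_simps fun_mult_distrib act_mk mk_eq_0 algebra_simps)
  show "br a (br b c) + br b (br c a) + br c (br a b) = 0"
    using jacobi[of X Y Z] by (simp add: N_flat_bracket N_simps mk_eq_0)
qed

lemma lie_algebroid_TT: "lie_algebroid A TT \<rho> br"
  unfolding lie_algebroid_def bilinear_map_on_def
  using anchored_TT br_algebra by (auto intro!: linear_map_onI)

lemma g_bilinear: "bilinear_map_on (T p \<times> T' p) UNIV (g p)"
proof -
  have [simp]: "(r *\<^sub>R f) x = r *\<^sub>R f x" for r x and f :: "'m tvec \<Rightarrow> real"
    by (simp add: scaleR_fun_def)
  note [simp] = bivector_metric_def T'_add T'_scale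
    linear_map_onD(2)[OF h_linear(1)] linear_map_onD(3)[OF h_linear(1)]
    linear_map_onD(2)[OF h_linear(2)] linear_map_onD(3)[OF h_linear(2)]
  show ?thesis
    unfolding bilinear_map_on_def
    by (intro conjI ballI linear_map_onI) (auto simp: algebra_simps)
qed

text \<open>\<open>lift Y\<close> is the isomorphism \<open>Y + \<beta> \<mapsto> Y + h\<^sub>#(\<beta>) + \<beta>\<close>.  It carries the natural pairing to
  the metric, the anchor \<open>id + h\<^sub>#\<close> to \<open>id + 0\<close>, the splitting \<open>TM \<oplus> T*M\<close> to the eigenbundles of
  \<open>K\<^sub>h\<close>, and the connection of the compatible pair to the Levi-Civita connection.\<close>

definition lift :: "('m \<Rightarrow> 'm tvec) \<Rightarrow> ('m \<Rightarrow> 'm tvec \<Rightarrow> real) \<Rightarrow> 'm \<Rightarrow> 'm tvec \<times> ('m tvec \<Rightarrow> real)"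
  where "lift Y \<beta> = mk (Y + S \<beta>) \<beta>"

lemma lift_sections: "Y \<in> VF \<Longrightarrow> \<beta> \<in> OM \<Longrightarrow> lift Y \<beta> \<in> sections TT"
  by (simp add: lift_def all_closed)

lemma lift_cases:
  assumes "a \<in> sections TT"
  obtains X \<alpha> where "a = lift X \<alpha>" "X \<in> VF" "\<alpha> \<in> OM"
proof -
  obtain X \<alpha> where "a = mk X \<alpha>" "X \<in> VF" "\<alpha> \<in> OM" using assms by (rule mk_cases)
  then show thesis using that[of "X - S \<alpha>" \<alpha>] by (simp add: lift_def all_closed)
qed

lemma lift_simps:
  assumes "\<alpha> \<in> OM"
  shows "\<beta> \<in> OM \<Longrightarrow> lift X \<alpha> + lift Y \<beta> = lift (X + Y) (\<alpha> + \<beta>)"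
    "\<beta> \<in> OM \<Longrightarrow> lift X \<alpha> - lift Y \<beta> = lift (X - Y) (\<alpha> - \<beta>)"
    "fun_mult f (lift X \<alpha>) = lift (fun_mult f X) (fun_mult f \<alpha>)"
    "r *\<^sub>R lift X \<alpha> = lift (r *\<^sub>R X) (r *\<^sub>R \<alpha>)"
  using assms by (simp_all add: lift_def mk_simps S_simps fun_mult_distrib algebra_simps)

text \<open>Each of the two lifts contributes a term h(\<beta>, \<gamma>), and together they cancel
  the term with factor -2 in the metric.\<close>

lemma g_lift:
  assumes "Y \<in> VF" "\<beta> \<in> OM" "Z \<in> VF" "\<gamma> \<in> OM"
  shows "(\<lambda>p. g p (lift Y \<beta> p) (lift Z \<gamma> p)) = fib_app \<beta> Z + fib_app \<gamma> Y"
proof -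
  have "(\<lambda>p. g p (lift Y \<beta> p) (lift Z \<gamma> p)) =
      fib_app \<beta> (Z + S \<gamma>) + fib_app \<gamma> (Y + S \<beta>) - 2 * (\<lambda>p. h p (\<beta> p) (\<gamma> p))"
    by (simp add: bivector_metric_def lift_def mk_def fun_eq_iff fib_app_def)
  then show ?thesis
    using assms pair_S[of \<beta> \<gamma>] pair_S_sym[of \<beta> \<gamma>]
    by (simp add: all_closed pair_vector)
qed

lemma T'_neg: "\<xi> \<in> T' p \<Longrightarrow> - \<xi> \<in> T' p"
  and sharp_neg: "\<xi> \<in> T' p \<Longrightarrow> sharp A h p (- \<xi>) = - sharp A h p \<xi>"
  using subspace_neg[OF subspace_T'] linear_map_onD(3)[OF sharp_linear, of \<xi> p "-1"] by simp_all

text \<open>On the tangent part, S \<beta> - 2 S \<beta> is S applied to -\<beta>. So the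
  eigenspaces are the vectors \<open>lift Y 0\<close>, for 1, and the graph of h_sharp, made of
  \<open>lift 0 \<beta>\<close>, for -1.\<close>

lemma K_lift:
  assumes "\<beta> \<in> OM"
  shows "fib_app K (lift Y \<beta>) = lift Y (- \<beta>)"
proof
  fix p
  show "fib_app K (lift Y \<beta>) p = lift Y (- \<beta>) p"
    by (simp add: lift_def mk_def fib_app_def bivector_endo_def sharp_neg[OF OM_T'[OF assms]] scaleR_2)
qed

lemma K_fiber:
  "u \<in> T p \<times> T' p \<Longrightarrow> K p u \<in> T p \<times> T' p" "u \<in> T p \<times> T' p \<Longrightarrow> K p (K p u) = u"
proof -
  note neg = T'_neg sharp_neg
  show "K p u \<in> T p \<times> T' p" if "u \<in> T p \<times> T' p"
    using that neg sharp_T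
    by (auto simp: bivector_endo_def intro!: subspace_diff[OF subspace_T] subspace_scale[OF subspace_T])
  show "K p (K p u) = u" if "u \<in> T p \<times> T' p"
    using that neg by (auto simp: bivector_endo_def)
qed

lemma K_linear: "linear_map_on (T p \<times> T' p) (T p \<times> T' p) (K p)"
proof (rule linear_map_onI)
  show "K p (u + v) = K p u + K p v" if "u \<in> T p \<times> T' p" "v \<in> T p \<times> T' p" for u v
    using that linear_map_onD(2)[OF sharp_linear] by (auto simp: bivector_endo_def algebra_simps)
  show "K p (r *\<^sub>R u) = r *\<^sub>R K p u" if "u \<in> T p \<times> T' p" for r u
    using that linear_map_onD(3)[OF sharp_linear] by (auto simp: bivector_endo_def algebra_simps)
qed (rule K_fiber)

lemma bundle_iso_K: "bundle_iso TT TT K"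
proof -
  have "fib_app K s \<in> sections TT" if "s \<in> sections TT" for s
    using that by (elim lift_cases) (simp add: K_lift lift_sections all_closed)
  moreover have "bij_betw (K p) (T p \<times> T' p) (T p \<times> T' p)" for p
    by (rule bij_betw_byWitness[where f' = "K p"]) (simp_all add: K_fiber(2) image_subset_iff K_fiber(1) del: mem_Sigma_iff split_paired_All)
  ultimately show ?thesis
    using K_linear by (simp add: bundle_iso_def bundle_map_def)
qed

text \<open>The term 2h(\<xi>, \<eta>) produced by -\<xi> in the metric cancels the one produced by
  the shift of u.\<close>

lemma associated_form_eq:
  assumes "u \<in> T p" "\<xi> \<in> T' p" "v \<in> T p" "\<eta> \<in> T' p"
  shows "associated_form g K p (u, \<xi>) (v, \<eta>) = \<eta> u - \<xi> v"
proof -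
  have "\<eta> (u - 2 *\<^sub>R sharp A h p \<xi>) = \<eta> u - 2 * h p \<xi> \<eta>"
    using assms by (simp add: T'_diff T'_scale subspace_scale[OF subspace_T] sharp_T sharp_eval)
  moreover have "h p (- \<xi>) \<eta> = - h p \<xi> \<eta>"
    using linear_map_onD(3)[OF h_linear(2)[OF assms(4)] assms(2), of "-1"] by simp
  ultimately show ?thesis
    by (simp add: associated_form_def bivector_metric_def bivector_endo_def)
qed

text \<open>The operation of \<open>double_product\<close> transported by \<open>lift\<close>; X and
  Y are the tangent components of the inverse of \<open>lift\<close>.\<close>

definition LC ::
    "('m \<Rightarrow> 'm tvec \<times> ('m tvec \<Rightarrow> real)) \<Rightarrow> ('m \<Rightarrow> 'm tvec \<times> ('m tvec \<Rightarrow> real)) \<Rightarrow>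
     'm \<Rightarrow> 'm tvec \<times> ('m tvec \<Rightarrow> real)"
  where "LC a b =
    (let \<alpha> = (\<lambda>p. snd (a p)); X = (\<lambda>p. fst (a p)) - S \<alpha>; \<beta> = (\<lambda>p. snd (b p)); Y = (\<lambda>p. fst (b p)) - S \<beta>
     in lift (conn X Y + Q \<alpha> Y) (N X \<beta> + D \<alpha> \<beta>))"

lemma LC_lift: "LC (lift X \<alpha>) (lift Y \<beta>) = lift (conn X Y + Q \<alpha> Y) (N X \<beta> + D \<alpha> \<beta>)"
proof -
  have "(\<lambda>p. snd (lift X \<alpha> p)) = \<alpha>" "(\<lambda>p. fst (lift X \<alpha> p)) - S \<alpha> = X" for X \<alpha>
    by (simp_all add: lift_def mk_def fun_eq_iff)
  then show ?thesis by (simp add: LC_def Let_def)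
qed

text \<open>In lifted components \<open>LC\<close> acts separately on the two summands, so it
  commutes with K. It preserves the metric because \<open>conn\<close> is dual to \<open>N\<close>
  and \<open>Q\<close> to \<open>D\<close>. The bracket condition on the anchor enters in the
  torsion.\<close>

lemma LC_algebra:
  assumes "a \<in> sections TT" "b \<in> sections TT" "c \<in> sections TT"
  shows "LC a b \<in> sections TT" "LC a (b + c) = LC a b + LC a c" "LC (a + b) c = LC a c + LC b c"
    "LC a (r *\<^sub>R b) = r *\<^sub>R LC a b" "LC (r *\<^sub>R a) b = r *\<^sub>R LC a b"
    "f \<in> C \<Longrightarrow> LC (fun_mult f a) b = fun_mult f (LC a b)"
    "f \<in> C \<Longrightarrow> LC a (fun_mult f b) = fun_mult f (LC a b) + fun_mult (act \<rho> a f) b"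
    "LC a (fib_app K b) = fib_app K (LC a b)"
    "act \<rho> a (\<lambda>p. g p (b p) (c p)) = (\<lambda>p. g p (LC a b p) (c p)) + (\<lambda>p. g p (b p) (LC a c p))"
    "anchor_morphism \<Longrightarrow> LC a b - LC b a = br a b"
proof -
  obtain X \<alpha> where a: "a = lift X \<alpha>" "X \<in> VF" "\<alpha> \<in> OM" using assms(1) by (rule lift_cases)
  obtain Y \<beta> where b: "b = lift Y \<beta>" "Y \<in> VF" "\<beta> \<in> OM" using assms(2) by (rule lift_cases)
  obtain Z \<gamma> where c: "c = lift Z \<gamma>" "Z \<in> VF" "\<gamma> \<in> OM" using assms(3) by (rule lift_cases)
  note [simp] = a b c LC_lift lift_simps lift_sections all_closed
  \<comment> \<open>Seen through \<open>lift\<close>, the anchor is the identity plus h_sharp, which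
    matches the Leibniz terms of \<open>conn\<close> and \<open>Q\<close>.\<close>
  have act: "act \<rho> (lift X \<alpha>) f = der X f + der (S \<alpha>) f" for f
    by (simp add: lift_def act_mk der_vector)
  show "LC a b \<in> sections TT" by simp
  show "LC a (b + c) = LC a b + LC a c" "LC (a + b) c = LC a c + LC b c"
    "LC a (r *\<^sub>R b) = r *\<^sub>R LC a b" "LC (r *\<^sub>R a) b = r *\<^sub>R LC a b"
    "f \<in> C \<Longrightarrow> LC (fun_mult f a) b = fun_mult f (LC a b)"
    "f \<in> C \<Longrightarrow> LC a (fun_mult f b) = fun_mult f (LC a b) + fun_mult (act \<rho> a f) b"
    by (simp_all add: conn_simps N_simps Q_simps D_simps fun_mult_distrib act algebra_simps)
  show "LC a (fib_app K b) = fib_app K (LC a b)"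
    by (simp add: K_lift N_simps D_simps)
  show "act \<rho> a (\<lambda>p. g p (b p) (c p)) = (\<lambda>p. g p (LC a b p) (c p)) + (\<lambda>p. g p (b p) (LC a c p))"
    by (simp add: g_lift act expand pair_D_dual algebra_simps)
  show "LC a b - LC b a = br a b" if anchor_morphism
  proof -
    \<comment> \<open>The form part of the torsion matches by \<open>commutator_D\<close>. Its image
      under \<open>S\<close> enters the tangent part of the lift, where the bracket of
      \<open>S \<alpha>\<close> and \<open>S \<beta>\<close> has to appear.\<close>
    have "S (N (S \<alpha>) \<beta>) = S (N (S \<beta>) \<alpha>) + vf_bracket (S \<alpha>) (S \<beta>)"
      using that by (simp add: anchor_morphism_def S_simps)
    then have 1: "S (N (S \<alpha>) \<beta>) = S (N (S \<beta>) \<alpha>) + conn (S \<alpha>) (S \<beta>) - conn (S \<beta>) (S \<alpha>)"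
      by (simp add: torsion_free)
    have 2: "D \<alpha> \<beta> = D \<beta> \<alpha> + N (S \<alpha>) \<beta> - N (S \<beta>) \<alpha>"
      using commutator_D[of \<alpha> \<beta>] by (simp add: algebra_simps)
    have "LC a b - LC b a =
        lift (conn X Y + Q \<alpha> Y - (conn Y X + Q \<beta> X)) (N X \<beta> + D \<alpha> \<beta> - (N Y \<alpha> + D \<beta> \<alpha>))"
      by simp
    also have "\<dots> = mk (vf_bracket (X + S \<alpha>) (Y + S \<beta>)) (N (X + S \<alpha>) \<beta> - N (Y + S \<beta>) \<alpha>)"
      unfolding lift_def 2
      by (simp add: Q_eq torsion_free conn_simps N_simps S_simps 1 algebra_simps)
    also have "\<dots> = br a b" by (simp add: lift_def br_mk)
    finally show ?thesis .
  qed
qed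

lemma levi_civita_LC: "anchor_morphism \<Longrightarrow> levi_civita A TT \<rho> br g LC"
  unfolding levi_civita_def right_anchored_product_def bilinear_map_on_def
  using anchored_TT LC_algebra(1-7,9,10)
  by (auto intro!: linear_map_onI simp: plus_fun_def[of "\<lambda>p. g p (_ p) (_ p)"])

lemma fiber_form_g: "fiber_form A TT g"
proof -
  have "(\<lambda>p. g p (a p) (b p)) \<in> C" if "a \<in> sections TT" "b \<in> sections TT" for a b
    using that by (elim lift_cases) (simp add: g_lift all_closed)
  then show ?thesis using g_bilinear by (simp add: fiber_form_def)
qed

lemma T'_0: "0 \<in> T' p" "0 \<in> T p"
  by (simp_all add: subspace_0 subspace_T subspace_T')

lemma nondegenerate_g: "nondegenerate_form TT g"
  unfolding nondegenerate_form_def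
proof (intro allI ballI impI)
  fix p u assume u: "u \<in> fiber TT p" and 0: "\<forall>v\<in>fiber TT p. g p u v = 0"
  obtain v \<xi> where v: "u = (v, \<xi>)" "v \<in> T p" "\<xi> \<in> T' p" using u by auto
  have h0: "h p 0 \<eta> = 0" "h p \<xi> 0 = 0" if "\<eta> \<in> T' p" for \<eta>
    using linear_map_on_0[OF h_linear(2)[OF that] subspace_T'] linear_map_on_0[OF h_linear(1)[OF v(3)] subspace_T'] by auto
  \<comment> \<open>Testing with (w, 0) comes first: once \<xi> is 0, the term in h vanishes from
    the test with (0, \<eta>).\<close>
  have "\<xi> = 0"
  proof (rule T'_eqI[OF v(3) T'_0(1)])
    fix w assume "w \<in> T p"
    then show "\<xi> w = 0 w"
      using bspec[OF 0, of "(w, 0)"] T'_0 h0 v by (simp add: bivector_metric_def)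
  qed
  moreover have "v = 0"
  proof (rule T_separated[OF v(2) T'_0(2)])
    fix \<eta> assume \<eta>: "\<eta> \<in> T' p"
    then show "\<eta> v = \<eta> 0"
      using bspec[OF 0, of "(0, \<eta>)"] T'_0 h0[OF \<eta>] v \<open>\<xi> = 0\<close> linear_map_on_0[OF T'_linear[OF \<eta>] subspace_T]
      by (simp add: bivector_metric_def)
  qed
  ultimately show "u = 0" using v by (simp add: zero_prod_def)
qed

lemma para_kaehler:
  assumes anchor_morphism
  shows "para_kaehler_lie_algebroid A TT \<rho> br g K"
proof -
  have sym: "symmetric_form TT g"
    by (auto simp: symmetric_form_def bivector_metric_def h_sym)
  \<comment> \<open>Skewness of K is antisymmetry of the associated form, combined with symmetry of
    the metric.\<close>
  moreover have "g p (K p u) v = - g p u (K p v)" if uv: "u \<in> fiber TT p" "v \<in> fiber TT p" for p u v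
  proof -
    obtain x \<xi> where x: "u = (x, \<xi>)" "x \<in> T p" "\<xi> \<in> T' p" using uv by auto
    obtain y \<eta> where y: "v = (y, \<eta>)" "y \<in> T p" "\<eta> \<in> T' p" using uv by auto
    have "g p u (K p v) = g p (K p v) u"
      using sym uv K_fiber(1)[of v p] unfolding symmetric_form_def by (metis fiber_TT)
    then show ?thesis
      using associated_form_eq[OF x(2,3) y(2,3)] associated_form_eq[OF y(2,3) x(2,3)] x y
      by (simp add: associated_form_def)
  qed
  ultimately show ?thesis
    unfolding para_kaehler_lie_algebroid_def
    using lie_algebroid_TT fiber_form_g nondegenerate_g bundle_iso_K K_fiber(2) levi_civita_LC[OF assms]
      LC_algebra(8)
    by auto
qed

section \<open>The associated symplectic form\<close>

lemma associated_form_mk: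
  assumes "X \<in> VF" "\<alpha> \<in> OM" "Y \<in> VF" "\<beta> \<in> OM"
  shows "(\<lambda>p. associated_form g K p (mk X \<alpha> p) (mk Y \<beta> p)) = fib_app \<beta> X - fib_app \<alpha> Y"
  using associated_form_eq[OF VF_T OM_T' VF_T OM_T', OF assms]
  by (simp add: mk_def fun_eq_iff fib_app_def)

text \<open>The form is the canonical antisymmetric pairing of TM with its dual. Closedness
  expresses torsion-freeness of \<nabla>, since the bracket differentiates forms by the dual
  connection.\<close>

lemma symplectic: "symplectic_form A TT \<rho> br (associated_form g K)"
  unfolding symplectic_form_def
proof (intro conjI allI ballI)
  show "fiber_form A TT (associated_form g K)"
  proof -
    have "bilinear_map_on (T p \<times> T' p) UNIV (associated_form g K p)" for p
      unfolding associated_form_def by (rule bilinear_map_on_comp_left[OF g_bilinear K_linear])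
    moreover have "(\<lambda>p. associated_form g K p (a p) (b p)) \<in> C" if "a \<in> sections TT" "b \<in> sections TT" for a b
      using that by (elim mk_cases) (simp add: associated_form_mk all_closed)
    ultimately show ?thesis by (simp add: fiber_form_def)
  qed
  show "nondegenerate_form TT (associated_form g K)"
    unfolding nondegenerate_form_def
  proof (intro allI ballI impI)
    fix p u assume u: "u \<in> fiber TT p" and 0: "\<forall>v\<in>fiber TT p. associated_form g K p u v = 0"
    \<comment> \<open>The metric is nondegenerate, and K is its own inverse, so it can be applied
      once more.\<close>
    have "K p u = 0"
    proof (rule nondegenerate_g[unfolded nondegenerate_form_def, rule_format])
      show "K p u \<in> fiber TT p" using K_fiber(1)[of u p] u by simp
      show "g p (K p u) v = 0" if "v \<in> fiber TT p" for v
        using bspec[OF 0 that] by (simp add: associated_form_def)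
    qed
    then have "K p (K p u) = K p 0" by simp
    then show "u = 0"
      using K_fiber(2)[of u p] u linear_map_on_0[OF K_linear] subspace_T subspace_T'
      by (simp add: subspace_Times)
  qed
  show "associated_form g K p u u = 0" if "u \<in> fiber TT p" for p u
    using that by (auto simp: associated_form_eq)
  fix a b c p assume "a \<in> sections TT" "b \<in> sections TT" "c \<in> sections TT"
  then obtain X \<alpha> Y \<beta> Z \<gamma> where abc: "a = mk X \<alpha>" "b = mk Y \<beta>" "c = mk Z \<gamma>"
    and VF: "X \<in> VF" "Y \<in> VF" "Z \<in> VF" and OM: "\<alpha> \<in> OM" "\<beta> \<in> OM" "\<gamma> \<in> OM"
    by (elim mk_cases)
  let ?\<omega> = "\<lambda>a b. (\<lambda>p. associated_form g K p (a p) (b p))"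
  \<comment> \<open>Expanding the pairings with the dual connection cancels all derivatives of
    functions. What is left pairs each form with a bracket minus a difference of covariant
    derivatives.\<close>
  have "act \<rho> a (?\<omega> b c) + act \<rho> b (?\<omega> c a) + act \<rho> c (?\<omega> a b)
       - ?\<omega> (br a b) c - ?\<omega> (br b c) a - ?\<omega> (br c a) b = 0"
    using VF OM
    by (simp add: abc act_mk br_mk associated_form_mk bracket_closed all_closed expand)
      (simp add: torsion_free all_closed expand)
  from fun_cong[OF this, of p]
  show "act \<rho> a (\<lambda>q. associated_form g K q (b q) (c q)) p + act \<rho> b (\<lambda>q. associated_form g K q (c q) (a q)) p
       + act \<rho> c (\<lambda>q. associated_form g K q (a q) (b q)) p
       - associated_form g K p (br a b p) (c p) - associated_form g K p (br b c p) (a p)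
       - associated_form g K p (br c a p) (b p) = 0"
    by simp
qed

end


theorem theorem6p1:
  fixes A :: "('m::{t2_space,second_countable_topology}, 'e::euclidean_space) atlas"
    and conn :: "('m \<Rightarrow> 'm tvec) \<Rightarrow> ('m \<Rightarrow> 'm tvec) \<Rightarrow> 'm \<Rightarrow> 'm tvec"
    and h :: "'m \<Rightarrow> ('m tvec \<Rightarrow> real) \<Rightarrow> ('m tvec \<Rightarrow> real) \<Rightarrow> real"
  assumes "affine_manifold A conn"
    and "symmetric_bivector_field A h"
  shows
    "((left_symmetric_algebroid A (cotangent_bundle A) (sharp A h) (bivector_product A conn h) \<and>
       compatible A (tangent_bundle A) id_anchor conn (sharp A h) (bivector_product A conn h))
      \<longleftrightarrow>
      (\<forall>\<alpha>\<in>sections (cotangent_bundle A). \<forall>\<beta>\<in>sections (cotangent_bundle A).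
       \<forall>\<gamma>\<in>sections (cotangent_bundle A).
         bivector_derivative A conn h (fib_app (sharp A h) \<alpha>) \<beta> \<gamma>
         - bivector_derivative A conn h (fib_app (sharp A h) \<beta>) \<alpha> \<gamma> = 0))
     \<and>
     ((left_symmetric_algebroid A (cotangent_bundle A) (sharp A h) (bivector_product A conn h) \<and>
       compatible A (tangent_bundle A) id_anchor conn (sharp A h) (bivector_product A conn h))
      \<longrightarrow>
      para_kaehler_lie_algebroid A (sum_bundle (tangent_bundle A) (cotangent_bundle A))
        (sum_anchor id_anchor zero_anchor) (triangle_bracket A conn)
        (bivector_metric h) (bivector_endo A h) \<and>
      symplectic_form A (sum_bundle (tangent_bundle A) (cotangent_bundle A))
        (sum_anchor id_anchor zero_anchor) (triangle_bracket A conn)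
        (associated_form (bivector_metric h) (bivector_endo A h)) \<and>
      (\<forall>p. \<forall>u\<in>fiber (tangent_bundle A) p. \<forall>\<xi>\<in>fiber (cotangent_bundle A) p.
           \<forall>v\<in>fiber (tangent_bundle A) p. \<forall>\<eta>\<in>fiber (cotangent_bundle A) p.
         associated_form (bivector_metric h) (bivector_endo A h) p (u, \<xi>) (v, \<eta>) = \<eta> u - \<xi> v))"
proof -
  interpret affine_bivector A conn h
    by unfold_locales (fact assms)+
  show ?thesis
    unfolding compatible_iff anchor_morphism_iff[symmetric]
    using para_kaehler symplectic associated_form_eq by simp
qed

end
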